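(* Let $F=\alpha^{1+m}\beta^{-m}$, $m\neq0$, be an $m$-Kropina metric of Berwald type on a smooth manifold $M$ with $\dim M>2$. Then $F$ is affinely Ricci-flat if and only if $F$ is locally metrizable and Ricci-flat.
   Context: Finsler metrics. Let $M$ be a smooth manifold of dimension $n$, with local coordinates $x^i$ and induced coordinates $(x,y)$ on $TM$ (a tangent vector is $y^i\partial_i$); write $\partial_i=\partial/\partial x^i$, $\bar\partial_i=\partial/\partial y^i$. A conic subbundle of $TM$ is an open subset $\mathcal A\subset TM$ such that $(x,\lambda y)\in\mathcal A$ for all $(x,y)\in\mathcal A$, $\lambda>0$, and whose projection to $M$ is all of $M$. A Finsler metric on $\mathcal A$ is a smooth map $F:\mathcal A\to[0,\infty)$ with $F(x,\lambda y)=\lambda F(x,y)$ for $\lambda>0$ and with nondegenerate fundamental tensor $g_{ij}=\bar\partial_i\bar\partial_j(\tfrac12F^2)$. Connection and curvature. The canonical nonlinear connection has coefficients $N^j_i=\tfrac14\bar\partial_i\big[g^{jk}(y^l\partial_l\bar\partial_kF^2-\partial_kF^2)\big]$. With $\delta_i=\partial_i-N^j_i\bar\partial_j$, its curvature is $R^k_{ij}=\delta_iN^k_j-\delta_jN^k_i$; put $\mathrm{Ric}=R^i_{ij}y^j$ and $R_{ij}=\tfrac12\bar\partial_i\bar\partial_j\mathrm{Ric}$ (the Finsler-Ricci tensor). $F$ is Ricci-flat if $R_{ij}=0$, equivalently $\mathrm{Ric}=0$. $F$ is of Berwald type if $N^k_i=\Gamma^k_{ij}(x)y^j$ for functions $\Gamma^k_{ij}$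 on the base; these are then the Christoffel symbols of a torsion-free affine connection on $M$, called the affine connection of $F$. The affine Ricci tensor is $\bar R_{lk}=\bar R^i{}_{lik}$, with $\bar R^k{}_{\ell ij}=\partial_i\Gamma^k_{j\ell}-\partial_j\Gamma^k_{i\ell}+\Gamma^k_{im}\Gamma^m_{j\ell}-\Gamma^k_{jm}\Gamma^m_{i\ell}$. A Berwald metric is affinely Ricci-flat if $\bar R_{ij}=0$. Metrizability. A Berwald metric $F$ is locally metrizable if each point of $M$ has a neighborhood admitting a pseudo-Riemannian metric whose Levi-Civita connection is the restriction of the affine connection of $F$. $m$-Kropina metrics. An $m$-Kropina metric is a Finsler metric of the form $F=\alpha^{1+m}\beta^{-m}$ with $\alpha=\sqrt{|a_{ij}y^iy^j|}$, $\beta=b_iy^i$, where $a$ is a (pseudo-)Riemannian metric of arbitrary signature and $b$ a 1-form on $M$, and $m\in\mathbb R$; $b$ is then nowhere vanishing. The trivial case $m=0$ is excluded. Indices are raised and lowered with $a_{ij}$, and $\mathring\nabla$, $\mathring\Gamma$ denote the Levi-Civita connection of $a$ and its Christoffel symbols. Known fact: for $n>2$, $F$ is of Berwald type iff there is a smooth vector field $f^i$ on $M$ with $\mathring\nabla_j b_i = m (f_k b^k)a_{ij} + b_i f_j - m f_i b_j$. In that case $f$ is unique and the affine connection of $F$ is $\Gamma^\ell_{ij}=\mathring\Gamma^\ell_{ij}+m a^{\ell k}(a_{ij}f_k-a_{jk}f_i-a_{ki}f_j)$. *)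

theory Defs
  imports "HOL-Analysis.Analysis"
begin

section \<open>Smooth maps on open subsets of normed spaces\<close>

(* For open S this is C^k in the usual sense. *)
primrec ck_on ::
  "nat \<Rightarrow> 'v::real_normed_vector set \<Rightarrow> ('v \<Rightarrow> 'w::real_normed_vector) \<Rightarrow> bool" where
  "ck_on 0 S f \<longleftrightarrow> continuous_on S f"
| "ck_on (Suc k) S f \<longleftrightarrow>
     (\<forall>x\<in>S. f differentiable (at x)) \<and> (\<forall>v. ck_on k S (\<lambda>x. frechet_derivative f (at x) v))"

definition smooth_on ::
  "'v::real_normed_vector set \<Rightarrow> ('v \<Rightarrow> 'w::real_normed_vector) \<Rightarrow> bool" where
  "smooth_on S f \<longleftrightarrow> (\<forall>k. ck_on k S f)"

definition pd :: "'n::finite \<Rightarrow> (real^'n \<Rightarrow> real) \<Rightarrow> real^'n \<Rightarrow> real" where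
  "pd i f x = frechet_derivative f (at x) (axis i 1)"


section \<open>Smooth manifolds\<close>

(* A chart is a pair (U, \<phi>); the values of \<phi> outside of U are irrelevant. *)
type_synonym ('a, 'n) chart = "'a set \<times> ('a \<Rightarrow> real^'n)"

definition is_chart :: "'a topology \<Rightarrow> ('a, 'n::finite) chart \<Rightarrow> bool" where
  "is_chart M c \<longleftrightarrow> openin M (fst c) \<and> open (snd c ` fst c) \<and>
     homeomorphic_map (subtopology M (fst c)) (top_of_set (snd c ` fst c)) (snd c)"

definition transition :: "('a, 'n::finite) chart \<Rightarrow> ('a, 'n) chart \<Rightarrow> real^'n \<Rightarrow> real^'n" where
  "transition c d = snd d \<circ> inv_into (fst c) (snd c)"

definition smooth_manifold :: "'a topology \<Rightarrow> ('a, 'n::finite) chart set \<Rightarrow> bool" where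
  "smooth_manifold M At \<longleftrightarrow>
     Hausdorff_space M \<and> second_countable M \<and>
     (\<forall>c\<in>At. is_chart M c) \<and> \<Union>(fst ` At) = topspace M \<and>
     (\<forall>c\<in>At. \<forall>d\<in>At. smooth_on (snd c ` (fst c \<inter> fst d)) (transition c d))"


section \<open>The tangent bundle\<close>

definition charts_at :: "('a, 'n::finite) chart set \<Rightarrow> 'a \<Rightarrow> ('a, 'n) chart set" where
  "charts_at At p = {c\<in>At. p \<in> fst c}"

(* A tangent vector at p is given by its components with respect to every chart of the atlas
   around p, subject to the transformation law; charts not containing p get the dummy value 0.
   The vector space operations are the pointwise ones. *)
type_synonym ('a, 'n) tvec = "('a, 'n) chart \<Rightarrow> real^'n"

definition tangent_space :: "('a, 'n::finite) chart set \<Rightarrow> 'a \<Rightarrow> ('a, 'n) tvec set" where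
  "tangent_space At p = {v.
     (\<forall>c. c \<notin> charts_at At p \<longrightarrow> v c = 0) \<and>
     (\<forall>c\<in>charts_at At p. \<forall>d\<in>charts_at At p.
        v d = frechet_derivative (transition c d) (at (snd c p)) (v c))}"

definition tangent_bundle :: "('a, 'n::finite) chart set \<Rightarrow> ('a \<times> ('a, 'n) tvec) set" where
  "tangent_bundle At = (SIGMA p:\<Union>(fst ` At). tangent_space At p)"

(* The induced coordinates (x, y) on TM and their inverse. *)
definition tcoord ::
  "('a, 'n::finite) chart \<Rightarrow> 'a \<times> ('a, 'n) tvec \<Rightarrow> (real^'n) \<times> (real^'n)" where
  "tcoord c V = (snd c (fst V), snd V c)"

definition over :: "('a, 'n) chart \<Rightarrow> ('a \<times> ('a, 'n) tvec) set \<Rightarrow> ('a \<times> ('a, 'n) tvec) set" where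
  "over c A = {V\<in>A. fst V \<in> fst c}"

definition tcoord_inv ::
  "('a, 'n::finite) chart set \<Rightarrow> ('a, 'n) chart \<Rightarrow> (real^'n) \<times> (real^'n) \<Rightarrow> 'a \<times> ('a, 'n) tvec" where
  "tcoord_inv At c = inv_into (over c (tangent_bundle At)) (tcoord c)"

definition coord_vec ::
  "('a, 'n::finite) chart set \<Rightarrow> ('a, 'n) chart \<Rightarrow> 'n \<Rightarrow> real^'n \<Rightarrow> ('a, 'n) tvec" where
  "coord_vec At c i x = snd (tcoord_inv At c (x, axis i 1))"

definition open_in_tangent_bundle ::
  "('a, 'n::finite) chart set \<Rightarrow> ('a \<times> ('a, 'n) tvec) set \<Rightarrow> bool" where
  "open_in_tangent_bundle At A \<longleftrightarrow>
     A \<subseteq> tangent_bundle At \<and> (\<forall>c\<in>At. open (tcoord c ` over c A))"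

definition conic_subbundle ::
  "('a, 'n::finite) chart set \<Rightarrow> ('a \<times> ('a, 'n) tvec) set \<Rightarrow> bool" where
  "conic_subbundle At A \<longleftrightarrow>
     open_in_tangent_bundle At A \<and>
     (\<forall>(p, v)\<in>A. \<forall>r>0. (p, \<lambda>c. r *\<^sub>R v c) \<in> A) \<and>
     fst ` A = \<Union>(fst ` At)"


section \<open>One-forms and pseudo-Riemannian metrics on an open subset W\<close>

definition one_form ::
  "('a, 'n::finite) chart set \<Rightarrow> 'a set \<Rightarrow> ('a \<Rightarrow> ('a, 'n) tvec \<Rightarrow> real) \<Rightarrow> bool" where
  "one_form At W b \<longleftrightarrow>
     (\<forall>p\<in>W. \<forall>v\<in>tangent_space At p. \<forall>w\<in>tangent_space At p. \<forall>r s.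
        b p (\<lambda>c. r *\<^sub>R v c + s *\<^sub>R w c) = r * b p v + s * b p w) \<and>
     (\<forall>c\<in>At. \<forall>i. smooth_on (snd c ` (fst c \<inter> W))
        (\<lambda>x. b (inv_into (fst c) (snd c) x) (coord_vec At c i x)))"

definition metric_comp ::
  "('a, 'n::finite) chart set \<Rightarrow> ('a \<Rightarrow> ('a, 'n) tvec \<Rightarrow> ('a, 'n) tvec \<Rightarrow> real) \<Rightarrow>
   ('a, 'n) chart \<Rightarrow> 'n \<Rightarrow> 'n \<Rightarrow> real^'n \<Rightarrow> real" where
  "metric_comp At h c i j x =
     h (inv_into (fst c) (snd c) x) (coord_vec At c i x) (coord_vec At c j x)"

definition pseudo_riemannian_metric ::
  "('a, 'n::finite) chart set \<Rightarrow> 'a set \<Rightarrow>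
   ('a \<Rightarrow> ('a, 'n) tvec \<Rightarrow> ('a, 'n) tvec \<Rightarrow> real) \<Rightarrow> bool" where
  "pseudo_riemannian_metric At W h \<longleftrightarrow>
     (\<forall>p\<in>W. \<forall>u\<in>tangent_space At p. \<forall>v\<in>tangent_space At p. \<forall>w\<in>tangent_space At p. \<forall>r s.
        h p (\<lambda>c. r *\<^sub>R u c + s *\<^sub>R v c) w = r * h p u w + s * h p v w) \<and>
     (\<forall>p\<in>W. \<forall>v\<in>tangent_space At p. \<forall>w\<in>tangent_space At p. h p v w = h p w v) \<and>
     (\<forall>p\<in>W. \<forall>v\<in>tangent_space At p.
        (\<forall>w\<in>tangent_space At p. h p v w = 0) \<longrightarrow> v = (\<lambda>_. 0)) \<and>
     (\<forall>c\<in>At. \<forall>i j. smooth_on (snd c ` (fst c \<inter> W)) (metric_comp At h c i j))"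

(* levi_civita At h c k i j is \<Gamma>^k_{ij} in the chart c. *)
definition levi_civita ::
  "('a, 'n::finite) chart set \<Rightarrow> ('a \<Rightarrow> ('a, 'n) tvec \<Rightarrow> ('a, 'n) tvec \<Rightarrow> real) \<Rightarrow>
   ('a, 'n) chart \<Rightarrow> 'n \<Rightarrow> 'n \<Rightarrow> 'n \<Rightarrow> real^'n \<Rightarrow> real" where
  "levi_civita At h c k i j x = 1/2 *
     (\<Sum>l\<in>UNIV. matrix_inv (\<chi> r s. metric_comp At h c r s x) $ k $ l *
        (pd i (metric_comp At h c j l) x + pd j (metric_comp At h c i l) x
          - pd l (metric_comp At h c i j) x))"


section \<open>Finsler geometry in induced coordinates\<close>

text \<open>In this section a real function of (x, y) stands for the expression of a function on
  (a part of) the tangent bundle in the coordinates induced by some chart.\<close>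

type_synonym 'n tfun = "(real^'n) \<times> (real^'n) \<Rightarrow> real"

definition pdx :: "'n::finite \<Rightarrow> 'n tfun \<Rightarrow> 'n tfun" where
  "pdx i f z = frechet_derivative f (at z) (axis i 1, 0)"

definition pdy :: "'n::finite \<Rightarrow> 'n tfun \<Rightarrow> 'n tfun" where
  "pdy i f z = frechet_derivative f (at z) (0, axis i 1)"

definition fundamental_tensor ::
  "'n::finite tfun \<Rightarrow> (real^'n) \<times> (real^'n) \<Rightarrow> real^'n^'n" where
  "fundamental_tensor L z = (\<chi> i j. pdy i (pdy j (\<lambda>z. 1/2 * (L z)\<^sup>2)) z)"

(* nonlin_conn L j i is N^j_i. *)
definition nonlin_conn :: "'n::finite tfun \<Rightarrow> 'n \<Rightarrow> 'n \<Rightarrow> 'n tfun" where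
  "nonlin_conn L j i z = 1/4 *
     pdy i (\<lambda>z. \<Sum>k\<in>UNIV. matrix_inv (fundamental_tensor L z) $ j $ k *
       ((\<Sum>l\<in>UNIV. snd z $ l * pdx l (pdy k (\<lambda>z. (L z)\<^sup>2)) z) - pdx k (\<lambda>z. (L z)\<^sup>2) z)) z"

definition horiz_deriv :: "'n::finite tfun \<Rightarrow> 'n \<Rightarrow> 'n tfun \<Rightarrow> 'n tfun" where
  "horiz_deriv L i f z = pdx i f z - (\<Sum>j\<in>UNIV. nonlin_conn L j i z * pdy j f z)"

(* nonlin_curv L k i j is R^k_{ij}. *)
definition nonlin_curv :: "'n::finite tfun \<Rightarrow> 'n \<Rightarrow> 'n \<Rightarrow> 'n \<Rightarrow> 'n tfun" where
  "nonlin_curv L k i j z =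
     horiz_deriv L i (nonlin_conn L k j) z - horiz_deriv L j (nonlin_conn L k i) z"

definition finsler_Ric :: "'n::finite tfun \<Rightarrow> 'n tfun" where
  "finsler_Ric L z = (\<Sum>i\<in>UNIV. \<Sum>j\<in>UNIV. nonlin_curv L i i j z * snd z $ j)"

definition finsler_ricci_tensor :: "'n::finite tfun \<Rightarrow> 'n \<Rightarrow> 'n \<Rightarrow> 'n tfun" where
  "finsler_ricci_tensor L i j z = 1/2 * pdy i (pdy j (finsler_Ric L)) z"


section \<open>Curvature of an affine connection given by Christoffel symbols\<close>

(* G k i j is \<Gamma>^k_{ij}; affine_curv G k l i j is the curvature with upper index k and
   lower indices l, i, j. *)
definition affine_curv ::
  "('n \<Rightarrow> 'n \<Rightarrow> 'n \<Rightarrow> real^'n \<Rightarrow> real) \<Rightarrow> 'n::finite \<Rightarrow> 'n \<Rightarrow> 'n \<Rightarrow> 'n \<Rightarrow> real^'n \<Rightarrow> real" where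
  "affine_curv G k l i j x =
     pd i (G k j l) x - pd j (G k i l) x
     + (\<Sum>m\<in>UNIV. G k i m x * G m j l x) - (\<Sum>m\<in>UNIV. G k j m x * G m i l x)"

definition affine_ricci ::
  "('n \<Rightarrow> 'n \<Rightarrow> 'n \<Rightarrow> real^'n \<Rightarrow> real) \<Rightarrow> 'n::finite \<Rightarrow> 'n \<Rightarrow> real^'n \<Rightarrow> real" where
  "affine_ricci G l k x = (\<Sum>i\<in>UNIV. affine_curv G i l i k x)"


section \<open>Finsler metrics on a manifold\<close>

definition local_rep ::
  "('a, 'n::finite) chart set \<Rightarrow> ('a \<times> ('a, 'n) tvec \<Rightarrow> real) \<Rightarrow> ('a, 'n) chart \<Rightarrow> 'n tfun" where
  "local_rep At F c z = F (tcoord_inv At c z)"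

definition finsler_metric ::
  "('a, 'n::finite) chart set \<Rightarrow> ('a \<times> ('a, 'n) tvec) set \<Rightarrow>
   ('a \<times> ('a, 'n) tvec \<Rightarrow> real) \<Rightarrow> bool" where
  "finsler_metric At A F \<longleftrightarrow>
     conic_subbundle At A \<and>
     (\<forall>V\<in>A. 0 \<le> F V) \<and>
     (\<forall>c\<in>At. smooth_on (tcoord c ` over c A) (local_rep At F c)) \<and>
     (\<forall>(p, v)\<in>A. \<forall>r>0. F (p, \<lambda>c. r *\<^sub>R v c) = r * F (p, v)) \<and>
     (\<forall>c\<in>At. \<forall>z\<in>tcoord c ` over c A. invertible (fundamental_tensor (local_rep At F c) z))"

definition ricci_flat ::
  "('a, 'n::finite) chart set \<Rightarrow> ('a \<times> ('a, 'n) tvec) set \<Rightarrow>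
   ('a \<times> ('a, 'n) tvec \<Rightarrow> real) \<Rightarrow> bool" where
  "ricci_flat At A F \<longleftrightarrow>
     (\<forall>c\<in>At. \<forall>z\<in>tcoord c ` over c A. \<forall>i j.
        finsler_ricci_tensor (local_rep At F c) i j z = 0)"

definition berwald_coeffs ::
  "('a, 'n::finite) chart set \<Rightarrow> ('a \<times> ('a, 'n) tvec) set \<Rightarrow>
   ('a \<times> ('a, 'n) tvec \<Rightarrow> real) \<Rightarrow> ('a, 'n) chart \<Rightarrow>
   ('n \<Rightarrow> 'n \<Rightarrow> 'n \<Rightarrow> real^'n \<Rightarrow> real) \<Rightarrow> bool" where
  "berwald_coeffs At A F c G \<longleftrightarrow>
     (\<forall>(x, y)\<in>tcoord c ` over c A. \<forall>k i.
        nonlin_conn (local_rep At F c) k i (x, y) = (\<Sum>j\<in>UNIV. G k i j x * y $ j))"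

definition berwald ::
  "('a, 'n::finite) chart set \<Rightarrow> ('a \<times> ('a, 'n) tvec) set \<Rightarrow>
   ('a \<times> ('a, 'n) tvec \<Rightarrow> real) \<Rightarrow> bool" where
  "berwald At A F \<longleftrightarrow> (\<forall>c\<in>At. \<exists>G. berwald_coeffs At A F c G)"

(* The coefficients are uniquely determined on the image of the chart, because every fibre of a
   conic subbundle is open and non-empty; outside of the image they are irrelevant. *)
definition affine_connection ::
  "('a, 'n::finite) chart set \<Rightarrow> ('a \<times> ('a, 'n) tvec) set \<Rightarrow>
   ('a \<times> ('a, 'n) tvec \<Rightarrow> real) \<Rightarrow> ('a, 'n) chart \<Rightarrow>
   'n \<Rightarrow> 'n \<Rightarrow> 'n \<Rightarrow> real^'n \<Rightarrow> real" where
  "affine_connection At A F c = (SOME G. berwald_coeffs At A F c G)"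

definition affinely_ricci_flat ::
  "('a, 'n::finite) chart set \<Rightarrow> ('a \<times> ('a, 'n) tvec) set \<Rightarrow>
   ('a \<times> ('a, 'n) tvec \<Rightarrow> real) \<Rightarrow> bool" where
  "affinely_ricci_flat At A F \<longleftrightarrow>
     (\<forall>c\<in>At. \<forall>x\<in>snd c ` fst c. \<forall>i j. affine_ricci (affine_connection At A F c) i j x = 0)"

definition locally_metrizable ::
  "'a topology \<Rightarrow> ('a, 'n::finite) chart set \<Rightarrow> ('a \<times> ('a, 'n) tvec) set \<Rightarrow>
   ('a \<times> ('a, 'n) tvec \<Rightarrow> real) \<Rightarrow> bool" where
  "locally_metrizable M At A F \<longleftrightarrow>
     (\<forall>p\<in>topspace M. \<exists>W h. openin M W \<and> p \<in> W \<and> pseudo_riemannian_metric At W h \<and>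
        (\<forall>c\<in>At. \<forall>x\<in>snd c ` (fst c \<inter> W). \<forall>k i j.
           levi_civita At h c k i j x = affine_connection At A F c k i j x))"


section \<open>m-Kropina metrics\<close>

(* Real powers, including integral powers of negative numbers (for which powr is of no use). *)
definition rpow :: "real \<Rightarrow> real \<Rightarrow> real" where
  "rpow t e = (if e \<in> \<int> then t powi \<lfloor>e\<rfloor> else t powr e)"

definition rpow_defined :: "real \<Rightarrow> real \<Rightarrow> bool" where
  "rpow_defined t e \<longleftrightarrow> t > 0 \<or> (t = 0 \<and> e \<ge> 0) \<or> (t < 0 \<and> e \<in> \<int>)"

definition kropina_metric ::
  "'a topology \<Rightarrow> ('a, 'n::finite) chart set \<Rightarrow> ('a \<times> ('a, 'n) tvec) set \<Rightarrow>
   ('a \<times> ('a, 'n) tvec \<Rightarrow> real) \<Rightarrow> real \<Rightarrow>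
   ('a \<Rightarrow> ('a, 'n) tvec \<Rightarrow> ('a, 'n) tvec \<Rightarrow> real) \<Rightarrow> ('a \<Rightarrow> ('a, 'n) tvec \<Rightarrow> real) \<Rightarrow> bool" where
  "kropina_metric M At A F m a b \<longleftrightarrow>
     finsler_metric At A F \<and>
     pseudo_riemannian_metric At (topspace M) a \<and>
     one_form At (topspace M) b \<and>
     (\<forall>(p, v)\<in>A.
        rpow_defined (sqrt \<bar>a p v v\<bar>) (1 + m) \<and> rpow_defined (b p v) (- m) \<and>
        F (p, v) = rpow (sqrt \<bar>a p v v\<bar>) (1 + m) * rpow (b p v) (- m))"

end

theory Submission
  imports Defs
begin

text \<open>For a Berwald metric the Finsler--Ricci tensor is the symmetric part of the affine Ricci tensor,
  and the antisymmetric part is the exterior derivative of the trace \<open>\<Gamma>\<^sup>l\<^sub>l\<^sub>k\<close>. For a Levi-Civita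
  connection this trace is closed, since it is half the logarithmic differential of the determinant of
  the metric; this gives one direction.

  For the other direction, the horizontal derivative of \<open>F\<^sup>2\<close> vanishes, and for a Kropina metric this
  says \<open>(1 + m) (\<nabla>a)(y, y) \<beta>(y) = 2 m a(y, y) (\<nabla>\<beta>)(y)\<close> for all \<open>y\<close>. Nondegeneracy of the fundamental
  tensor excludes \<open>b = 0\<close> and \<open>m = - 1\<close>. As \<open>a(y, y)\<close> is an irreducible polynomial for \<open>n > 2\<close>,
  \<open>\<nabla>a = \<kappa> \<otimes> a\<close> for a 1-form \<open>\<kappa>\<close>, that is, \<open>\<nabla>\<close> is a Weyl connection. Taking the trace,
  \<open>n \<kappa>\<^sub>k = \<partial>\<^sub>k ln \<bar>det a\<bar> - 2 \<Gamma>\<^sup>l\<^sub>l\<^sub>k\<close>, so \<open>\<kappa>\<close> is closed if the affine Ricci tensor is symmetric.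
  Locally \<open>\<kappa> = d\<psi>\<close>, and \<open>\<nabla>\<close> is the Levi-Civita connection of \<open>exp (- \<psi>) a\<close>. That \<open>\<kappa>\<close> does not
  depend on the chart follows from the uniqueness of the torsion-free connection preserving \<open>F\<close>.\<close>

section \<open>Calculus of smooth maps\<close>

text \<open>\<open>ricci_flat\<close> sees only a quadratic form in y, so it loses the antisymmetric
  part of the affine Ricci tensor; local metrizability restores exactly that part. The domain
  \<open>A\<close> is only an open cone in each fibre and may miss directions where a(y, y) or
  \<beta>(y) vanishes. Tensor identities are therefore obtained on an open part of a fibre and then
  extended to all vectors as identities of polynomials; regularity in the base point plays no part
  in this. Accordingly the divisibility argument produces \<kappa> one point at a time, with no
  control over its dependence on the point. The trace formula supplies its smoothness as well as its
  exterior derivative. Local metrizability demands agreement with the Levi-Civita connection in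
  every chart of the atlas, whereas \<psi> is built in a single chart, on a ball. This is why a
  transformation law for \<kappa> is needed. \<open>affine_connection\<close> chooses its
  coefficients separately in each chart, so their behaviour under a change of chart has to be
  derived from the invariance of \<open>F\<close> as well.\<close>

abbreviation dd :: "('v::real_normed_vector \<Rightarrow> 'w::real_normed_vector) \<Rightarrow> 'v \<Rightarrow> 'v \<Rightarrow> 'w" where
  "dd f x \<equiv> frechet_derivative f (at x)"

lemma dd_eqI: "(f has_derivative f') (at x) \<Longrightarrow> dd f x = f'"
  by (metis frechet_derivative_at)

lemma has_derivative_dd: "f differentiable (at x) \<Longrightarrow> (f has_derivative dd f x) (at x)"
  by (simp add: frechet_derivative_works)

lemma dd_cong:
  assumes "open S" "x \<in> S" "\<And>y. y \<in> S \<Longrightarrow> f y = g y"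
  shows "dd f x = dd g x"
proof -
  have "(f has_derivative D) (at x) \<longleftrightarrow> (g has_derivative D) (at x)" for D
  proof
    assume "(f has_derivative D) (at x)"
    then show "(g has_derivative D) (at x)"
      by (rule has_derivative_transform_within_open[OF _ assms(1,2)]) (rule assms(3))
  next
    assume "(g has_derivative D) (at x)"
    then show "(f has_derivative D) (at x)"
      by (rule has_derivative_transform_within_open[OF _ assms(1,2)]) (rule assms(3)[symmetric])
  qed
  then show ?thesis by (simp add: frechet_derivative_def)
qed

lemma differentiable_cong:
  assumes "open S" "x \<in> S" "\<And>y. y \<in> S \<Longrightarrow> f y = g y" "f differentiable (at x)"
  shows "g differentiable (at x)"
proof -
  have "(g has_derivative dd f x) (at x)"
    by (rule has_derivative_transform_within_open[OF has_derivative_dd[OF assms(4)] assms(1,2)]) (rule assms(3))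
  then show ?thesis by (auto simp: differentiable_def)
qed

lemma ck_on_cong:
  assumes "open S" "\<And>x. x \<in> S \<Longrightarrow> f x = g x" "ck_on k S f"
  shows "ck_on k S g"
  using assms
proof (induction k arbitrary: f g)
  case 0
  then show ?case by (simp cong: continuous_on_cong)
next
  case (Suc k)
  have "ck_on k S (\<lambda>x. dd g x v)" for v
  proof (rule Suc.IH[OF Suc.prems(1)])
    show "dd f x v = dd g x v" if "x \<in> S" for x
      using dd_cong[OF Suc.prems(1) that Suc.prems(2)] by simp
    show "ck_on k S (\<lambda>x. dd f x v)" using Suc.prems(3) by simp
  qed
  moreover have "g differentiable (at x)" if "x \<in> S" for x
    using differentiable_cong[OF Suc.prems(1) that Suc.prems(2)] Suc.prems(3) that by simp
  ultimately show ?case by simp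
qed

lemma ck_on_subset: "ck_on k S f \<Longrightarrow> T \<subseteq> S \<Longrightarrow> ck_on k T f"
  by (induction k arbitrary: f) (auto intro: continuous_on_subset)

lemma ck_on_Suc: "ck_on (Suc k) S f \<Longrightarrow> ck_on k S f"
proof (induction k arbitrary: f)
  case 0
  then show ?case
    by (simp add: continuous_at_imp_continuous_on differentiable_imp_continuous_within)
next
  case (Suc k)
  then show ?case by (metis ck_on.simps(2))
qed

lemma ck_on_locally:
  assumes "\<And>x. x \<in> S \<Longrightarrow> \<exists>T. open T \<and> x \<in> T \<and> ck_on k T f"
  shows "ck_on k S f"
  using assms
proof (induction k arbitrary: f)
  case 0
  then show ?case
    by (metis ck_on.simps(1) continuous_at_imp_continuous_on continuous_on_eq_continuous_at)
next
  case (Suc k)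
  then show ?case by (metis ck_on.simps(2))
qed

lemma ck_on_const: "ck_on k S (\<lambda>x. c)"
  by (induction k arbitrary: c) auto

lemma ck_on_bounded_linear:
  assumes "bounded_linear f"
  shows "ck_on k S f"
proof (cases k)
  case 0
  then show ?thesis using assms by (simp add: linear_continuous_on)
next
  case (Suc j)
  have "dd f x = f" for x
    by (rule dd_eqI) (use assms in \<open>rule bounded_linear_imp_has_derivative\<close>)
  then show ?thesis
    using assms by (simp add: Suc ck_on_const bounded_linear_imp_differentiable)
qed

lemma dd_add:
  "f differentiable (at x) \<Longrightarrow> g differentiable (at x) \<Longrightarrow>
    dd (\<lambda>x. f x + g x) x v = dd f x v + dd g x v"
  by (subst dd_eqI[OF has_derivative_add[OF has_derivative_dd has_derivative_dd]]) auto

lemma dd_diff: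
  "f differentiable (at x) \<Longrightarrow> g differentiable (at x) \<Longrightarrow>
    dd (\<lambda>x. f x - g x) x v = dd f x v - dd g x v"
  by (subst dd_eqI[OF has_derivative_diff[OF has_derivative_dd has_derivative_dd]]) auto

lemma dd_sum:
  "(\<And>i. i \<in> I \<Longrightarrow> f i differentiable (at x)) \<Longrightarrow>
    dd (\<lambda>x. \<Sum>i\<in>I. f i x) x v = (\<Sum>i\<in>I. dd (f i) x v)"
  by (subst dd_eqI[OF has_derivative_sum[OF has_derivative_dd]]) auto

lemma dd_mult:
  fixes f g :: "'v::real_normed_vector \<Rightarrow> real"
  shows "f differentiable (at x) \<Longrightarrow> g differentiable (at x) \<Longrightarrow>
    dd (\<lambda>x. f x * g x) x v = f x * dd g x v + dd f x v * g x"
  by (subst dd_eqI[OF has_derivative_mult[OF has_derivative_dd has_derivative_dd]]) auto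

lemma dd_cmult:
  fixes f :: "'v::real_normed_vector \<Rightarrow> real"
  shows "f differentiable (at x) \<Longrightarrow> dd (\<lambda>x. c * f x) x v = c * dd f x v"
  by (subst dd_mult) auto

lemma ck_on_add:
  assumes "open S"
  shows "ck_on k S f \<Longrightarrow> ck_on k S g \<Longrightarrow> ck_on k S (\<lambda>x. f x + g x)"
proof (induction k arbitrary: f g)
  case 0
  then show ?case by (simp add: continuous_on_add)
next
  case (Suc k)
  have "ck_on k S (\<lambda>x. dd (\<lambda>x. f x + g x) x v)" for v
    by (rule ck_on_cong[OF assms, rotated], rule Suc.IH[of "\<lambda>x. dd f x v" "\<lambda>x. dd g x v"])
      (use Suc.prems in \<open>auto simp: dd_add\<close>)
  then show ?case using Suc.prems by simp
qed

lemma ck_on_mult: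
  fixes f g :: "'v::real_normed_vector \<Rightarrow> real"
  assumes "open S"
  shows "ck_on k S f \<Longrightarrow> ck_on k S g \<Longrightarrow> ck_on k S (\<lambda>x. f x * g x)"
proof (induction k arbitrary: f g)
  case 0
  then show ?case by (simp add: continuous_on_mult)
next
  case (Suc k)
  have "ck_on k S (\<lambda>x. dd (\<lambda>x. f x * g x) x v)" for v
    by (rule ck_on_cong[OF assms, rotated],
        rule ck_on_add[OF assms Suc.IH[of f "\<lambda>x. dd g x v"] Suc.IH[of "\<lambda>x. dd f x v" g]])
      (use Suc.prems ck_on_Suc in \<open>auto simp: dd_mult\<close>)
  then show ?case using Suc.prems by simp
qed

lemma ck_on_sum:
  fixes f :: "'i \<Rightarrow> 'v::real_normed_vector \<Rightarrow> 'w::real_normed_vector"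
  assumes "open S" "\<And>i. i \<in> I \<Longrightarrow> ck_on k S (f i)"
  shows "ck_on k S (\<lambda>x. \<Sum>i\<in>I. f i x)"
  using assms(2) by (induction I rule: infinite_finite_induct) (auto simp: ck_on_const ck_on_add[OF assms(1)])

lemma ck_on_prod:
  fixes f :: "'i \<Rightarrow> 'v::real_normed_vector \<Rightarrow> real"
  assumes "open S" "\<And>i. i \<in> I \<Longrightarrow> ck_on k S (f i)"
  shows "ck_on k S (\<lambda>x. \<Prod>i\<in>I. f i x)"
  using assms(2) by (induction I rule: infinite_finite_induct) (auto simp: ck_on_const ck_on_mult[OF assms(1)])

lemma ck_on_inverse:
  fixes f :: "'v::real_normed_vector \<Rightarrow> real"
  assumes "open S" "\<And>x. x \<in> S \<Longrightarrow> f x \<noteq> 0"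
  shows "ck_on k S f \<Longrightarrow> ck_on k S (\<lambda>x. inverse (f x))"
proof (induction k)
  case 0
  then show ?case using assms by (simp add: continuous_on_inverse)
next
  case (Suc k)
  have der: "((\<lambda>x. inverse (f x)) has_derivative (\<lambda>v. - 1 * (inverse (f x) * (inverse (f x) * dd f x v)))) (at x)"
    if "x \<in> S" for x
    using Suc.prems that
    by (intro has_derivative_eq_rhs[OF Deriv.has_derivative_inverse[OF _ has_derivative_dd]]) (auto simp: assms(2))
  have IH: "ck_on k S (\<lambda>x. inverse (f x))"
    by (rule Suc.IH) (use Suc.prems ck_on_Suc in blast)
  have "ck_on k S (\<lambda>x. - 1 * (inverse (f x) * (inverse (f x) * dd f x v)))" for v
    by (intro ck_on_mult[OF assms(1)] ck_on_const IH) (use Suc.prems in simp)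
  then have "ck_on k S (\<lambda>x. dd (\<lambda>x. inverse (f x)) x v)" for v
    by (rule ck_on_cong[OF assms(1), rotated, where f="\<lambda>x. - 1 * (inverse (f x) * (inverse (f x) * dd f x v))"])
      (simp add: dd_eqI[OF der])
  moreover have "(\<lambda>x. inverse (f x)) differentiable (at x)" if "x \<in> S" for x
    using der[OF that] by (auto simp: differentiable_def)
  ultimately show ?case by simp
qed

lemma ck_on_exp:
  fixes f :: "'v::real_normed_vector \<Rightarrow> real"
  assumes "open S"
  shows "ck_on k S f \<Longrightarrow> ck_on k S (\<lambda>x. exp (f x))"
proof (induction k)
  case 0
  then show ?case by (simp add: continuous_on_exp)
next
  case (Suc k)
  have der: "((\<lambda>x. exp (f x)) has_derivative (\<lambda>v. exp (f x) * dd f x v)) (at x)"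
    if "x \<in> S" for x
    using Suc.prems that by (intro has_derivative_eq_rhs[OF has_derivative_exp[OF has_derivative_dd]]) auto
  have IH: "ck_on k S (\<lambda>x. exp (f x))"
    by (rule Suc.IH) (use Suc.prems ck_on_Suc in blast)
  have "ck_on k S (\<lambda>x. exp (f x) * dd f x v)" for v
    by (intro ck_on_mult[OF assms] IH) (use Suc.prems in simp)
  then have "ck_on k S (\<lambda>x. dd (\<lambda>x. exp (f x)) x v)" for v
    by (rule ck_on_cong[OF assms, rotated]) (simp add: dd_eqI[OF der])
  moreover have "(\<lambda>x. exp (f x)) differentiable (at x)" if "x \<in> S" for x
    using der[OF that] by (auto simp: differentiable_def)
  ultimately show ?case by simp
qed

text \<open>Freezing the fibre vector turns a smooth function on the tangent bundle into one on the
  base; the smoothness of the Christoffel symbols is obtained in this way.\<close>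

lemma ck_on_slice:
  fixes f :: "('v::real_normed_vector \<times> 'u::real_normed_vector) \<Rightarrow> 'w::real_normed_vector"
  assumes "open \<Omega>" "open S" "\<And>x. x \<in> S \<Longrightarrow> (x, y) \<in> \<Omega>"
  shows "ck_on k \<Omega> f \<Longrightarrow> ck_on k S (\<lambda>x. f (x, y))"
proof (induction k arbitrary: f)
  case 0
  then show ?case
    using assms by (auto intro!: continuous_on_compose2[of \<Omega> f] continuous_intros)
next
  case (Suc k)
  have der: "((\<lambda>x. f (x, y)) has_derivative (\<lambda>v. dd f (x, y) (v, 0))) (at x)"
    if "x \<in> S" for x
  proof -
    have "(f has_derivative dd f (x, y)) (at (x, y))"
      using Suc.prems assms(3)[OF that] by (simp add: has_derivative_dd)
    moreover have "((\<lambda>x. (x, y)) has_derivative (\<lambda>v. (v, 0))) (at x)"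
      by (intro has_derivative_Pair has_derivative_const has_derivative_ident)
    ultimately show ?thesis
      by (rule has_derivative_compose[rotated])
  qed
  have "ck_on k S (\<lambda>x. dd f (x, y) (v, 0))" for v
    using Suc.IH[of "\<lambda>z. dd f z (v, 0)"] Suc.prems by simp
  then have "ck_on k S (\<lambda>x. dd (\<lambda>x. f (x, y)) x v)" for v
    by (rule ck_on_cong[OF assms(2), rotated]) (simp add: dd_eqI[OF der])
  moreover have "(\<lambda>x. f (x, y)) differentiable (at x)" if "x \<in> S" for x
    using der[OF that] by (auto simp: differentiable_def)
  ultimately show ?case by simp
qed

lemma smooth_on_differentiable: "smooth_on S f \<Longrightarrow> x \<in> S \<Longrightarrow> f differentiable (at x)"
  unfolding smooth_on_def by (metis ck_on.simps(2))

lemma smooth_on_has_derivative: "smooth_on S f \<Longrightarrow> x \<in> S \<Longrightarrow> (f has_derivative dd f x) (at x)"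
  by (intro has_derivative_dd smooth_on_differentiable)

lemma smooth_on_continuous: "smooth_on S f \<Longrightarrow> continuous_on S f"
  unfolding smooth_on_def by (metis ck_on.simps(1))

lemma smooth_on_dd: "smooth_on S f \<Longrightarrow> smooth_on S (\<lambda>x. dd f x v)"
  unfolding smooth_on_def by (metis ck_on.simps(2))

text \<open>A potential obtained by integration is known only through its derivative; this is
  enough, since \<open>ck_on (Suc k)\<close> refers to nothing else.\<close>

lemma smooth_on_if_derivative:
  assumes "open S" "\<And>x. x \<in> S \<Longrightarrow> (f has_derivative D x) (at x)" "\<And>v. smooth_on S (\<lambda>x. D x v)"
  shows "smooth_on S f"
proof -
  have *: "ck_on (Suc k) S f" for k
    using assms dd_eqI[OF assms(2)]
    by (auto simp: smooth_on_def differentiable_def intro!: ck_on_cong[where f="\<lambda>x. D x _" and g="\<lambda>x. dd f x _"])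
  have "ck_on k S f" for k by (cases k) (use * ck_on_Suc in blast)+
  then show ?thesis by (simp add: smooth_on_def)
qed

lemma smooth_on_cong:
  "open S \<Longrightarrow> (\<And>x. x \<in> S \<Longrightarrow> f x = g x) \<Longrightarrow> smooth_on S f \<Longrightarrow> smooth_on S g"
  unfolding smooth_on_def using ck_on_cong by blast

lemma smooth_on_subset: "smooth_on S f \<Longrightarrow> T \<subseteq> S \<Longrightarrow> smooth_on T f"
  unfolding smooth_on_def using ck_on_subset by blast

lemma smooth_on_locally:
  "(\<And>x. x \<in> S \<Longrightarrow> \<exists>T. open T \<and> x \<in> T \<and> smooth_on T f) \<Longrightarrow> smooth_on S f"
  unfolding smooth_on_def by (meson ck_on_locally)

lemma smooth_on_const: "smooth_on S (\<lambda>x. c)"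
  by (simp add: smooth_on_def ck_on_const)

lemma smooth_on_bounded_linear: "bounded_linear f \<Longrightarrow> smooth_on S f"
  by (simp add: smooth_on_def ck_on_bounded_linear)

lemma smooth_on_add: "open S \<Longrightarrow> smooth_on S f \<Longrightarrow> smooth_on S g \<Longrightarrow> smooth_on S (\<lambda>x. f x + g x)"
  by (simp add: smooth_on_def ck_on_add)

lemma smooth_on_sum: "open S \<Longrightarrow> (\<And>i. i \<in> I \<Longrightarrow> smooth_on S (f i)) \<Longrightarrow> smooth_on S (\<lambda>x. \<Sum>i\<in>I. f i x)"
  by (simp add: smooth_on_def ck_on_sum)

context
  fixes f g :: "'v::real_normed_vector \<Rightarrow> real" and S :: "'v set"
  assumes S: "open S"
begin

lemma smooth_on_mult: "smooth_on S f \<Longrightarrow> smooth_on S g \<Longrightarrow> smooth_on S (\<lambda>x. f x * g x)"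
  by (simp add: smooth_on_def ck_on_mult[OF S])

lemma smooth_on_diff: "smooth_on S f \<Longrightarrow> smooth_on S g \<Longrightarrow> smooth_on S (\<lambda>x. f x - g x)"
  using ck_on_add[OF S, of _ f "\<lambda>x. - 1 * g x"] ck_on_mult[OF S ck_on_const, of _ g "- 1"]
  by (simp add: smooth_on_def)

lemma smooth_on_inverse: "(\<And>x. x \<in> S \<Longrightarrow> f x \<noteq> 0) \<Longrightarrow> smooth_on S f \<Longrightarrow> smooth_on S (\<lambda>x. inverse (f x))"
  by (simp add: smooth_on_def ck_on_inverse[OF S])

lemma smooth_on_exp: "smooth_on S f \<Longrightarrow> smooth_on S (\<lambda>x. exp (f x))"
  by (simp add: smooth_on_def ck_on_exp[OF S])

end

lemma smooth_on_prod:
  fixes f :: "'i \<Rightarrow> 'v::real_normed_vector \<Rightarrow> real"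
  shows "open S \<Longrightarrow> (\<And>i. i \<in> I \<Longrightarrow> smooth_on S (f i)) \<Longrightarrow> smooth_on S (\<lambda>x. \<Prod>i\<in>I. f i x)"
  by (simp add: smooth_on_def ck_on_prod)

lemma smooth_on_slice:
  "open \<Omega> \<Longrightarrow> open S \<Longrightarrow> (\<And>x. x \<in> S \<Longrightarrow> (x, y) \<in> \<Omega>) \<Longrightarrow> smooth_on \<Omega> f \<Longrightarrow> smooth_on S (\<lambda>x. f (x, y))"
  unfolding smooth_on_def using ck_on_slice by blast

lemma smooth_on_vec_nth:
  fixes f :: "'v::real_normed_vector \<Rightarrow> real^'n"
  assumes "open S" "smooth_on S f"
  shows "smooth_on S (\<lambda>x. f x $ i)"
proof -
  have "ck_on k S f \<Longrightarrow> ck_on k S (\<lambda>x. f x $ i)" for k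
  proof (induction k arbitrary: f)
    case 0
    then show ?case by (simp add: continuous_on_component)
  next
    case (Suc k)
    have der: "((\<lambda>x. f x $ i) has_derivative (\<lambda>v. dd f x v $ i)) (at x)" if "x \<in> S" for x
      using Suc.prems that
      by (auto intro!: bounded_linear.has_derivative[OF bounded_linear_vec_nth] has_derivative_dd)
    have "ck_on k S (\<lambda>x. dd f x v $ i)" for v
      using Suc.IH[of "\<lambda>z. dd f z v"] Suc.prems by simp
    then have "ck_on k S (\<lambda>x. dd (\<lambda>x. f x $ i) x v)" for v
      by (rule ck_on_cong[OF assms(1), rotated]) (simp add: dd_eqI[OF der])
    moreover have "(\<lambda>x. f x $ i) differentiable (at x)" if "x \<in> S" for x
      using der[OF that] by (auto simp: differentiable_def)
    ultimately show ?case by simp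
  qed
  then show ?thesis using assms(2) by (simp add: smooth_on_def)
qed

section \<open>Smooth dependence of the inverse of a matrix\<close>

lemma matrix_inv_mult:
  fixes A :: "real^'n^'n"
  assumes "invertible A"
  shows "A ** matrix_inv A = mat 1" "matrix_inv A ** A = mat 1"
  using assms unfolding invertible_def matrix_inv_def by (metis (mono_tags, lifting) someI)+

lemma matrix_inv_cramer:
  fixes A :: "real^'n^'n"
  assumes "invertible A"
  shows "matrix_inv A $ k $ j = det (\<chi> i l. if l = k then (if i = j then 1 else 0) else A $ i $ l) * inverse (det A)"
proof -
  have d: "det A \<noteq> 0" using assms invertible_det_nz by blast
  let ?e = "axis j 1 :: real^'n"
  have "A *v (matrix_inv A *v ?e) = ?e"
    by (simp add: matrix_vector_mul_assoc matrix_inv_mult[OF assms])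
  then have "matrix_inv A *v ?e = (\<chi> k. det (\<chi> i l. if l = k then ?e $ i else A $ i $ l) / det A)"
    using cramer[OF d] by blast
  moreover have "(matrix_inv A *v ?e) $ k = matrix_inv A $ k $ j"
    by (simp add: matrix_vector_mult_basis column_def)
  ultimately have "matrix_inv A $ k $ j = det (\<chi> i l. if l = k then ?e $ i else A $ i $ l) / det A"
    by simp
  also have "(\<chi> i l. if l = k then ?e $ i else A $ i $ l) = (\<chi> i l. if l = k then (if i = j then 1 else 0) else A $ i $ l)"
    by (auto simp: vec_eq_iff axis_def)
  finally show ?thesis by (simp add: divide_inverse)
qed

lemma smooth_on_det:
  fixes A :: "'v::real_normed_vector \<Rightarrow> real^'n^'n"
  assumes "open S" "\<And>i j. smooth_on S (\<lambda>x. A x $ i $ j)"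
  shows "smooth_on S (\<lambda>x. det (A x))"
  unfolding det_def
  by (intro smooth_on_sum smooth_on_mult smooth_on_const smooth_on_prod assms)

lemma smooth_on_matrix_inv:
  fixes A :: "'v::real_normed_vector \<Rightarrow> real^'n^'n"
  assumes "open S" "\<And>i j. smooth_on S (\<lambda>x. A x $ i $ j)" "\<And>x. x \<in> S \<Longrightarrow> invertible (A x)"
  shows "smooth_on S (\<lambda>x. matrix_inv (A x) $ i $ j)"
proof (rule smooth_on_cong[OF assms(1)])
  show "det (\<chi> r l. if l = i then (if r = j then 1 else 0) else A x $ r $ l) * inverse (det (A x)) =
    matrix_inv (A x) $ i $ j" if "x \<in> S" for x
    using matrix_inv_cramer[OF assms(3)[OF that]] by simp
  have "smooth_on S (\<lambda>x. (\<chi> r l. if l = i then (if r = j then 1 else 0) else A x $ r $ l) $ s $ t)" for s t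
    using assms(2) by (cases "t = i") (auto simp: smooth_on_const)
  moreover have "det (A x) \<noteq> 0" if "x \<in> S" for x
    using assms(3)[OF that] invertible_det_nz by blast
  ultimately show "smooth_on S (\<lambda>x. det (\<chi> r l. if l = i then (if r = j then 1 else 0) else A x $ r $ l) * inverse (det (A x)))"
    by (intro smooth_on_mult smooth_on_inverse smooth_on_det assms)
qed

text \<open>Both mixed second derivatives are limits of the second difference quotient, by the mean value
  theorem applied to each variable in turn.\<close>

lemma second_difference_mean_value:
  fixes f :: "'v::real_normed_vector \<Rightarrow> real"
  assumes f: "smooth_on S f" and S: "\<And>s r. 0 \<le> s \<Longrightarrow> s \<le> t \<Longrightarrow> 0 \<le> r \<Longrightarrow> r \<le> t \<Longrightarrow> x + s *\<^sub>R v + r *\<^sub>R w \<in> S"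
    and t: "0 < t"
  obtains s r where "0 < s" "s < t" "0 < r" "r < t"
    "f (x + t *\<^sub>R v + t *\<^sub>R w) - f (x + t *\<^sub>R v) - f (x + t *\<^sub>R w) + f x =
      t * t * dd (\<lambda>x. dd f x v) (x + s *\<^sub>R v + r *\<^sub>R w) w"
proof -
  define p where "p s = f (x + s *\<^sub>R v + t *\<^sub>R w) - f (x + s *\<^sub>R v)" for s
  have fd: "((\<lambda>s. g (a + s *\<^sub>R u)) has_real_derivative dd g (a + s *\<^sub>R u) u) (at s)"
    if "smooth_on S g" "a + s *\<^sub>R u \<in> S" for g :: "'v \<Rightarrow> real" and a u and s :: real
  proof -
    have "(g has_derivative dd g (a + s *\<^sub>R u)) (at (a + s *\<^sub>R u))"
      by (rule smooth_on_has_derivative[OF that])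
    moreover have "((\<lambda>s. a + s *\<^sub>R u) has_derivative (\<lambda>h. h *\<^sub>R u)) (at s)"
      using has_derivative_add[OF has_derivative_const[of a] has_derivative_scaleR_left[OF has_derivative_ident]]
      by simp
    ultimately have "((\<lambda>s. g (a + s *\<^sub>R u)) has_derivative (\<lambda>h. dd g (a + s *\<^sub>R u) (h *\<^sub>R u))) (at s)"
      by (rule has_derivative_compose[rotated])
    moreover have "dd g (a + s *\<^sub>R u) (h *\<^sub>R u) = h * dd g (a + s *\<^sub>R u) u" for h
      using linear_cmul[OF linear_frechet_derivative[OF smooth_on_differentiable[OF that]]] by simp
    ultimately show ?thesis by (simp add: has_field_derivative_def mult.commute[of _ "dd g _ _"])
  qed
  have p': "(p has_real_derivative dd f (x + s *\<^sub>R v + t *\<^sub>R w) v - dd f (x + s *\<^sub>R v) v) (at s)"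
    if "0 \<le> s" "s \<le> t" for s
    using fd[OF f, of "x + t *\<^sub>R w" s v] fd[OF f, of x s v] S[of s t] S[of s 0] that t
    unfolding p_def by (auto intro!: DERIV_diff simp: add.commute add.left_commute)
  obtain s where s: "0 < s" "s < t" "p t - p 0 = (t - 0) * (dd f (x + s *\<^sub>R v + t *\<^sub>R w) v - dd f (x + s *\<^sub>R v) v)"
    using MVT2[OF t p'] by blast
  obtain r where r: "0 < r" "r < t" "dd f (x + s *\<^sub>R v + t *\<^sub>R w) v - dd f (x + s *\<^sub>R v + 0 *\<^sub>R w) v =
      (t - 0) * dd (\<lambda>x. dd f x v) (x + s *\<^sub>R v + r *\<^sub>R w) w"
    using MVT2[OF t fd[OF smooth_on_dd[OF f], of "x + s *\<^sub>R v" _ w v]] S s by force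
  show ?thesis
    by (rule that[OF s(1,2) r(1,2)]) (use s(3) r(3) in \<open>simp add: p_def algebra_simps\<close>)
qed

lemma dd_commute:
  fixes f :: "'v::real_normed_vector \<Rightarrow> real"
  assumes S: "open S" and f: "smooth_on S f" and x: "x \<in> S"
  shows "dd (\<lambda>x. dd f x v) x w = dd (\<lambda>x. dd f x w) x v"
proof -
  define g where "g = (\<lambda>v w x. dd (\<lambda>x. dd f x v) x w)"
  have lim: "\<exists>d>0. \<forall>t. 0 < t \<and> t < d \<longrightarrow>
      \<bar>(f (x + t *\<^sub>R v + t *\<^sub>R w) - f (x + t *\<^sub>R v) - f (x + t *\<^sub>R w) + f x) / (t * t) - g v w x\<bar> < e"
    if e: "0 < e" for v w and e :: real
  proof -
    have "isCont (g v w) x"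
      using smooth_on_continuous[OF smooth_on_dd[OF smooth_on_dd[OF f]]] S x
      unfolding g_def by (simp add: continuous_on_eq_continuous_at)
    then obtain d1 where d1: "d1 > 0" "\<And>y. dist y x < d1 \<Longrightarrow> dist (g v w y) (g v w x) < e"
      using e unfolding continuous_at_eps_delta by metis
    obtain d2 where d2: "d2 > 0" "ball x d2 \<subseteq> S" using S x open_contains_ball by blast
    \<comment> \<open>The parallelogram with sides t v and t w at x lies within distance t * c of x;
      the summand 1 keeps \<open>c\<close> positive if v = w = 0.\<close>
    define c where "c = norm v + norm w + 1"
    define d where "d = min d1 d2 / c"
    have c: "c > 0" unfolding c_def by (simp add: add_nonneg_pos)
    have near: "dist (x + s *\<^sub>R v + r *\<^sub>R w) x < min d1 d2"
      if "0 \<le> s" "s \<le> t" "0 \<le> r" "r \<le> t" "t < d" "0 < t" for s r t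
    proof -
      have "dist (x + s *\<^sub>R v + r *\<^sub>R w) x \<le> s * norm v + r * norm w"
        using that norm_triangle_ineq[of "s *\<^sub>R v" "r *\<^sub>R w"] by (simp add: dist_norm add.assoc)
      also have "\<dots> \<le> t * norm v + t * norm w"
        using that by (intro add_mono mult_right_mono) auto
      also have "\<dots> \<le> t * c" using that by (simp add: c_def algebra_simps)
      also have "\<dots> < min d1 d2" using that c by (simp add: d_def pos_less_divide_eq)
      finally show ?thesis .
    qed
    show ?thesis
    proof (intro exI[of _ d] conjI allI impI)
      show "d > 0" using c d1 d2 by (simp add: d_def)
      fix t assume t: "0 < t \<and> t < d"
      have "x + s *\<^sub>R v + r *\<^sub>R w \<in> S" if "0 \<le> s" "s \<le> t" "0 \<le> r" "r \<le> t" for s r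
        using near[OF that] t d2(2) by (auto simp: dist_commute)
      then obtain s r where sr: "0 < s" "s < t" "0 < r" "r < t"
        "f (x + t *\<^sub>R v + t *\<^sub>R w) - f (x + t *\<^sub>R v) - f (x + t *\<^sub>R w) + f x =
          t * t * g v w (x + s *\<^sub>R v + r *\<^sub>R w)"
        using second_difference_mean_value[OF f _ conjunct1[OF t], of x v w] unfolding g_def by metis
      have "dist (g v w (x + s *\<^sub>R v + r *\<^sub>R w)) (g v w x) < e"
        by (rule d1(2)) (use near[of s t r] sr t in auto)
      then show "\<bar>(f (x + t *\<^sub>R v + t *\<^sub>R w) - f (x + t *\<^sub>R v) - f (x + t *\<^sub>R w) + f x) / (t * t) - g v w x\<bar> < e"
        using sr t by (simp add: dist_real_def)
    qed
  qed
  \<comment> \<open>No number is closer than half of |p - q| to both p and q. It is applied to the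
    second difference quotient, which is symmetric in v and w and approximates both mixed
    derivatives.\<close>
  have *: "\<bar>X - p\<bar> < \<bar>p - q\<bar> / 2 \<Longrightarrow> \<bar>X - q\<bar> < \<bar>p - q\<bar> / 2 \<Longrightarrow> False" for X p q :: real
    by (auto simp: abs_if split: if_splits)
  have "\<not> 0 < \<bar>g v w x - g w v x\<bar>"
  proof
    assume "0 < \<bar>g v w x - g w v x\<bar>"
    then have e: "0 < \<bar>g v w x - g w v x\<bar> / 2" by simp
    obtain d1 where d1: "d1 > 0" "\<And>t. 0 < t \<Longrightarrow> t < d1 \<Longrightarrow>
      \<bar>(f (x + t *\<^sub>R v + t *\<^sub>R w) - f (x + t *\<^sub>R v) - f (x + t *\<^sub>R w) + f x) / (t * t) - g v w x\<bar> < \<bar>g v w x - g w v x\<bar> / 2"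
      using lim[OF e, of v w] by blast
    obtain d2 where d2: "d2 > 0" "\<And>t. 0 < t \<Longrightarrow> t < d2 \<Longrightarrow>
      \<bar>(f (x + t *\<^sub>R w + t *\<^sub>R v) - f (x + t *\<^sub>R w) - f (x + t *\<^sub>R v) + f x) / (t * t) - g w v x\<bar> < \<bar>g v w x - g w v x\<bar> / 2"
      using lim[OF e, of w v] by blast
    define t where "t = min d1 d2 / 2"
    have t: "0 < t" "t < d1" "t < d2" using d1 d2 by (auto simp: t_def)
    have eq: "f (x + t *\<^sub>R w + t *\<^sub>R v) - f (x + t *\<^sub>R w) - f (x + t *\<^sub>R v) + f x =
      f (x + t *\<^sub>R v + t *\<^sub>R w) - f (x + t *\<^sub>R v) - f (x + t *\<^sub>R w) + f x"
      by (simp add: algebra_simps)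
    show False
      using d1(2)[OF t(1,2)] d2(2)[OF t(1,3)] *[of _ "g v w x" "g w v x"] unfolding eq by blast
  qed
  then show ?thesis by (simp add: g_def)
qed

section \<open>Polynomial identities on open sets\<close>

text \<open>A cubic polynomial that vanishes at the four points 0, e, - e and 2 e is zero.
  Polynomial identities on open sets are reduced to this case by restriction to lines.\<close>

lemma cubic_coeffs_zero:
  fixes c0 c1 c2 c3 d :: real
  assumes "0 < d" "\<And>t. \<bar>t\<bar> < d \<Longrightarrow> c0 + t * c1 + t\<^sup>2 * c2 + t ^ 3 * c3 = 0"
  shows "c0 = 0" "c1 = 0" "c2 = 0" "c3 = 0"
proof -
  \<comment> \<open>A third of \<open>d\<close>, so that \<open>2 * e\<close> still lies in the
    interval.\<close>
  define e where "e = d / 3"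
  have e: "0 < e" "e < d" "2 * e < d" using assms(1) by (auto simp: e_def)
  have *: "c0 = 0" using assms(2)[of 0] assms(1) by simp
  have p: "e * c1 + e\<^sup>2 * c2 + e ^ 3 * c3 = 0" using assms(2)[of e] e * by simp
  have q: "- e * c1 + e\<^sup>2 * c2 - e ^ 3 * c3 = 0" using assms(2)[of "- e"] e * by simp
  have r: "2 * e * c1 + 4 * e\<^sup>2 * c2 + 8 * e ^ 3 * c3 = 0"
    using assms(2)[of "2 * e"] e * by (simp add: power_mult_distrib)
  have "e\<^sup>2 * c2 = 0" "e * c1 = 0" "e ^ 3 * c3 = 0" using p q r by linarith+
  then show "c0 = 0" "c1 = 0" "c2 = 0" "c3 = 0" using e * by auto
qed

lemma line_in_open:
  fixes y :: "'v::real_normed_vector"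
  assumes "open U" "y \<in> U"
  obtains d where "0 < d" "\<And>t::real. \<bar>t\<bar> < d \<Longrightarrow> y + t *\<^sub>R w \<in> U"
proof -
  obtain e where e: "e > 0" "ball y e \<subseteq> U" using assms open_contains_ball by blast
  define d where "d = e / (norm w + 1)"
  have n: "norm w + 1 > 0" by (simp add: add_nonneg_pos)
  show ?thesis
  proof (rule that)
    show "0 < d" using e n by (simp add: d_def)
    fix t :: real assume t: "\<bar>t\<bar> < d"
    have "\<bar>t\<bar> * norm w \<le> \<bar>t\<bar> * (norm w + 1)" by (simp add: mult_left_mono)
    also have "\<dots> < e" using t n by (simp add: d_def pos_less_divide_eq)
    finally show "y + t *\<^sub>R w \<in> U" using e(2) by (auto simp: dist_norm)
  qed
qed

lemma linear_zero_if_zero_on_open: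
  fixes f :: "'v::real_normed_vector \<Rightarrow> real"
  assumes f: "linear f" and U: "open U" "y \<in> U" and z: "\<And>y. y \<in> U \<Longrightarrow> f y = 0"
  shows "f w = 0"
proof -
  obtain d where d: "0 < d" "\<And>t. \<bar>t\<bar> < d \<Longrightarrow> y + t *\<^sub>R w \<in> U"
    using line_in_open[OF U, of w] by blast
  have "f (y + (d / 2) *\<^sub>R w) = f y + (d / 2) * f w" by (simp add: linear_add[OF f] linear_cmul[OF f])
  then show ?thesis using z[OF d(2)[of "d/2"]] z[OF U(2)] d(1) by simp
qed

lemma bilinear_expand:
  fixes B :: "'v::real_vector \<Rightarrow> 'v \<Rightarrow> real"
  assumes "bilinear B"
  shows "B (y + t *\<^sub>R w) (y + t *\<^sub>R w) = B y y + t * (B y w + B w y) + t\<^sup>2 * B w w"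
  by (simp add: bilinear_ladd[OF assms] bilinear_radd[OF assms] bilinear_lmul[OF assms]
      bilinear_rmul[OF assms] algebra_simps power2_eq_square)

lemma bilinear_zero_if_zero_on_diagonal:
  fixes B :: "'v::real_vector \<Rightarrow> 'v \<Rightarrow> real"
  assumes "bilinear B" "\<And>v w. B v w = B w v" "\<And>v. B v v = 0"
  shows "B v w = 0"
  using bilinear_expand[OF assms(1), of v 1 w] assms(2)[of v w] by (simp add: assms(3))

lemma bilinear_zero_if_zero_on_open:
  fixes B :: "'v::real_normed_vector \<Rightarrow> 'v \<Rightarrow> real"
  assumes B: "bilinear B" "\<And>v w. B v w = B w v" and U: "open U" "y \<in> U"
    and z: "\<And>y. y \<in> U \<Longrightarrow> B y y = 0"
  shows "B v w = 0"
proof (rule bilinear_zero_if_zero_on_diagonal[OF B])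
  fix w
  obtain d where d: "0 < d" "\<And>t. \<bar>t\<bar> < d \<Longrightarrow> y + t *\<^sub>R w \<in> U"
    using line_in_open[OF U, of w] by blast
  show "B w w = 0"
    by (rule cubic_coeffs_zero(3)[OF d(1), of "B y y" "B y w + B w y" "B w w" 0])
      (use z[OF d(2)] in \<open>simp add: bilinear_expand[OF B(1)]\<close>)
qed

text \<open>Otherwise the hyperplane ker \<beta> would be totally isotropic. In dimension at least
  three it contains a nonzero v with a(v, w) = 0; since ker \<beta> and w span the space, v is then
  orthogonal to everything, against nondegeneracy. In dimension two a null line of a Lorentzian form
  is a counterexample.\<close>

lemma kernel_not_isotropic:
  fixes a :: "'v::euclidean_space \<Rightarrow> 'v \<Rightarrow> real"
  assumes a: "bilinear a" "\<And>v w. a v w = a w v" "\<And>v. (\<And>w. a v w = 0) \<Longrightarrow> v = 0"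
    and \<beta>: "linear \<beta>" and dim: "DIM('v) > 2" and w: "\<beta> w \<noteq> (0::real)"
  shows "\<exists>v. \<beta> v = 0 \<and> a v v \<noteq> 0"
proof (rule ccontr)
  assume "\<not> ?thesis"
  then have iso: "a v v = 0" if "\<beta> v = 0" for v using that by blast
  have iso2: "a u v = 0" if "\<beta> u = 0" "\<beta> v = 0" for u v
    using bilinear_expand[OF a(1), of u 1 v] iso[of u] iso[of v] iso[of "u + v"] that a(2)[of u v]
    by (simp add: linear_add[OF \<beta>])
  \<comment> \<open>The vector that represents a linear form by the Euclidean inner product.\<close>
  define r where "r f = (\<Sum>i\<in>Basis. f i *\<^sub>R i)" for f :: "'v \<Rightarrow> real"
  have r: "f v = r f \<bullet> v" if "linear f" for f v
  proof -
    have "f v = f (\<Sum>i\<in>Basis. (v \<bullet> i) *\<^sub>R i)" by (simp add: euclidean_representation)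
    also have "\<dots> = (\<Sum>i\<in>Basis. (v \<bullet> i) * f i)" by (simp add: linear_sum[OF that] linear_cmul[OF that])
    also have "\<dots> = r f \<bullet> v" unfolding r_def inner_sum_left by (simp add: inner_commute mult.commute)
    finally show ?thesis .
  qed
  \<comment> \<open>Two linear conditions, \<beta>(v) = 0 and a(v, w) = 0, leave a nonzero solution
    in dimension at least three.\<close>
  have "dim {r \<beta>, r (\<lambda>v. a v w)} \<le> card {r \<beta>, r (\<lambda>v. a v w)}" by (rule dim_le_card') auto
  also have "\<dots> \<le> 2" by (simp add: card_insert_if)
  finally have "dim {r \<beta>, r (\<lambda>v. a v w)} < DIM('v)" using dim by simp
  then obtain v where v: "v \<noteq> 0" "\<And>y. y \<in> span {r \<beta>, r (\<lambda>v. a v w)} \<Longrightarrow> orthogonal v y"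
    using orthogonal_to_subspace_exists by blast
  have orth: "r f \<bullet> v = 0" if "f = \<beta> \<or> f = (\<lambda>v. a v w)" for f
    using v(2)[of "r f"] that by (auto simp: span_base orthogonal_def inner_commute)
  have "\<beta> v = 0" by (rule trans[OF r[OF \<beta>] orth]) simp
  have "linear (\<lambda>v. a v w)" using a(1) by (simp add: bilinear_def)
  then have avw: "a v w = 0" by (rule trans[OF r orth]) simp
  have "a v u = 0" for u
  proof -
    define s where "s = \<beta> u / \<beta> w"
    have "a v (u - s *\<^sub>R w) = 0"
      using \<open>\<beta> v = 0\<close> w by (intro iso2) (auto simp: s_def linear_diff[OF \<beta>] linear_cmul[OF \<beta>])
    then show ?thesis by (simp add: bilinear_rsub[OF a(1)] bilinear_rmul[OF a(1)] avw)
  qed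
  then show False using a(3) v(1) by blast
qed

text \<open>In dimension at least three a nondegenerate quadratic form is an irreducible polynomial, so it
  divides the quadratic factor of \<open>Q \<beta>\<close>. The argument below avoids factorization: \<open>\<mu>\<close> vanishes on
  the kernel of \<open>\<beta>\<close>, because \<open>a\<close> does not vanish identically there.\<close>

lemma quadratic_divides_quadratic_times_linear:
  fixes a Q :: "'v::euclidean_space \<Rightarrow> 'v \<Rightarrow> real" and \<beta> \<mu> :: "'v \<Rightarrow> real"
  assumes a: "bilinear a" "\<And>v w. a v w = a w v" "\<And>v. (\<And>w. a v w = 0) \<Longrightarrow> v = 0"
    and Q: "bilinear Q" and \<beta>: "linear \<beta>" and \<mu>: "linear \<mu>"
    and dim: "DIM('v) > 2" and w: "\<beta> w \<noteq> 0" and U: "open U" "y0 \<in> U"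
    and eq: "\<And>y. y \<in> U \<Longrightarrow> Q y y * \<beta> y = a y y * \<mu> y"
  obtains \<kappa> where "\<And>y. Q y y = \<kappa> * a y y"
proof -
  have cub: "B (y + t *\<^sub>R u) (y + t *\<^sub>R u) * f (y + t *\<^sub>R u) =
      B y y * f y + t * ((B y u + B u y) * f y + B y y * f u)
      + t\<^sup>2 * (B u u * f y + (B y u + B u y) * f u) + t ^ 3 * (B u u * f u)"
    if "bilinear B" "linear f" for B :: "'v \<Rightarrow> 'v \<Rightarrow> real" and f y u and t :: real
    by (simp add: bilinear_expand[OF that(1)] linear_add[OF that(2)] linear_cmul[OF that(2)]
        algebra_simps power2_eq_square power3_eq_cube)
  have eq': "Q y y * \<beta> y = a y y * \<mu> y" for y
  proof -
    obtain d where d: "0 < d" "\<And>t. \<bar>t\<bar> < d \<Longrightarrow> y0 + t *\<^sub>R y \<in> U"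
      using line_in_open[OF U, of y] by blast
    define q where "q B f = (B y0 y + B y y0) * f y0 + B y0 y0 * f y" for B :: "'v \<Rightarrow> 'v \<Rightarrow> real" and f
    define p where "p B f = B y y * f y0 + (B y0 y + B y y0) * f y" for B :: "'v \<Rightarrow> 'v \<Rightarrow> real" and f
    \<comment> \<open>Both sides are cubic along the line y0 + t y, and their coefficients of t^3
      are the values at y. The identity near y0 thus gives the identity everywhere.\<close>
    have "Q y y * \<beta> y - a y y * \<mu> y = 0"
    proof (rule cubic_coeffs_zero(4)[OF d(1)])
      fix t :: real assume t: "\<bar>t\<bar> < d"
      show "(Q y0 y0 * \<beta> y0 - a y0 y0 * \<mu> y0) + t * (q Q \<beta> - q a \<mu>) + t\<^sup>2 * (p Q \<beta> - p a \<mu>)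
        + t ^ 3 * (Q y y * \<beta> y - a y y * \<mu> y) = 0"
        using eq[OF d(2)[OF t]] unfolding cub[OF Q \<beta>] cub[OF a(1) \<mu>] p_def q_def
        by (simp add: right_diff_distrib)
    qed
    then show ?thesis by simp
  qed
  obtain v where v: "\<beta> v = 0" "a v v \<noteq> 0"
    using kernel_not_isotropic[OF a \<beta> dim w] by blast
  have "\<mu> v = 0" using eq'[of v] v by simp
  have ker: "\<mu> y = 0" if "\<beta> y = 0" for y
  proof -
    \<comment> \<open>The line v + t y stays in ker \<beta>, where the identity reads 0 = a \<mu>;
      because \<mu>(v) = 0, the coefficient of t is a(v, v) \<mu>(y).\<close>
    have "a v v * \<mu> y = 0"
    proof (rule cubic_coeffs_zero(2)[of 1])
      fix t :: real
      have "\<beta> (v + t *\<^sub>R y) = 0" by (simp add: linear_add[OF \<beta>] linear_cmul[OF \<beta>] v that)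
      then have "a (v + t *\<^sub>R y) (v + t *\<^sub>R y) * \<mu> (v + t *\<^sub>R y) = 0" using eq'[of "v + t *\<^sub>R y"] by simp
      then show "0 + t * (a v v * \<mu> y) + t\<^sup>2 * ((a v y + a y v) * \<mu> y) + t ^ 3 * (a y y * \<mu> y) = 0"
        by (simp add: cub[OF a(1) \<mu>] \<open>\<mu> v = 0\<close>)
    qed simp
    then show ?thesis using v by simp
  qed
  define \<kappa> where "\<kappa> = \<mu> w / \<beta> w"
  have \<mu>\<beta>: "\<mu> y = \<kappa> * \<beta> y" for y
    using ker[of "y - (\<beta> y / \<beta> w) *\<^sub>R w"] w
    by (simp add: linear_diff[OF \<beta>] linear_cmul[OF \<beta>] linear_diff[OF \<mu>] linear_cmul[OF \<mu>] \<kappa>_def field_simps)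
  have ne: "Q y y = \<kappa> * a y y" if "\<beta> y \<noteq> 0" for y
    using eq'[of y] that unfolding \<mu>\<beta> by simp
  have "Q y y = \<kappa> * a y y" if "\<beta> y = 0" for y
  proof -
    have "Q (y + t *\<^sub>R w) (y + t *\<^sub>R w) = \<kappa> * a (y + t *\<^sub>R w) (y + t *\<^sub>R w)" if "t \<noteq> 0" for t
      by (rule ne) (use \<open>\<beta> y = 0\<close> w that in \<open>simp add: linear_add[OF \<beta>] linear_cmul[OF \<beta>]\<close>)
    \<comment> \<open>The sum over t = 1 and t = - 1 cancels the terms linear in t, and the
      contribution of w is known from \<open>ne\<close>.\<close>
    from this[of 1] this[of "- 1"] ne[OF w] show ?thesis
      unfolding bilinear_expand[OF Q] bilinear_expand[OF a(1)] by (simp add: algebra_simps)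
  qed
  then show ?thesis using ne that by blast
qed

section \<open>Berwald metrics in a chart\<close>

lemma pdx_dd: "pdx i f z = dd f z (axis i 1, 0)"
  by (simp add: pdx_def)

lemma pdy_dd: "pdy i f z = dd f z (0, axis i 1)"
  by (simp add: pdy_def)

lemma linear_axis_sum:
  fixes f :: "real^'n \<Rightarrow> real"
  assumes "linear f"
  shows "f w = (\<Sum>i\<in>UNIV. w $ i * f (axis i 1))"
proof -
  have "f w = f (\<Sum>i\<in>UNIV. w $ i *\<^sub>R axis i 1)"
    by (simp add: basis_expansion[of w, unfolded scalar_mult_eq_scaleR])
  then show ?thesis by (simp add: linear_sum[OF assms] linear_cmul[OF assms])
qed

lemma dd_pair_linear:
  assumes "f differentiable (at z)"
  shows "linear (\<lambda>v. dd f z (v, 0))" "linear (\<lambda>w. dd f z (0, w))"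
    "dd f z (v, w) = dd f z (v, 0) + dd f z (0, w)"
proof -
  note l = linear_frechet_derivative[OF assms]
  show "linear (\<lambda>v. dd f z (v, 0))" "linear (\<lambda>w. dd f z (0, w))"
    by (auto intro!: linearI simp: linear_add[OF l, symmetric] linear_cmul[OF l, symmetric])
  show "dd f z (v, w) = dd f z (v, 0) + dd f z (0, w)"
    by (simp add: linear_add[OF l, symmetric])
qed

lemma dd_fibre_pdy:
  "f differentiable (at z) \<Longrightarrow> dd f z (0, w) = (\<Sum>i\<in>UNIV. w $ i * pdy i f z)"
  unfolding pdy_dd by (rule linear_axis_sum[OF dd_pair_linear(2)])

text \<open>For a vertical derivative it suffices to know \<open>f\<close> on one fibre. This allows
  formulas that are polynomial in y while nothing is yet known about how their coefficients depend
  on x.\<close>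

lemma dd_fibre_eqI:
  assumes \<Omega>: "open \<Omega>" "(x, y) \<in> \<Omega>" and f: "f differentiable (at (x, y))"
    and g: "(g has_derivative g') (at y)" and eq: "\<And>y'. (x, y') \<in> \<Omega> \<Longrightarrow> f (x, y') = g y'"
  shows "dd f (x, y) (0, w) = g' w"
proof -
  have "((\<lambda>y. (x, y)) has_derivative (\<lambda>w. (0, w))) (at y)"
    by (intro has_derivative_Pair has_derivative_const has_derivative_ident)
  then have "((\<lambda>y. f (x, y)) has_derivative (\<lambda>w. dd f (x, y) (0, w))) (at y)"
    using has_derivative_dd[OF f] by (rule has_derivative_compose)
  moreover have "open {y. (x, y) \<in> \<Omega>}"
    using \<Omega>(1) by (intro open_vimage[of \<Omega> "Pair x", unfolded vimage_def] continuous_intros)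
  ultimately have "(g has_derivative (\<lambda>w. dd f (x, y) (0, w))) (at y)"
    using \<Omega>(2) eq by (auto elim!: has_derivative_transform_within_open)
  then show ?thesis using g has_derivative_unique by metis
qed

text \<open>The horizontal lift of u at (x, y) is \<open>(u, - christoffel_action G x u y)\<close>.
  As a bilinear map it replaces most index computations by linear algebra.\<close>

definition christoffel_action ::
  "('n \<Rightarrow> 'n \<Rightarrow> 'n \<Rightarrow> real^'n \<Rightarrow> real) \<Rightarrow> real^'n \<Rightarrow> real^'n \<Rightarrow> real^'n \<Rightarrow> real^'n::finite" where
  "christoffel_action G x u y = (\<chi> k. \<Sum>i\<in>UNIV. \<Sum>j\<in>UNIV. G k i j x * u $ i * y $ j)"

lemma linear_christoffel_action:
  "linear (\<lambda>u. christoffel_action G x u y)" "linear (\<lambda>y. christoffel_action G x u y)"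
  by (auto intro!: linearI simp: christoffel_action_def vec_eq_iff algebra_simps sum.distrib sum_distrib_left)

lemma bilinear_christoffel_action: "bilinear (christoffel_action G x)"
  by (simp add: bilinear_def linear_christoffel_action)

lemma sum_axis:
  fixes f :: "'n::finite \<Rightarrow> real"
  shows "(\<Sum>i\<in>UNIV. f i * axis k 1 $ i) = f k"
  by (simp add: axis_def if_distrib cong: if_cong)

lemma christoffel_action_axis:
  "christoffel_action G x (axis i 1) y $ k = (\<Sum>j\<in>UNIV. G k i j x * y $ j)"
  "christoffel_action G x u (axis j 1) $ k = (\<Sum>i\<in>UNIV. G k i j x * u $ i)"
proof -
  have "(\<Sum>i'\<in>UNIV. \<Sum>j\<in>UNIV. G k i' j x * axis i 1 $ i' * y $ j) =
      (\<Sum>i'\<in>UNIV. (\<Sum>j\<in>UNIV. G k i' j x * y $ j) * axis i 1 $ i')"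
    unfolding sum_distrib_right by (intro sum.cong refl) (simp only: mult_ac)
  then show "christoffel_action G x (axis i 1) y $ k = (\<Sum>j\<in>UNIV. G k i j x * y $ j)"
    by (simp add: christoffel_action_def sum_axis)
  show "christoffel_action G x u (axis j 1) $ k = (\<Sum>i\<in>UNIV. G k i j x * u $ i)"
    by (simp add: christoffel_action_def sum_axis)
qed

lemma christoffel_action_axis_axis:
  "christoffel_action G x (axis i 1) (axis j 1) $ k = G k i j x"
  by (simp add: christoffel_action_axis(1) sum_axis)

lemma bilinear_nth: "bilinear B \<Longrightarrow> bilinear (\<lambda>u v. B u v $ k)"
  by (auto simp: bilinear_def linear_iff)

lemma has_derivative_christoffel_diagonal:
  "((\<lambda>y. christoffel_action G x y y $ k) has_derivative
     (\<lambda>w. christoffel_action G x y w $ k + christoffel_action G x w y $ k)) (at y)"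
proof -
  have "bounded_bilinear (\<lambda>u v. christoffel_action G x u v $ k)"
    using bilinear_nth[OF bilinear_christoffel_action] bilinear_conv_bounded_bilinear by blast
  from bounded_bilinear.FDERIV[OF this has_derivative_ident has_derivative_ident]
  show ?thesis .
qed

text \<open>What a Berwald metric leaves in the coordinates induced by one chart:
  \<open>\<Omega>\<close> is the image of the cone and \<open>L\<close> the local expression of
  \<open>F\<close>. The coefficients \<open>G\<close> are only required to produce the nonlinear
  connection; their symmetry and smoothness are derived.\<close>

locale berwald_chart =
  fixes \<Omega> :: "((real^'n) \<times> (real^'n)) set" and L :: "'n::finite tfun"
    and G :: "'n \<Rightarrow> 'n \<Rightarrow> 'n \<Rightarrow> real^'n \<Rightarrow> real"
  assumes open_dom: "open \<Omega>" and smooth: "smooth_on \<Omega> L"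
    and cone: "(x, y) \<in> \<Omega> \<Longrightarrow> 0 < r \<Longrightarrow> (x, r *\<^sub>R y) \<in> \<Omega>"
    and homogeneous: "(x, y) \<in> \<Omega> \<Longrightarrow> 0 < r \<Longrightarrow> L (x, r *\<^sub>R y) = r * L (x, y)"
    and nondegenerate: "z \<in> \<Omega> \<Longrightarrow> invertible (fundamental_tensor L z)"
    and nonlin_conn_eq: "(x, y) \<in> \<Omega> \<Longrightarrow> nonlin_conn L k i (x, y) = (\<Sum>j\<in>UNIV. G k i j x * y $ j)"
begin

definition E :: "'n tfun" where "E z = (L z)\<^sup>2"

definition W :: "'n \<Rightarrow> 'n tfun" where
  "W k z = (\<Sum>l\<in>UNIV. snd z $ l * pdx l (pdy k E) z) - pdx k E z"

text \<open>Four times the usual spray coefficient: the nonlinear connection is the fibre derivative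
  of \<open>B / 4\<close>, and geodesics satisfy x'' + B / 2 = 0.\<close>

definition B :: "'n \<Rightarrow> 'n tfun" where
  "B j z = (\<Sum>k\<in>UNIV. matrix_inv (fundamental_tensor L z) $ j $ k * W k z)"

abbreviation \<Gamma> where "\<Gamma> \<equiv> christoffel_action G"

lemma nonlin_conn_B: "nonlin_conn L j i z = 1/4 * pdy i (B j) z"
  unfolding nonlin_conn_def B_def W_def E_def by simp

lemma smooth_E: "smooth_on \<Omega> E"
  unfolding E_def power2_eq_square by (intro smooth_on_mult open_dom smooth)

lemma smooth_pdx: "smooth_on \<Omega> f \<Longrightarrow> smooth_on \<Omega> (pdx i f)"
  using smooth_on_dd by (simp add: pdx_def[abs_def])

lemma smooth_pdy: "smooth_on \<Omega> f \<Longrightarrow> smooth_on \<Omega> (pdy i f)"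
  using smooth_on_dd by (simp add: pdy_def[abs_def])

lemma smooth_fibre_coord: "smooth_on \<Omega> (\<lambda>z. snd z $ l)"
  by (intro smooth_on_vec_nth open_dom smooth_on_bounded_linear bounded_linear_snd)

lemma smooth_W: "smooth_on \<Omega> (W k)"
  unfolding W_def[abs_def]
  by (intro smooth_on_diff smooth_on_sum smooth_on_mult open_dom smooth_fibre_coord smooth_pdx smooth_pdy smooth_E)

lemma fundamental_tensor_E:
  assumes "z \<in> \<Omega>"
  shows "fundamental_tensor L z $ i $ j = 1/2 * pdy i (pdy j E) z"
proof -
  have "pdy j (\<lambda>z. 1/2 * (L z)\<^sup>2) z' = 1/2 * pdy j E z'" if "z' \<in> \<Omega>" for z'
    unfolding pdy_def E_def[symmetric]
    by (rule dd_cmult[OF smooth_on_differentiable[OF smooth_E that]])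
  then have "dd (pdy j (\<lambda>z. 1/2 * (L z)\<^sup>2)) z = dd (\<lambda>z. 1/2 * pdy j E z) z"
    by (rule dd_cong[OF open_dom assms])
  then have "pdy i (pdy j (\<lambda>z. 1/2 * (L z)\<^sup>2)) z = pdy i (\<lambda>z. 1/2 * pdy j E z) z"
    by (simp only: pdy_def[of i])
  also have "\<dots> = 1/2 * pdy i (pdy j E) z"
    unfolding pdy_def[of i]
    by (rule dd_cmult[OF smooth_on_differentiable[OF smooth_pdy[OF smooth_E] assms]])
  finally show ?thesis by (simp add: fundamental_tensor_def)
qed

lemma smooth_B: "smooth_on \<Omega> (B k)"
proof -
  have "smooth_on \<Omega> (\<lambda>z. fundamental_tensor L z $ i $ j)" for i j
    by (rule smooth_on_cong[OF open_dom fundamental_tensor_E[symmetric]])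
      (assumption, intro smooth_on_mult open_dom smooth_on_const smooth_pdy smooth_E)
  then show ?thesis
    unfolding B_def[abs_def]
    by (intro smooth_on_sum smooth_on_mult open_dom smooth_on_matrix_inv nondegenerate smooth_W)
qed

section \<open>Homogeneity in the fibre and Euler's identity\<close>

definition hom :: "nat \<Rightarrow> 'n tfun \<Rightarrow> bool" where
  "hom p f \<longleftrightarrow> (\<forall>x y r. (x, y) \<in> \<Omega> \<longrightarrow> 0 < r \<longrightarrow> f (x, r *\<^sub>R y) = r ^ p * f (x, y))"

lemma homD: "hom p f \<Longrightarrow> (x, y) \<in> \<Omega> \<Longrightarrow> 0 < r \<Longrightarrow> f (x, r *\<^sub>R y) = r ^ p * f (x, y)"
  by (simp add: hom_def)

lemma dd_hom:
  assumes f: "smooth_on \<Omega> f" "hom p f" and z: "(x, y) \<in> \<Omega>" "0 < r"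
  shows "dd f (x, r *\<^sub>R y) (v, r *\<^sub>R w) = r ^ p * dd f (x, y) (v, w)"
proof -
  have "((\<lambda>z. (fst z, r *\<^sub>R snd z)) has_derivative (\<lambda>z. (fst z, r *\<^sub>R snd z))) (at (x, y))"
    by (intro has_derivative_Pair has_derivative_fst has_derivative_scaleR_right has_derivative_snd has_derivative_ident)
  moreover have "(f has_derivative dd f (x, r *\<^sub>R y)) (at (fst (x, y), r *\<^sub>R snd (x, y)))"
    using smooth_on_has_derivative[OF f(1) cone[OF z]] by simp
  ultimately have 1: "((\<lambda>z. f (fst z, r *\<^sub>R snd z)) has_derivative
      (\<lambda>z. dd f (x, r *\<^sub>R y) (fst z, r *\<^sub>R snd z))) (at (x, y))"
    by (rule has_derivative_compose)
  have "((\<lambda>z. r ^ p * f z) has_derivative (\<lambda>z. r ^ p * dd f (x, y) z)) (at (x, y))"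
    by (rule has_derivative_mult_right[OF smooth_on_has_derivative[OF f(1) z(1)]])
  then have "((\<lambda>z. f (fst z, r *\<^sub>R snd z)) has_derivative (\<lambda>z. r ^ p * dd f (x, y) z)) (at (x, y))"
    by (rule has_derivative_transform_within_open[OF _ open_dom z(1)])
      (use homD[OF f(2) _ z(2)] in \<open>auto simp: split_beta\<close>)
  from fun_cong[OF has_derivative_unique[OF 1 this], of "(v, w)"] show ?thesis by simp
qed

lemma hom_pdx:
  assumes "smooth_on \<Omega> f" "hom p f"
  shows "hom p (pdx i f)"
  unfolding hom_def pdx_dd using dd_hom[OF assms, where w=0] by simp

lemma hom_pdy:
  assumes "smooth_on \<Omega> f" "hom (Suc p) f"
  shows "hom p (pdy i f)"
  unfolding hom_def pdy_dd
proof (intro allI impI)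
  fix x y and r :: real assume z: "(x, y) \<in> \<Omega>" "0 < r"
  have l: "linear (\<lambda>w. dd f (x, r *\<^sub>R y) (0, w))"
    by (rule dd_pair_linear(2)[OF smooth_on_differentiable[OF assms(1) cone[OF z]]])
  have "r * dd f (x, r *\<^sub>R y) (0, axis i 1) = r * (r ^ p * dd f (x, y) (0, axis i 1))"
    using dd_hom[OF assms z, of 0 "axis i 1"] linear_cmul[OF l, of r "axis i 1"] by simp
  then show "dd f (x, r *\<^sub>R y) (0, axis i 1) = r ^ p * dd f (x, y) (0, axis i 1)"
    using z(2) by simp
qed

lemma euler:
  assumes f: "smooth_on \<Omega> f" "hom p f" and z: "(x, y) \<in> \<Omega>"
  shows "(\<Sum>i\<in>UNIV. y $ i * pdy i f (x, y)) = real p * f (x, y)"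
proof -
  note d = smooth_on_differentiable[OF f(1) z]
  have "((\<lambda>r. (x, r *\<^sub>R y)) has_derivative (\<lambda>h. (0, h *\<^sub>R y))) (at 1)"
    by (intro has_derivative_Pair has_derivative_const has_derivative_scaleR_left has_derivative_ident)
  then have "((\<lambda>r. f (x, r *\<^sub>R y)) has_derivative (\<lambda>h. dd f (x, y) (0, h *\<^sub>R y))) (at 1)"
    by (rule has_derivative_compose) (use has_derivative_dd[OF d] in simp)
  then have "((\<lambda>r. r ^ p * f (x, y)) has_derivative (\<lambda>h. dd f (x, y) (0, h *\<^sub>R y))) (at 1)"
    by (rule has_derivative_transform_within_open[where s="{0<..}"])
      (use homD[OF f(2) z] in \<open>auto\<close>)
  moreover have "((\<lambda>r. r ^ p * f (x, y)) has_derivative (\<lambda>h. h * (real p * f (x, y)))) (at 1)"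
    by (auto intro!: derivative_eq_intros)
  ultimately have "(\<lambda>h. dd f (x, y) (0, h *\<^sub>R y)) = (\<lambda>h. h * (real p * f (x, y)))"
    by (rule has_derivative_unique)
  from fun_cong[OF this, of 1] show ?thesis by (simp add: dd_fibre_pdy[OF d])
qed

lemma hom_E: "hom 2 E"
  by (simp add: hom_def E_def homogeneous power_mult_distrib)

lemma hom_pdy_E: "hom 1 (pdy k E)"
  by (rule hom_pdy[OF smooth_E]) (use hom_E in \<open>simp add: numeral_2_eq_2\<close>)

lemma hom_W: "hom 2 (W k)"
  using homD[OF hom_pdx[OF smooth_pdy[OF smooth_E] hom_pdy_E]] homD[OF hom_pdx[OF smooth_E hom_E]]
  by (simp add: hom_def W_def right_diff_distrib sum_distrib_left power2_eq_square mult_ac)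

lemma hom_B: "hom 2 (B k)"
proof -
  have "hom 0 (pdy i (pdy j E))" for i j
    by (rule hom_pdy[OF smooth_pdy[OF smooth_E]]) (use hom_pdy_E in simp)
  then have "fundamental_tensor L (x, r *\<^sub>R y) = fundamental_tensor L (x, y)"
    if "(x, y) \<in> \<Omega>" "0 < r" for x y r
    using that homD[of 0 "pdy _ (pdy _ E)"] by (simp add: vec_eq_iff fundamental_tensor_E cone)
  then show ?thesis
    using homD[OF hom_W] by (simp add: hom_def B_def sum_distrib_left mult_ac)
qed

text \<open>\<open>B\<close> is homogeneous of degree two, so Euler's identity recovers it from its
  fibre derivatives; these are four times the nonlinear connection, which is linear in y for a
  Berwald metric.\<close>

lemma B_eq:
  assumes "(x, y) \<in> \<Omega>"
  shows "B k (x, y) = 2 * \<Gamma> x y y $ k"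
proof -
  have "pdy i (B k) (x, y) = 4 * (\<Sum>j\<in>UNIV. G k i j x * y $ j)" for i
    using nonlin_conn_B[of k i "(x, y)"] nonlin_conn_eq[OF assms, of k i] by simp
  then have "2 * B k (x, y) = (\<Sum>i\<in>UNIV. y $ i * (4 * (\<Sum>j\<in>UNIV. G k i j x * y $ j)))"
    using euler[OF smooth_B hom_B assms, of k] by simp
  also have "\<dots> = 4 * \<Gamma> x y y $ k"
    by (simp add: christoffel_action_def sum_distrib_left mult_ac)
  finally show ?thesis by simp
qed

section \<open>Symmetry of the coefficients and parallelism of \<open>F\<^sup>2\<close>\<close>

lemma open_fibre: "open {y. (x, y) \<in> \<Omega>}"
  using open_dom by (intro open_vimage[of \<Omega> "Pair x", unfolded vimage_def] continuous_intros)

text \<open>The nonlinear connection is a fibre gradient. Differentiating the quadratic expression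
  \<open>B_eq\<close> yields the symmetrized coefficients, whereas the Berwald condition yields the
  given ones; the difference is linear in y and vanishes on an open cone.\<close>

lemma coeffs_sym:
  assumes z: "(x, y) \<in> \<Omega>"
  shows "G k i j x = G k j i x"
proof -
  have "(\<Sum>j\<in>UNIV. (G k i j x - G k j i x) * y $ j) = 0" if "(x, y) \<in> \<Omega>" for y
  proof -
    have "((\<lambda>y. 2 * \<Gamma> x y y $ k) has_derivative (\<lambda>w. 2 * (\<Gamma> x y w $ k + \<Gamma> x w y $ k))) (at y)"
      by (rule has_derivative_mult_right[OF has_derivative_christoffel_diagonal])
    from dd_fibre_eqI[OF open_dom that smooth_on_differentiable[OF smooth_B that] this B_eq, of "axis i 1"]
    have "pdy i (B k) (x, y) = 2 * (\<Gamma> x y (axis i 1) $ k + \<Gamma> x (axis i 1) y $ k)"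
      by (simp add: pdy_dd)
    moreover have "pdy i (B k) (x, y) = 4 * \<Gamma> x (axis i 1) y $ k"
      using nonlin_conn_B[of k i "(x, y)"] nonlin_conn_eq[OF that, of k i]
      by (simp add: christoffel_action_axis)
    ultimately have "\<Gamma> x (axis i 1) y $ k - \<Gamma> x y (axis i 1) $ k = 0" by simp
    then show ?thesis
      by (simp add: christoffel_action_axis left_diff_distrib sum_subtractf)
  qed
  moreover have "linear (\<lambda>y. \<Sum>j\<in>UNIV. (G k i j x - G k j i x) * y $ j)"
    by (auto intro!: linearI simp: distrib_left sum.distrib sum_distrib_left mult.left_commute)
  ultimately have "(\<Sum>l\<in>UNIV. (G k i l x - G k l i x) * axis j 1 $ l) = 0"
    using linear_zero_if_zero_on_open[OF _ open_fibre, of _ y x] z by blast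
  then show ?thesis by (simp only: sum_axis)
qed

lemma action_commute: "(x, y) \<in> \<Omega> \<Longrightarrow> \<Gamma> x u v = \<Gamma> x v u"
proof -
  assume z: "(x, y) \<in> \<Omega>"
  have "(\<Sum>i\<in>UNIV. \<Sum>j\<in>UNIV. G k i j x * u $ i * v $ j) = (\<Sum>i\<in>UNIV. \<Sum>j\<in>UNIV. G k i j x * v $ i * u $ j)" for k
    by (subst sum.swap, intro sum.cong refl) (subst coeffs_sym[OF z], simp only: mult_ac)
  then show ?thesis by (simp add: christoffel_action_def)
qed

text \<open>The index of \<open>B\<close> is lowered again with the fundamental tensor. The 1/2 in
  that tensor cancels the 2 in \<open>B_eq\<close>.\<close>

lemma euler_lagrange:
  assumes z: "(x, y) \<in> \<Omega>"
  shows "(\<Sum>j\<in>UNIV. pdy k (pdy j E) (x, y) * \<Gamma> x y y $ j) = W k (x, y)"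
proof -
  let ?g = "fundamental_tensor L (x, y)"
  have "(\<chi> j. B j (x, y)) = matrix_inv ?g *v (\<chi> k. W k (x, y))"
    by (simp add: vec_eq_iff B_def matrix_vector_mult_def)
  then have "?g *v (\<chi> j. B j (x, y)) = (\<chi> k. W k (x, y))"
    by (simp add: matrix_vector_mul_assoc matrix_inv_mult(1)[OF nondegenerate[OF z]])
  then have "(\<Sum>j\<in>UNIV. ?g $ k $ j * B j (x, y)) = W k (x, y)"
    by (simp add: vec_eq_iff matrix_vector_mult_def)
  then show ?thesis by (simp add: fundamental_tensor_E[OF z] B_eq[OF z])
qed

lemma pdy_pdx_commute: "z \<in> \<Omega> \<Longrightarrow> pdx l (pdy k E) z = pdy k (pdx l E) z"
  unfolding pdx_def[abs_def] pdy_def[abs_def] by (rule dd_commute[OF open_dom smooth_E])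

text \<open>Conservation of energy along the spray: the Euler-Lagrange equation is contracted with
  y, and Euler's identity is used in degree one on the left and degree two on the right.\<close>

lemma spray_E:
  assumes z: "(x, y) \<in> \<Omega>"
  shows "(\<Sum>j\<in>UNIV. pdy j E (x, y) * \<Gamma> x y y $ j) = (\<Sum>l\<in>UNIV. y $ l * pdx l E (x, y))"
proof -
  have "(\<Sum>k\<in>UNIV. y $ k * (\<Sum>j\<in>UNIV. pdy k (pdy j E) (x, y) * \<Gamma> x y y $ j)) =
      (\<Sum>j\<in>UNIV. (\<Sum>k\<in>UNIV. y $ k * pdy k (pdy j E) (x, y)) * \<Gamma> x y y $ j)"
    unfolding sum_distrib_left sum_distrib_right by (subst sum.swap) (simp add: mult_ac)
  also have "\<dots> = (\<Sum>j\<in>UNIV. pdy j E (x, y) * \<Gamma> x y y $ j)"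
    by (simp add: euler[OF smooth_pdy[OF smooth_E] hom_pdy_E z])
  finally have 1: "(\<Sum>j\<in>UNIV. pdy j E (x, y) * \<Gamma> x y y $ j) = (\<Sum>k\<in>UNIV. y $ k * W k (x, y))"
    by (simp add: euler_lagrange[OF z])
  have "(\<Sum>k\<in>UNIV. y $ k * (\<Sum>l\<in>UNIV. y $ l * pdx l (pdy k E) (x, y))) =
      (\<Sum>l\<in>UNIV. y $ l * (\<Sum>k\<in>UNIV. y $ k * pdy k (pdx l E) (x, y)))"
    unfolding sum_distrib_left by (subst sum.swap) (simp add: pdy_pdx_commute[OF z] mult_ac)
  also have "\<dots> = 2 * (\<Sum>l\<in>UNIV. y $ l * pdx l E (x, y))"
    by (simp add: euler[OF smooth_pdx[OF smooth_E] hom_pdx[OF smooth_E hom_E] z] sum_distrib_left mult_ac)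
  finally show ?thesis
    by (simp add: 1 W_def right_diff_distrib sum_subtractf)
qed

text \<open>The horizontal derivative of \<open>F\<^sup>2\<close> vanishes: differentiate \<open>spray_E\<close> along the fibre and
  subtract the Euler--Lagrange equation.\<close>

lemma horizontal_E:
  assumes z: "(x, y) \<in> \<Omega>"
  shows "dd E (x, y) (u, - \<Gamma> x u y) = 0"
proof -
  define R where "R z = (\<Sum>l\<in>UNIV. snd z $ l * pdx l E z)" for z
  note dE = smooth_on_differentiable[OF smooth_E z]
  have smR: "smooth_on \<Omega> R"
    unfolding R_def[abs_def] by (intro smooth_on_sum smooth_on_mult open_dom smooth_fibre_coord smooth_pdx smooth_E)
  have pdyE: "((\<lambda>y. pdy j E (x, y)) has_derivative (\<lambda>w. dd (pdy j E) (x, y) (0, w))) (at y)" for j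
  proof -
    have "((\<lambda>y. (x, y)) has_derivative (\<lambda>w. (0, w))) (at y)"
      by (intro has_derivative_Pair has_derivative_const has_derivative_ident)
    then show ?thesis
      by (rule has_derivative_compose) (rule smooth_on_has_derivative[OF smooth_pdy[OF smooth_E] z])
  qed
  have pdxE: "((\<lambda>y. pdx j E (x, y)) has_derivative (\<lambda>w. dd (pdx j E) (x, y) (0, w))) (at y)" for j
  proof -
    have "((\<lambda>y. (x, y)) has_derivative (\<lambda>w. (0, w))) (at y)"
      by (intro has_derivative_Pair has_derivative_const has_derivative_ident)
    then show ?thesis
      by (rule has_derivative_compose) (rule smooth_on_has_derivative[OF smooth_pdx[OF smooth_E] z])
  qed
  have "pdx k E (x, y) = (\<Sum>j\<in>UNIV. pdy j E (x, y) * \<Gamma> x (axis k 1) y $ j)" for k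
  proof -
    \<comment> \<open>\<open>R\<close> is differentiated along the fibre twice: here through the
      expression provided by \<open>spray_E\<close>, below from its definition.\<close>
    have 1: "dd R (x, y) (0, axis k 1) = (\<Sum>j\<in>UNIV. pdy j E (x, y) *
        (\<Gamma> x y (axis k 1) $ j + \<Gamma> x (axis k 1) y $ j) + dd (pdy j E) (x, y) (0, axis k 1) * \<Gamma> x y y $ j)"
      by (rule dd_fibre_eqI[OF open_dom z smooth_on_differentiable[OF smR z]],
          rule has_derivative_sum, rule has_derivative_mult[OF pdyE has_derivative_christoffel_diagonal])
        (simp add: R_def spray_E)
    have 2: "dd R (x, y) (0, axis k 1) =
        (\<Sum>l\<in>UNIV. y $ l * dd (pdx l E) (x, y) (0, axis k 1) + axis k 1 $ l * pdx l E (x, y))"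
      by (rule dd_fibre_eqI[OF open_dom z smooth_on_differentiable[OF smR z]],
          rule has_derivative_sum, rule has_derivative_mult[OF _ pdxE])
        (auto simp: R_def intro!: bounded_linear_imp_has_derivative bounded_linear_vec_nth)
    have "(\<Sum>j\<in>UNIV. pdy k (pdy j E) (x, y) * \<Gamma> x y y $ j) =
        (\<Sum>l\<in>UNIV. y $ l * pdy k (pdx l E) (x, y)) - pdx k E (x, y)"
      using euler_lagrange[OF z, of k] by (simp add: W_def pdy_pdx_commute[OF z])
    moreover have "(\<Sum>l\<in>UNIV. axis k 1 $ l * pdx l E (x, y)) = pdx k E (x, y)"
      using sum_axis[of "\<lambda>l. pdx l E (x, y)" k] by (simp add: mult.commute)
    ultimately have "(\<Sum>j\<in>UNIV. pdy j E (x, y) * (\<Gamma> x y (axis k 1) $ j + \<Gamma> x (axis k 1) y $ j)) =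
        2 * pdx k E (x, y)"
      using 1 2 by (simp add: sum.distrib pdy_dd)
    then show ?thesis
      by (simp add: action_commute[OF z, of y "axis k 1"] mult_2[symmetric] sum_distrib_left[symmetric]
          mult.left_commute[of _ 2])
  qed
  then have "dd E (x, y) (axis k 1, 0) = dd E (x, y) (0, \<Gamma> x (axis k 1) y)" for k
    by (simp add: dd_fibre_pdy[OF dE] pdx_dd mult.commute)
  moreover have "linear (\<lambda>u. dd E (x, y) (0, \<Gamma> x u y))"
    using linear_compose[OF linear_christoffel_action(1) dd_pair_linear(2)[OF dE]] by (simp add: o_def)
  ultimately have "dd E (x, y) (u, 0) = dd E (x, y) (0, \<Gamma> x u y)"
    using linear_axis_sum[OF dd_pair_linear(1)[OF dE], of u]
      linear_axis_sum[of "\<lambda>u. dd E (x, y) (0, \<Gamma> x u y)" u] by simp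
  then show ?thesis
    using dd_pair_linear(3)[OF dE, of u "- \<Gamma> x u y"] linear_neg[OF dd_pair_linear(2)[OF dE]] by simp
qed

text \<open>The fibre derivative of the nonlinear connection at any y of the cone is the coefficient
  itself. As \<open>\<Omega>\<close> is open, one fixed y serves for all nearby base points,
  although perhaps not for all of \<open>V\<close>.\<close>

lemma smooth_coeffs:
  assumes V: "open V" "\<And>x. x \<in> V \<Longrightarrow> \<exists>y. (x, y) \<in> \<Omega>"
  shows "smooth_on V (G k i j)"
proof (rule smooth_on_locally)
  fix x assume "x \<in> V"
  then obtain y where y: "(x, y) \<in> \<Omega>" using V by blast
  define T where "T = {x. (x, y) \<in> \<Omega>}"
  have T: "open T"
    unfolding T_def using open_dom
    by (intro open_vimage[of \<Omega> "\<lambda>x. (x, y)", unfolded vimage_def] continuous_intros)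
  have sm: "smooth_on \<Omega> (nonlin_conn L k i)"
    using smooth_on_mult[OF open_dom smooth_on_const smooth_pdy[OF smooth_B]]
    by (rule smooth_on_cong[OF open_dom nonlin_conn_B[symmetric]])
  have eq: "pdy j (nonlin_conn L k i) (x, y) = G k i j x" if "(x, y) \<in> \<Omega>" for x y
  proof -
    have "((\<lambda>y. \<Sum>l\<in>UNIV. G k i l x * y $ l) has_derivative (\<lambda>w. \<Sum>l\<in>UNIV. G k i l x * w $ l)) (at y)"
      by (intro has_derivative_sum has_derivative_mult_right bounded_linear_imp_has_derivative bounded_linear_vec_nth)
    from dd_fibre_eqI[OF open_dom that smooth_on_differentiable[OF sm that] this nonlin_conn_eq]
    show ?thesis by (simp add: pdy_dd sum_axis)
  qed
  have "smooth_on T (\<lambda>x. pdy j (nonlin_conn L k i) (x, y))"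
    by (rule smooth_on_slice[OF open_dom T]) (use smooth_pdy[OF sm] in \<open>auto simp: T_def\<close>)
  then have "smooth_on T (G k i j)"
    by (rule smooth_on_cong[OF T, rotated]) (rule eq, simp add: T_def)
  then show "\<exists>T. open T \<and> x \<in> T \<and> smooth_on T (G k i j)"
    using T y by (auto simp: T_def)
qed

end

section \<open>Pseudo-Riemannian metrics and curvature in a chart\<close>

lemma pd_dd: "pd i f x = dd f x (axis i 1)"
  by (simp add: pd_def)

lemma smooth_on_pd: "smooth_on S f \<Longrightarrow> smooth_on S (pd i f)"
  using smooth_on_dd by (simp add: pd_def[abs_def])

lemma pd_cong: "open S \<Longrightarrow> x \<in> S \<Longrightarrow> (\<And>y. y \<in> S \<Longrightarrow> f y = g y) \<Longrightarrow> pd i f x = pd i g x"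
  unfolding pd_def using dd_cong by metis

lemma pd_commute: "open S \<Longrightarrow> smooth_on S f \<Longrightarrow> x \<in> S \<Longrightarrow> pd i (pd j f) x = pd j (pd i f) x"
  unfolding pd_def[abs_def] by (rule dd_commute)

lemma dd_pd_sum:
  fixes f :: "real^'n::finite \<Rightarrow> real"
  shows "f differentiable (at x) \<Longrightarrow> dd f x v = (\<Sum>i\<in>UNIV. v $ i * pd i f x)"
  unfolding pd_dd by (rule linear_axis_sum[OF linear_frechet_derivative])

lemma smooth_on_fst:
  fixes f :: "'v::real_normed_vector \<Rightarrow> 'w::real_normed_vector" and \<Omega> :: "('v \<times> 'u::real_normed_vector) set"
  assumes "open \<Omega>" "\<And>z. z \<in> \<Omega> \<Longrightarrow> fst z \<in> V" "smooth_on V f"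
  shows "smooth_on \<Omega> (\<lambda>z. f (fst z))"
proof -
  have "ck_on k V f \<Longrightarrow> ck_on k \<Omega> (\<lambda>z. f (fst z))" for k
  proof (induction k arbitrary: f)
    case 0
    then show ?case
      using assms(2) by (auto intro!: continuous_on_compose2[of V f] continuous_intros)
  next
    case (Suc k)
    have der: "((\<lambda>z. f (fst z)) has_derivative (\<lambda>v. dd f (fst z) (fst v))) (at z)" if "z \<in> \<Omega>" for z
      by (rule has_derivative_compose[OF has_derivative_fst[OF has_derivative_ident]])
        (use Suc.prems assms(2)[OF that] in \<open>simp add: has_derivative_dd\<close>)
    have "ck_on k \<Omega> (\<lambda>z. dd f (fst z) (fst v))" for v
      using Suc.IH[of "\<lambda>x. dd f x (fst v)"] Suc.prems by simp
    then have "ck_on k \<Omega> (\<lambda>z. dd (\<lambda>z. f (fst z)) z v)" for v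
      by (rule ck_on_cong[OF assms(1), rotated]) (simp add: dd_eqI[OF der])
    moreover have "(\<lambda>z. f (fst z)) differentiable (at z)" if "z \<in> \<Omega>" for z
      using der[OF that] by (auto simp: differentiable_def)
    ultimately show ?case by simp
  qed
  then show ?thesis using assms(3) by (simp add: smooth_on_def)
qed

lemma transpose_matrix_inv:
  fixes A :: "real^'n^'n"
  assumes "invertible A" "transpose A = A"
  shows "transpose (matrix_inv A) = matrix_inv A"
proof -
  have "transpose (matrix_inv A) ** A = mat 1"
    using matrix_inv_mult(1)[OF assms(1)] matrix_transpose_mul[of A "matrix_inv A"] assms(2) by simp
  then have "transpose (matrix_inv A) ** (A ** matrix_inv A) = matrix_inv A"
    by (simp add: matrix_mul_assoc)
  then show ?thesis by (simp add: matrix_inv_mult(1)[OF assms(1)])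
qed

lemma sum_delta_mult:
  fixes f :: "'n::finite \<Rightarrow> real"
  shows "(\<Sum>i\<in>UNIV. f i * (if i = k then 1 else 0)) = f k"
    "(\<Sum>i\<in>UNIV. f i * (if k = i then 1 else 0)) = f k"
  by (simp_all add: if_distrib cong: if_cong)

section \<open>Inverse metric, volume and Levi-Civita connection\<close>

locale metric_chart =
  fixes V :: "(real^'n) set" and h :: "'n::finite \<Rightarrow> 'n \<Rightarrow> real^'n \<Rightarrow> real"
  assumes open_dom: "open V" and smooth: "smooth_on V (h i j)"
    and sym: "x \<in> V \<Longrightarrow> h i j x = h j i x"
    and nondegenerate: "x \<in> V \<Longrightarrow> invertible (\<chi> i j. h i j x)"
begin

lemma pd_sym: "x \<in> V \<Longrightarrow> pd l (h i j) x = pd l (h j i) x"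
  by (rule pd_cong[OF open_dom]) (assumption, rule sym)

definition hinv :: "'n \<Rightarrow> 'n \<Rightarrow> real^'n \<Rightarrow> real" where
  "hinv i j x = matrix_inv (\<chi> i j. h i j x) $ i $ j"

lemma hinv_mult:
  assumes "x \<in> V"
  shows "(\<Sum>l\<in>UNIV. h i l x * hinv l j x) = (if i = j then 1 else 0)"
    "(\<Sum>l\<in>UNIV. hinv i l x * h l j x) = (if i = j then 1 else 0)"
  using matrix_inv_mult[OF nondegenerate[OF assms]]
  by (auto simp: vec_eq_iff matrix_matrix_mult_def mat_def hinv_def)

lemma hinv_sym:
  assumes "x \<in> V"
  shows "hinv i j x = hinv j i x"
proof -
  have "transpose (\<chi> i j. h i j x) = (\<chi> i j. h i j x)"
    using sym[OF assms] by (simp add: transpose_def vec_eq_iff)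
  from transpose_matrix_inv[OF nondegenerate[OF assms] this]
  show ?thesis by (simp add: hinv_def transpose_def vec_eq_iff)
qed

lemma smooth_hinv: "smooth_on V (hinv i j)"
  unfolding hinv_def[abs_def]
  by (rule smooth_on_matrix_inv) (use open_dom smooth nondegenerate in auto)

text \<open>Differentiate h h^-1 = 1 and multiply by h^-1 from the left.\<close>

lemma dd_hinv:
  assumes x: "x \<in> V"
  shows "dd (hinv p j) x v = - (\<Sum>i\<in>UNIV. \<Sum>l\<in>UNIV. hinv p i x * dd (h i l) x v * hinv l j x)"
proof -
  note dh = smooth_on_differentiable[OF smooth x] and di = smooth_on_differentiable[OF smooth_hinv x]
  have 0: "(\<Sum>l\<in>UNIV. h i l x * dd (hinv l j) x v + dd (h i l) x v * hinv l j x) = 0" for i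
  proof -
    have "dd (\<lambda>x. \<Sum>l\<in>UNIV. h i l x * hinv l j x) x = dd (\<lambda>x. if i = j then 1 else 0) x"
      by (rule dd_cong[OF open_dom x]) (rule hinv_mult)
    then have "dd (\<lambda>x. \<Sum>l\<in>UNIV. h i l x * hinv l j x) x v = 0" by (cases "i = j") auto
    then show ?thesis by (simp add: dd_sum dd_mult dh di)
  qed
  have "(\<Sum>i\<in>UNIV. hinv p i x * (\<Sum>l\<in>UNIV. h i l x * dd (hinv l j) x v)) =
      (\<Sum>l\<in>UNIV. dd (hinv l j) x v * (\<Sum>i\<in>UNIV. hinv p i x * h i l x))"
    unfolding sum_distrib_left by (subst sum.swap) (simp only: mult_ac)
  also have "\<dots> = dd (hinv p j) x v" by (simp only: hinv_mult(2)[OF x] sum_delta_mult)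
  finally have "dd (hinv p j) x v = (\<Sum>i\<in>UNIV. hinv p i x * - (\<Sum>l\<in>UNIV. dd (h i l) x v * hinv l j x))"
    using 0 by (simp add: sum.distrib add_eq_0_iff2)
  then show ?thesis by (simp add: sum_negf sum_distrib_left mult.assoc)
qed

text \<open>By Jacobi's formula \<open>vol k\<close> is \<open>\<partial>\<^sub>k ln \<bar>det h\<bar>\<close>.\<close>

definition vol :: "'n \<Rightarrow> real^'n \<Rightarrow> real" where
  "vol k x = (\<Sum>i\<in>UNIV. \<Sum>l\<in>UNIV. hinv i l x * pd k (h i l) x)"

lemma smooth_vol: "smooth_on V (vol k)"
  unfolding vol_def[abs_def]
  by (intro smooth_on_sum smooth_on_mult open_dom smooth_hinv smooth_on_pd smooth)

text \<open>With H the inverse metric, the derivative is tr(H \<partial>_j \<partial>_k h) - tr(H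
  (\<partial>_j h) H (\<partial>_k h)). The first term is symmetric in j and k because partial
  derivatives commute, the second because the trace is cyclic. Working with traces avoids the
  logarithm of a determinant of unknown sign.\<close>

lemma vol_closed:
  assumes x: "x \<in> V"
  shows "pd j (vol k) x = pd k (vol j) x"
proof -
  define X where "X k = (\<chi> p q. pd k (h p q) x)" for k
  define H where "H = matrix_inv (\<chi> i j. h i j x)"
  have "X k $ i $ l = X k $ l $ i" for k i l
    unfolding X_def using pd_sym[OF x] by simp
  then have tr: "(\<Sum>i\<in>UNIV. \<Sum>l\<in>UNIV. M $ i $ l * X k $ i $ l) = trace (M ** X k)" for M :: "real^'n^'n" and k
    by (simp add: trace_def matrix_matrix_mult_def)
  have cyc: "trace (H ** X j ** H ** X k) = trace (H ** X k ** H ** X j)" for j k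
    using trace_mul_sym[of "H ** X j" "H ** X k"] by (simp add: matrix_mul_assoc)
  have pv: "pd j (vol k) x =
      (\<Sum>i\<in>UNIV. \<Sum>l\<in>UNIV. hinv i l x * pd j (pd k (h i l)) x) - trace (H ** X j ** H ** X k)" for j k
  proof -
    have "pd j (vol k) x = (\<Sum>i\<in>UNIV. \<Sum>l\<in>UNIV. hinv i l x * pd j (pd k (h i l)) x
        + dd (hinv i l) x (axis j 1) * pd k (h i l) x)"
      unfolding vol_def[abs_def] pd_dd[of j]
      by (simp add: dd_sum dd_mult differentiable_sum differentiable_mult
          smooth_on_differentiable[OF smooth_hinv x] smooth_on_differentiable[OF smooth_on_pd[OF smooth] x])
    moreover have "dd (hinv i l) x (axis j 1) = - (H ** X j ** H) $ i $ l" for i l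
      unfolding dd_hinv[OF x] H_def X_def matrix_mul_assoc[symmetric]
      by (simp add: matrix_matrix_mult_def hinv_def pd_dd sum_distrib_left mult.assoc)
    moreover have "pd k (h i l) x = X k $ i $ l" for i l by (simp add: X_def)
    ultimately show ?thesis by (simp add: sum.distrib sum_negf sum_subtractf tr)
  qed
  have "(\<Sum>i\<in>UNIV. \<Sum>l\<in>UNIV. hinv i l x * pd j (pd k (h i l)) x) =
      (\<Sum>i\<in>UNIV. \<Sum>l\<in>UNIV. hinv i l x * pd k (pd j (h i l)) x)"
    by (simp add: pd_commute[OF open_dom smooth x])
  then show ?thesis unfolding pv cyc[of j k] by simp
qed

definition lc :: "'n \<Rightarrow> 'n \<Rightarrow> 'n \<Rightarrow> real^'n \<Rightarrow> real" where
  "lc k i j x = 1/2 * (\<Sum>l\<in>UNIV. hinv k l x * (pd i (h j l) x + pd j (h i l) x - pd l (h i j) x))"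

text \<open>After contraction with the symmetric inverse metric the first and the third derivative
  in the Christoffel symbol cancel.\<close>

lemma lc_trace:
  assumes x: "x \<in> V"
  shows "(\<Sum>i\<in>UNIV. lc i i k x) = vol k x / 2"
proof -
  have "(\<Sum>i\<in>UNIV. \<Sum>l\<in>UNIV. hinv i l x * pd i (h k l) x) = (\<Sum>l\<in>UNIV. \<Sum>i\<in>UNIV. hinv l i x * pd i (h l k) x)"
    by (subst sum.swap) (simp only: hinv_sym[OF x] pd_sym[OF x, of _ k])
  moreover have "(\<Sum>i\<in>UNIV. lc i i k x) =
      1/2 * (\<Sum>i\<in>UNIV. \<Sum>l\<in>UNIV. hinv i l x * (pd i (h k l) x + pd k (h i l) x - pd l (h i k) x))"
    by (simp only: lc_def sum_distrib_left)
  ultimately show ?thesis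
    by (simp add: vol_def right_diff_distrib distrib_left sum.distrib sum_subtractf)
qed

text \<open>Koszul's argument: in the combination of derivatives that defines \<open>lc\<close>,
  four of the six connection terms cancel by symmetry and the remaining two coincide.\<close>

lemma lc_unique:
  assumes x: "x \<in> V" and G: "\<And>k i j. G k i j x = G k j i x"
    and parallel: "\<And>i j k. pd k (h i j) x = (\<Sum>l\<in>UNIV. G l k i x * h l j x) + (\<Sum>l\<in>UNIV. G l k j x * h i l x)"
  shows "lc k i j x = G k i j x"
proof -
  have "pd i (h j l) x + pd j (h i l) x - pd l (h i j) x = 2 * (\<Sum>r\<in>UNIV. h l r x * G r i j x)" for l
  proof -
    have "(\<Sum>r\<in>UNIV. G r i l x * h j r x) = (\<Sum>r\<in>UNIV. G r l i x * h r j x)"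
      "(\<Sum>r\<in>UNIV. G r j l x * h i r x) = (\<Sum>r\<in>UNIV. G r l j x * h i r x)"
      "(\<Sum>r\<in>UNIV. G r i j x * h r l x) = (\<Sum>r\<in>UNIV. h l r x * G r i j x)"
      "(\<Sum>r\<in>UNIV. G r j i x * h r l x) = (\<Sum>r\<in>UNIV. h l r x * G r i j x)"
      by (intro sum.cong refl, metis sym[OF x] G mult.commute)+
    then show ?thesis unfolding parallel by linarith
  qed
  then have "lc k i j x = (\<Sum>l\<in>UNIV. hinv k l x * (\<Sum>r\<in>UNIV. h l r x * G r i j x))"
    by (simp add: lc_def sum_distrib_left mult.left_commute[of _ 2])
  also have "\<dots> = (\<Sum>r\<in>UNIV. G r i j x * (\<Sum>l\<in>UNIV. hinv k l x * h l r x))"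
    unfolding sum_distrib_left by (subst sum.swap) (simp only: mult_ac)
  also have "\<dots> = G k i j x" by (simp only: hinv_mult(2)[OF x] sum_delta_mult)
  finally show ?thesis .
qed

text \<open>Contraction with the inverse metric. Both connection terms give the same trace, and h^ij
  h_ij = n produces the factor in front of \<kappa>. Thus \<kappa> is determined by the metric and
  the trace of the connection.\<close>

lemma weyl_trace:
  assumes x: "x \<in> V"
    and weyl: "\<And>i j. pd k (h i j) x =
      (\<Sum>l\<in>UNIV. G l k i x * h l j x) + (\<Sum>l\<in>UNIV. G l k j x * h i l x) + \<kappa> * h i j x"
  shows "vol k x = 2 * (\<Sum>l\<in>UNIV. G l k l x) + real CARD('n) * \<kappa>"
proof -
  have "(\<Sum>i\<in>UNIV. \<Sum>j\<in>UNIV. hinv i j x * (\<Sum>l\<in>UNIV. G l k i x * h l j x)) =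
      (\<Sum>i\<in>UNIV. \<Sum>l\<in>UNIV. G l k i x * (\<Sum>j\<in>UNIV. h l j x * hinv j i x))"
    unfolding sum_distrib_left
    by (rule sum.cong[OF refl], subst sum.swap) (simp add: hinv_sym[OF x] mult_ac)
  then have 1: "(\<Sum>i\<in>UNIV. \<Sum>j\<in>UNIV. hinv i j x * (\<Sum>l\<in>UNIV. G l k i x * h l j x)) = (\<Sum>l\<in>UNIV. G l k l x)"
    by (simp only: hinv_mult(1)[OF x] sum_delta_mult)
  have "(\<Sum>i\<in>UNIV. \<Sum>j\<in>UNIV. hinv i j x * (\<Sum>l\<in>UNIV. G l k j x * h i l x)) =
      (\<Sum>j\<in>UNIV. \<Sum>l\<in>UNIV. G l k j x * (\<Sum>i\<in>UNIV. hinv j i x * h i l x))"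
    unfolding sum_distrib_left
    by (subst sum.swap, rule sum.cong[OF refl], subst sum.swap) (simp add: hinv_sym[OF x] mult_ac)
  then have 2: "(\<Sum>i\<in>UNIV. \<Sum>j\<in>UNIV. hinv i j x * (\<Sum>l\<in>UNIV. G l k j x * h i l x)) = (\<Sum>l\<in>UNIV. G l k l x)"
    by (simp only: hinv_mult(2)[OF x] sum_delta_mult)
  have "(\<Sum>j\<in>UNIV. hinv i j x * h i j x) = 1" for i
    using hinv_mult(2)[OF x, of i i] sym[OF x] by simp
  then have 3: "(\<Sum>i\<in>UNIV. \<Sum>j\<in>UNIV. hinv i j x * (\<kappa> * h i j x)) = real CARD('n) * \<kappa>"
    by (simp add: mult.left_commute[of _ \<kappa>] sum_distrib_left[symmetric])
  show ?thesis
    unfolding vol_def weyl by (simp add: distrib_left sum.distrib 1 2 3)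
qed

end

text \<open>In the Ricci tensor the divergence term and both quadratic terms are symmetric in l and
  k for a symmetric connection. Only the derivative of the trace survives.\<close>

lemma affine_ricci_antisym:
  assumes V: "open V" "x \<in> V" and sm: "\<And>k i j. smooth_on V (G k i j)"
    and sym: "\<And>x k i j. x \<in> V \<Longrightarrow> G k i j x = G k j i x"
  shows "affine_ricci G l k x - affine_ricci G k l x =
    pd l (\<lambda>x. \<Sum>i\<in>UNIV. G i i k x) x - pd k (\<lambda>x. \<Sum>i\<in>UNIV. G i i l x) x"
proof -
  have 1: "pd i (G i k l) x = pd i (G i l k) x" for i
    by (rule pd_cong[OF V]) (rule sym)
  have 2: "(\<Sum>i\<in>UNIV. \<Sum>m\<in>UNIV. G i k m x * G m i l x) = (\<Sum>i\<in>UNIV. \<Sum>m\<in>UNIV. G i l m x * G m i k x)"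
    by (subst sum.swap, intro sum.cong refl) (metis sym[OF V(2)] mult.commute)
  have 3: "pd l (\<lambda>x. \<Sum>i\<in>UNIV. G i i k x) x = (\<Sum>i\<in>UNIV. pd l (G i i k) x)" for l k
    unfolding pd_dd by (rule dd_sum[OF smooth_on_differentiable[OF sm V(2)]])
  show ?thesis
    unfolding affine_ricci_def affine_curv_def sum.distrib sum_subtractf 2 3
    by (simp add: 1 sym[OF V(2), of _ k l])
qed

section \<open>Finsler curvature of a Berwald metric as affine curvature\<close>

context berwald_chart
begin

definition dom :: "(real^'n) set" where "dom = fst ` \<Omega>"

lemma open_base: "open dom"
  unfolding dom_def by (rule open_image_fst[OF open_dom])

lemma in_dom: "(x, y) \<in> \<Omega> \<Longrightarrow> x \<in> dom"
  by (force simp: dom_def)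

lemma smooth_G: "smooth_on dom (G k i j)"
  by (rule smooth_coeffs[OF open_base]) (auto simp: dom_def)

lemma G_sym: "x \<in> dom \<Longrightarrow> G k i j x = G k j i x"
  using coeffs_sym by (auto simp: dom_def)

lemma dd_fst_poly:
  assumes f: "\<And>l. smooth_on dom (f l)" and z: "(x, y) \<in> \<Omega>"
  shows "dd (\<lambda>z. \<Sum>l\<in>UNIV. f l (fst z) * snd z $ l) (x, y) (u, w) = (\<Sum>l\<in>UNIV. f l x * w $ l + dd (f l) x u * y $ l)"
proof -
  have "((\<lambda>z. f l (fst z)) has_derivative (\<lambda>v. dd (f l) (fst (x, y)) (fst v))) (at (x, y))" for l
    by (rule has_derivative_compose[OF has_derivative_fst[OF has_derivative_ident]])
      (use smooth_on_has_derivative[OF f in_dom[OF z]] in simp)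
  then have "((\<lambda>z. f l (fst z)) has_derivative (\<lambda>v. dd (f l) x (fst v))) (at (x, y))" for l by simp
  moreover have "((\<lambda>z. snd z $ l) has_derivative (\<lambda>v. snd v $ l)) (at (x, y))" for l :: 'n
    by (intro bounded_linear.has_derivative[OF bounded_linear_vec_nth] has_derivative_snd has_derivative_ident)
  ultimately have "((\<lambda>z. \<Sum>l\<in>UNIV. f l (fst z) * snd z $ l) has_derivative
      (\<lambda>v. \<Sum>l\<in>UNIV. f l (fst (x, y)) * snd v $ l + dd (f l) x (fst v) * snd (x, y) $ l)) (at (x, y))"
    by (intro has_derivative_sum has_derivative_mult)
  from dd_eqI[OF this] show ?thesis by simp
qed

lemma dd_nonlin_conn:
  assumes z: "(x, y) \<in> \<Omega>"
  shows "dd (nonlin_conn L k j) (x, y) (u, w) = (\<Sum>l\<in>UNIV. G k j l x * w $ l + dd (G k j l) x u * y $ l)"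
proof -
  have "dd (nonlin_conn L k j) (x, y) = dd (\<lambda>z. \<Sum>l\<in>UNIV. G k j l (fst z) * snd z $ l) (x, y)"
    by (rule dd_cong[OF open_dom z]) (auto simp: split_beta nonlin_conn_eq)
  then show ?thesis by (simp add: dd_fst_poly[OF smooth_G z])
qed

text \<open>Since the nonlinear connection is linear in y, the vertical part of the horizontal
  derivative is a product of two coefficients contracted with y; this is the quadratic term of the
  affine curvature.\<close>

lemma nonlin_curv_eq:
  assumes z: "(x, y) \<in> \<Omega>"
  shows "nonlin_curv L k i j (x, y) = (\<Sum>l\<in>UNIV. affine_curv G k l i j x * y $ l)"
proof -
  have hd: "horiz_deriv L i (nonlin_conn L k j) (x, y) =
      (\<Sum>l\<in>UNIV. pd i (G k j l) x * y $ l) - (\<Sum>l\<in>UNIV. (\<Sum>m\<in>UNIV. G k j m x * G m i l x) * y $ l)" for i j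
  proof -
    have "(\<Sum>m\<in>UNIV. (\<Sum>l\<in>UNIV. G m i l x * y $ l) * G k j m x) =
        (\<Sum>l\<in>UNIV. (\<Sum>m\<in>UNIV. G k j m x * G m i l x) * y $ l)"
      unfolding sum_distrib_right by (subst sum.swap) (simp only: mult_ac)
    moreover have "dd (G k j l) x 0 = 0" for k j l
      by (rule linear_0[OF linear_frechet_derivative[OF smooth_on_differentiable[OF smooth_G in_dom[OF z]]]])
    ultimately show ?thesis
      by (simp add: horiz_deriv_def pdx_dd pdy_dd dd_nonlin_conn[OF z] nonlin_conn_eq[OF z] pd_dd sum_axis)
  qed
  show ?thesis
    unfolding nonlin_curv_def hd affine_curv_def
    by (simp add: distrib_right left_diff_distrib sum.distrib sum_subtractf)
qed

lemma smooth_affine_ricci: "smooth_on dom (affine_ricci G l k)"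
  unfolding affine_ricci_def[abs_def] affine_curv_def
  by (intro smooth_on_sum smooth_on_add smooth_on_diff smooth_on_mult open_base smooth_G smooth_on_pd)

lemma finsler_Ric_eq:
  assumes z: "(x, y) \<in> \<Omega>"
  shows "finsler_Ric L (x, y) = (\<Sum>l\<in>UNIV. (\<Sum>j\<in>UNIV. affine_ricci G l j x * y $ j) * y $ l)"
proof -
  have "finsler_Ric L (x, y) = (\<Sum>i\<in>UNIV. \<Sum>j\<in>UNIV. \<Sum>l\<in>UNIV. affine_curv G i l i j x * y $ j * y $ l)"
    by (simp add: finsler_Ric_def nonlin_curv_eq[OF z] sum_distrib_right sum_distrib_left mult_ac)
  also have "\<dots> = (\<Sum>j\<in>UNIV. \<Sum>l\<in>UNIV. \<Sum>i\<in>UNIV. affine_curv G i l i j x * y $ j * y $ l)"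
    by (subst sum.swap, rule sum.cong[OF refl], rule sum.swap)
  also have "\<dots> = (\<Sum>l\<in>UNIV. \<Sum>j\<in>UNIV. \<Sum>i\<in>UNIV. affine_curv G i l i j x * y $ j * y $ l)"
    by (rule sum.swap)
  finally show ?thesis by (simp add: affine_ricci_def sum_distrib_right)
qed

text \<open>By \<open>finsler_Ric_eq\<close> the function to be differentiated is the quadratic form
  of the affine Ricci tensor, and half the Hessian of a quadratic form is its symmetric
  part.\<close>

lemma finsler_ricci_tensor_eq:
  assumes z: "(x, y) \<in> \<Omega>"
  shows "finsler_ricci_tensor L i j (x, y) = 1/2 * (affine_ricci G i j x + affine_ricci G j i x)"
proof -
  let ?R = "affine_ricci G"
  have 1: "pdy j (finsler_Ric L) (x, y) = (\<Sum>l\<in>UNIV. (?R l j x + ?R j l x) * y $ l)" if z: "(x, y) \<in> \<Omega>" for x y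
  proof -
    define q where "q z = (\<Sum>l\<in>UNIV. (\<Sum>j\<in>UNIV. ?R l j (fst z) * snd z $ j) * snd z $ l)" for z :: "(real^'n) \<times> (real^'n)"
    have nth: "((\<lambda>y. y $ l) has_derivative (\<lambda>w. w $ l)) (at y)" for l :: 'n and y :: "real^'n"
      by (rule bounded_linear_imp_has_derivative[OF bounded_linear_vec_nth])
    have lin: "((\<lambda>y. \<Sum>m\<in>UNIV. ?R l m x * y $ m) has_derivative (\<lambda>w. \<Sum>m\<in>UNIV. ?R l m x * w $ m)) (at y)" for l
      by (intro has_derivative_sum has_derivative_mult_right nth)
    have "pdy j (finsler_Ric L) (x, y) = dd q (x, y) (0, axis j 1)"
      unfolding pdy_def q_def[abs_def]
      by (rule fun_cong[OF dd_cong[OF open_dom z]]) (auto simp: split_beta finsler_Ric_eq)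
    also have "smooth_on \<Omega> q"
      unfolding q_def[abs_def]
      by (intro smooth_on_sum smooth_on_mult open_dom smooth_fibre_coord smooth_on_fst[OF open_dom _ smooth_affine_ricci])
        (auto simp: dom_def)
    then have "dd q (x, y) (0, axis j 1) = (\<Sum>l\<in>UNIV. (\<Sum>m\<in>UNIV. ?R l m x * y $ m) * axis j 1 $ l
        + (\<Sum>m\<in>UNIV. ?R l m x * axis j 1 $ m) * y $ l)"
      by (rule dd_fibre_eqI[OF open_dom z smooth_on_differentiable[OF _ z] has_derivative_sum[OF has_derivative_mult[OF lin nth]]])
        (simp add: q_def)
    finally show ?thesis by (simp add: sum_axis sum.distrib distrib_right add.commute)
  qed
  have sm: "smooth_on dom (\<lambda>x. ?R l j x + ?R j l x)" for l
    by (intro smooth_on_add open_base smooth_affine_ricci)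
  have "pdy i (pdy j (finsler_Ric L)) (x, y) =
      dd (\<lambda>z. \<Sum>l\<in>UNIV. (?R l j (fst z) + ?R j l (fst z)) * snd z $ l) (x, y) (0, axis i 1)"
    unfolding pdy_def[of i]
    by (rule fun_cong[OF dd_cong[OF open_dom z]]) (auto simp: split_beta 1)
  also have "\<dots> = ?R i j x + ?R j i x"
    using sm linear_0[OF linear_frechet_derivative[OF smooth_on_differentiable[OF sm in_dom[OF z]]]]
    by (simp add: dd_fst_poly[where f="\<lambda>l x. ?R l j x + ?R j l x", OF _ z] sum_axis)
  finally show ?thesis by (simp add: finsler_ricci_tensor_def)
qed

end

text \<open>The potential is the integral of \<kappa> along the segment from x0 to x, which stays in
  \<open>V\<close> by convexity. It is differentiated under the integral sign; closedness makes the
  resulting integrand a total derivative in t.\<close>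

lemma poincare:
  fixes \<kappa> :: "'n::finite \<Rightarrow> real^'n \<Rightarrow> real"
  assumes V: "open V" "convex V" and sm: "\<And>k. smooth_on V (\<kappa> k)"
    and closed: "\<And>x j k. x \<in> V \<Longrightarrow> pd j (\<kappa> k) x = pd k (\<kappa> j) x"
  obtains \<psi> where "\<And>x. x \<in> V \<Longrightarrow> (\<psi> has_derivative (\<lambda>u. \<Sum>k\<in>UNIV. \<kappa> k x * u $ k)) (at x)"
proof (cases "V = {}")
  case True
  then show ?thesis using that by blast
next
  case False
  then obtain x0 where x0: "x0 \<in> V" by blast
  define p where "p x t = x0 + t *\<^sub>R (x - x0)" for x and t :: real
  have p: "p x t \<in> V" if "x \<in> V" "t \<in> cbox 0 1" for x t
  proof -
    have "p x t = (1 - t) *\<^sub>R x0 + t *\<^sub>R x" by (simp add: p_def algebra_simps)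
    then show ?thesis using that x0 V(2) by (auto simp: convex_def)
  qed
  define f where "f x t = (\<Sum>k\<in>UNIV. \<kappa> k (p x t) * (x - x0) $ k)" for x t
  define D where "D x t = (\<chi> j. \<kappa> j (p x t) + t * (\<Sum>k\<in>UNIV. (x - x0) $ k * pd k (\<kappa> j) (p x t)))" for x t
  \<comment> \<open>\<open>leibniz_rule\<close> expects the derivative of the integrand as a bounded
    linear map, here the inner product with the gradient \<open>D x t\<close>.\<close>
  define fx where "fx x t = blinfun_inner_left (D x t)" for x t
  have fx: "blinfun_apply (fx x t) u = (\<Sum>j\<in>UNIV. u $ j * (\<kappa> j (p x t) + t * dd (\<kappa> j) (p x t) (x - x0)))"
    if "x \<in> V" "t \<in> cbox 0 1" for x t u
    by (simp add: fx_def D_def inner_vec_def dd_pd_sum[OF smooth_on_differentiable[OF sm p[OF that]], of _ "x - x0"])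
  have der: "((\<lambda>x. f x t) has_derivative blinfun_apply (fx x t)) (at x within V)"
    if x: "x \<in> V" and t: "t \<in> cbox 0 1" for x t
  proof -
    note pt = p[OF that]
    have "((\<lambda>x. x0 + t *\<^sub>R (x - x0)) has_derivative (\<lambda>u. 0 + t *\<^sub>R (u - 0))) (at x)"
      by (intro has_derivative_add has_derivative_const has_derivative_scaleR_right has_derivative_diff has_derivative_ident)
    then have "((\<lambda>x. p x t) has_derivative (\<lambda>u. t *\<^sub>R u)) (at x)"
      by (simp add: p_def)
    then have "((\<lambda>x. \<kappa> k (p x t)) has_derivative (\<lambda>u. dd (\<kappa> k) (p x t) (t *\<^sub>R u))) (at x)" for k
      by (rule has_derivative_compose) (rule smooth_on_has_derivative[OF sm pt])
    moreover have "((\<lambda>x. (x - x0) $ k) has_derivative (\<lambda>u. (u - 0) $ k)) (at x)" for k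
      by (intro bounded_linear.has_derivative[OF bounded_linear_vec_nth] has_derivative_diff has_derivative_ident has_derivative_const)
    ultimately have "((\<lambda>x. f x t) has_derivative (\<lambda>u. \<Sum>k\<in>UNIV. \<kappa> k (p x t) * (u - 0) $ k
        + dd (\<kappa> k) (p x t) (t *\<^sub>R u) * (x - x0) $ k)) (at x)"
      unfolding f_def by (intro has_derivative_sum has_derivative_mult)
    \<comment> \<open>Closedness enters here: the roles of the direction u and of x - x0 are
      exchanged.\<close>
    moreover have "(\<Sum>k\<in>UNIV. dd (\<kappa> k) (p x t) (t *\<^sub>R u) * (x - x0) $ k) =
        (\<Sum>j\<in>UNIV. u $ j * (t * dd (\<kappa> j) (p x t) (x - x0)))" for u
    proof -
      have "(\<Sum>k\<in>UNIV. dd (\<kappa> k) (p x t) (t *\<^sub>R u) * (x - x0) $ k) =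
          (\<Sum>k\<in>UNIV. \<Sum>j\<in>UNIV. u $ j * (t * ((x - x0) $ k * pd j (\<kappa> k) (p x t))))"
        unfolding dd_pd_sum[OF smooth_on_differentiable[OF sm pt]] sum_distrib_right
        by (simp only: vector_scaleR_component real_scaleR_def mult_ac)
      also have "\<dots> = (\<Sum>j\<in>UNIV. \<Sum>k\<in>UNIV. u $ j * (t * ((x - x0) $ k * pd k (\<kappa> j) (p x t))))"
        by (subst sum.swap) (simp only: closed[OF pt])
      finally show ?thesis
        by (simp add: dd_pd_sum[OF smooth_on_differentiable[OF sm pt], of _ "x - x0"] sum_distrib_left)
    qed
    ultimately have "((\<lambda>x. f x t) has_derivative (\<lambda>u. \<Sum>k\<in>UNIV. \<kappa> k (p x t) * u $ k
        + u $ k * (t * dd (\<kappa> k) (p x t) (x - x0)))) (at x)"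
      by (simp add: sum.distrib)
    also have "(\<lambda>u. \<Sum>k\<in>UNIV. \<kappa> k (p x t) * u $ k + u $ k * (t * dd (\<kappa> k) (p x t) (x - x0))) = blinfun_apply (fx x t)"
      by (simp add: fun_eq_iff fx[OF that] distrib_left mult.commute)
    finally show ?thesis by (rule has_derivative_at_withinI)
  qed
  have pc: "continuous_on (V \<times> cbox 0 1) (\<lambda>(x, t). p x t)"
    unfolding p_def case_prod_unfold by (intro continuous_intros)
  have c: "continuous_on (V \<times> cbox 0 1) (\<lambda>(x, t). g (p x t))" if "smooth_on V g" for g :: "real^'n \<Rightarrow> real"
  proof -
    have "(\<lambda>(x, t). p x t) ` (V \<times> cbox 0 1) \<subseteq> V"
    proof (rule image_subsetI)
      fix z assume "z \<in> V \<times> cbox (0::real) 1"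
      then show "(case z of (x, t) \<Rightarrow> p x t) \<in> V" using p[of "fst z" "snd z"] by (simp add: case_prod_unfold mem_Times_iff)
    qed
    from continuous_on_compose2[OF smooth_on_continuous[OF that] pc this] show ?thesis
      by (simp only: case_prod_unfold)
  qed
  have cD: "continuous_on (V \<times> cbox 0 1) (\<lambda>(x, t). D x t)"
    unfolding D_def case_prod_unfold
    by (intro continuous_on_vec_lambda continuous_on_add continuous_on_mult continuous_on_sum continuous_intros
        c[OF sm, unfolded case_prod_unfold] c[OF smooth_on_pd[OF sm], unfolded case_prod_unfold])
  have cfx: "continuous_on (V \<times> cbox 0 1) (\<lambda>(x, t). fx x t)"
    using bounded_linear.continuous_on[OF bounded_linear_blinfun_inner_left cD] by (simp add: fx_def case_prod_unfold)
  have cf: "continuous_on (V \<times> cbox 0 1) (\<lambda>(x, t). f x t)"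
    unfolding f_def case_prod_unfold
    by (intro continuous_on_mult continuous_on_sum continuous_intros c[OF sm, unfolded case_prod_unfold])
  have "continuous_on (cbox 0 1) (\<lambda>t. (\<lambda>(x, t). f x t) (x, t))" if "x \<in> V" for x
    by (rule continuous_on_compose2[OF cf]) (use that in \<open>auto intro!: continuous_intros\<close>)
  then have "continuous_on (cbox 0 1) (f x)" if "x \<in> V" for x
    using that by simp
  then have int: "f x integrable_on cbox 0 1" if "x \<in> V" for x
    using that integrable_continuous by blast
  show ?thesis
  proof (rule that)
    fix x assume x: "x \<in> V"
    have "((\<lambda>x. integral (cbox 0 1) (f x)) has_derivative blinfun_apply (integral (cbox 0 1) (fx x))) (at x within V)"
      by (rule leibniz_rule[OF der int cfx x V(2)])
    then have 1: "((\<lambda>x. integral (cbox 0 1) (f x)) has_derivative blinfun_apply (integral (cbox 0 1) (fx x))) (at x)"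
      using at_within_open[OF x V(1)] by simp
    have "continuous_on (cbox 0 1) (\<lambda>t. (\<lambda>(x, t). fx x t) (x, t))"
      by (rule continuous_on_compose2[OF cfx]) (use x in \<open>auto intro!: continuous_intros\<close>)
    then have "continuous_on (cbox 0 1) (fx x)" by simp
    then have I: "(fx x has_integral integral (cbox 0 1) (fx x)) (cbox 0 1)"
      using integrable_continuous by blast
    have "blinfun_apply (integral (cbox 0 1) (fx x)) u = (\<Sum>k\<in>UNIV. \<kappa> k x * u $ k)" for u
    proof -
      have i1: "((\<lambda>t. blinfun_apply (fx x t) u) has_integral blinfun_apply (integral (cbox 0 1) (fx x)) u) (cbox 0 1)"
        using has_integral_linear[OF I bounded_bilinear.bounded_linear_left[OF bounded_bilinear_blinfun_apply, of u]] by (simp add: o_def)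
      \<comment> \<open>The integrand is the t-derivative of t \<kappa>(u) at the point
        \<open>p x t\<close>. The factor t removes the boundary term at x0, and at t = 1 the value
        is \<kappa>(u) at x.\<close>
      have i2: "((\<lambda>t. blinfun_apply (fx x t) u) has_integral
          (1 * (\<Sum>k\<in>UNIV. u $ k * \<kappa> k (p x 1)) - 0 * (\<Sum>k\<in>UNIV. u $ k * \<kappa> k (p x 0)))) {0..1}"
      proof (rule fundamental_theorem_of_calculus)
        fix t :: real assume "t \<in> {0..1}"
        then have t: "t \<in> cbox 0 1" by simp
        have l: "linear (dd (\<kappa> k) (p x t))" for k
          by (rule linear_frechet_derivative[OF smooth_on_differentiable[OF sm p[OF x t]]])
        have "((\<lambda>t. x0 + t *\<^sub>R (x - x0)) has_derivative (\<lambda>h. 0 + h *\<^sub>R (x - x0))) (at t)"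
          by (intro has_derivative_add has_derivative_const has_derivative_scaleR_left has_derivative_ident)
        then have "(p x has_derivative (\<lambda>h. h *\<^sub>R (x - x0))) (at t)"
          by (simp add: p_def[abs_def])
        then have "((\<lambda>t. \<kappa> k (p x t)) has_derivative (\<lambda>h. dd (\<kappa> k) (p x t) (h *\<^sub>R (x - x0)))) (at t)" for k
          by (rule has_derivative_compose) (rule smooth_on_has_derivative[OF sm p[OF x t]])
        then have "((\<lambda>t. t * (\<Sum>k\<in>UNIV. u $ k * \<kappa> k (p x t))) has_derivative
            (\<lambda>h. t * (\<Sum>k\<in>UNIV. u $ k * dd (\<kappa> k) (p x t) (h *\<^sub>R (x - x0))) + h * (\<Sum>k\<in>UNIV. u $ k * \<kappa> k (p x t)))) (at t)"
          by (intro has_derivative_mult has_derivative_ident has_derivative_sum has_derivative_mult_right)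
        moreover have "(\<lambda>h. t * (\<Sum>k\<in>UNIV. u $ k * dd (\<kappa> k) (p x t) (h *\<^sub>R (x - x0))) + h * (\<Sum>k\<in>UNIV. u $ k * \<kappa> k (p x t))) =
            (\<lambda>h. h *\<^sub>R blinfun_apply (fx x t) u)"
          by (simp add: fun_eq_iff fx[OF x t] linear_cmul[OF l] distrib_left sum.distrib sum_distrib_left mult_ac add.commute)
        ultimately show "((\<lambda>t. t * (\<Sum>k\<in>UNIV. u $ k * \<kappa> k (p x t))) has_vector_derivative blinfun_apply (fx x t) u) (at t within {0..1})"
          by (simp add: has_vector_derivative_def has_derivative_at_withinI)
      qed simp
      from has_integral_unique[OF i1[unfolded box_real] i2] show ?thesis
        by (simp add: p_def mult.commute)
    qed
    then have "blinfun_apply (integral (cbox 0 1) (fx x)) = (\<lambda>u. \<Sum>k\<in>UNIV. \<kappa> k x * u $ k)"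
      by (rule ext)
    with 1 show "((\<lambda>x. integral (cbox 0 1) (f x)) has_derivative (\<lambda>u. \<Sum>k\<in>UNIV. \<kappa> k x * u $ k)) (at x)"
      by (simp only:)
  qed
qed

section \<open>Kropina metrics in a chart\<close>

definition form :: "('n::finite \<Rightarrow> 'n \<Rightarrow> real^'n \<Rightarrow> real) \<Rightarrow> real^'n \<Rightarrow> real^'n \<Rightarrow> real^'n \<Rightarrow> real" where
  "form h x v w = (\<Sum>i\<in>UNIV. (\<Sum>j\<in>UNIV. h i j x * w $ j) * v $ i)"

definition covector :: "('n::finite \<Rightarrow> real^'n \<Rightarrow> real) \<Rightarrow> real^'n \<Rightarrow> real^'n \<Rightarrow> real" where
  "covector b x v = (\<Sum>i\<in>UNIV. b i x * v $ i)"

lemma linear_covector: "linear (covector b x)"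
  by (auto intro!: linearI simp: covector_def distrib_left sum.distrib sum_distrib_left mult.left_commute)

lemma bilinear_form: "bilinear (form h x)"
  unfolding bilinear_def form_def
  by (auto intro!: linearI simp: distrib_left distrib_right sum.distrib sum_distrib_left sum_distrib_right mult_ac)

lemma form_axis: "form h x (axis i 1) (axis j 1) = h i j x"
  by (simp add: form_def sum_axis)

lemma form_axis_left: "form h x (axis i 1) v = (\<Sum>j\<in>UNIV. h i j x * v $ j)"
  by (simp add: form_def sum_axis)

lemma form_axis_right: "form h x v (axis j 1) = (\<Sum>i\<in>UNIV. h i j x * v $ i)"
  by (simp add: form_def sum_axis)

lemma covector_axis: "covector b x (axis i 1) = b i x"
  by (simp add: covector_def sum_axis)

lemma form_commute:
  assumes "\<And>i j. h i j x = h j i x"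
  shows "form h x v w = form h x w v"
proof -
  have "form h x v w = (\<Sum>i\<in>UNIV. \<Sum>j\<in>UNIV. h i j x * w $ j * v $ i)"
    by (simp add: form_def sum_distrib_right)
  also have "\<dots> = (\<Sum>j\<in>UNIV. \<Sum>i\<in>UNIV. h i j x * w $ j * v $ i)" by (rule sum.swap)
  also have "\<dots> = form h x w v"
    unfolding form_def sum_distrib_right by (intro sum.cong refl) (metis assms mult.assoc mult.commute)
  finally show ?thesis .
qed

lemma has_derivative_covector:
  assumes b: "\<And>i. smooth_on V (b i)" and x: "x \<in> V"
  shows "((\<lambda>z. covector b (fst z) (snd z)) has_derivative
    (\<lambda>v. covector b x (snd v) + covector (\<lambda>i x. dd (b i) x (fst v)) x y)) (at (x, y))"
proof -
  have "((\<lambda>z. b i (fst z)) has_derivative (\<lambda>v. dd (b i) (fst (x, y)) (fst v))) (at (x, y))" for i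
    by (rule has_derivative_compose[OF has_derivative_fst[OF has_derivative_ident]])
      (use smooth_on_has_derivative[OF b x] in simp)
  moreover have "((\<lambda>z. snd z $ l) has_derivative (\<lambda>v. snd v $ l)) (at (x, y))" for l
    by (intro bounded_linear.has_derivative[OF bounded_linear_vec_nth] has_derivative_snd has_derivative_ident)
  ultimately have "((\<lambda>z. \<Sum>l\<in>UNIV. b l (fst z) * snd z $ l) has_derivative
      (\<lambda>v. \<Sum>l\<in>UNIV. b l (fst (x, y)) * snd v $ l + dd (b l) (fst (x, y)) (fst v) * snd (x, y) $ l)) (at (x, y))"
    by (intro has_derivative_sum has_derivative_mult)
  then show ?thesis by (simp add: covector_def sum.distrib)
qed

lemma has_derivative_form:
  assumes h: "\<And>i j. smooth_on V (h i j)" and x: "x \<in> V"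
  shows "((\<lambda>z. form h (fst z) (snd z) (snd z)) has_derivative
    (\<lambda>v. form (\<lambda>i j x. dd (h i j) x (fst v)) x y y + form h x (snd v) y + form h x y (snd v))) (at (x, y))"
proof -
  have n: "((\<lambda>z. snd z $ l) has_derivative (\<lambda>v. snd v $ l)) (at (x, y))" for l
    by (intro bounded_linear.has_derivative[OF bounded_linear_vec_nth] has_derivative_snd has_derivative_ident)
  have "((\<lambda>z. form h (fst z) (snd z) (snd z)) has_derivative
      (\<lambda>v. \<Sum>i\<in>UNIV. covector (h i) (fst (x, y)) (snd (x, y)) * snd v $ i +
        (covector (h i) x (snd v) + covector (\<lambda>j x. dd (h i j) x (fst v)) x y) * snd (x, y) $ i)) (at (x, y))"
    unfolding form_def covector_def[symmetric]
    by (intro has_derivative_sum has_derivative_mult has_derivative_covector[OF h x] n)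
  then show ?thesis
    by (simp add: form_def covector_def distrib_right sum.distrib add_ac)
qed

lemma invertible_kernel:
  fixes A :: "real^'n^'n"
  assumes "invertible A" "A *v v = 0"
  shows "v = 0"
proof -
  have "matrix_inv A *v (A *v v) = 0" using assms(2) by simp
  then show ?thesis by (simp add: matrix_vector_mul_assoc matrix_inv_mult(2)[OF assms(1)])
qed

lemma (in metric_chart) form_sym: "x \<in> V \<Longrightarrow> form h x v w = form h x w v"
  by (rule form_commute) (rule sym)

lemma (in metric_chart) form_nondegenerate:
  assumes x: "x \<in> V" and v: "\<And>w. form h x v w = 0"
  shows "v = 0"
proof -
  let ?H = "\<chi> i j. h i j x"
  have "(?H *v v) $ i = form h x v (axis i 1)" for i
    unfolding form_sym[OF x, of v] form_axis_left by (simp add: matrix_vector_mult_def)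
  then have "?H *v v = 0" by (simp add: vec_eq_iff v)
  then show ?thesis by (rule invertible_kernel[OF nondegenerate[OF x]])
qed

text \<open>The square makes the logarithm available although a(y, y) and \<beta>(y) may be
  negative.\<close>

lemma has_derivative_ln_square:
  fixes f :: "'v::real_normed_vector \<Rightarrow> real"
  assumes "(f has_derivative f') (at z)" "f z \<noteq> 0"
  shows "((\<lambda>z. ln ((f z)\<^sup>2)) has_derivative (\<lambda>v. 2 * f' v / f z)) (at z)"
proof -
  have "((\<lambda>z. f z * f z) has_derivative (\<lambda>v. f z * f' v + f' v * f z)) (at z)"
    by (rule has_derivative_mult[OF assms(1) assms(1)])
  moreover have "0 < f z * f z" using assms(2) by (auto simp: zero_less_mult_iff linorder_neq_iff)
  ultimately have "((\<lambda>z. ln (f z * f z)) has_derivative (\<lambda>v. (f z * f' v + f' v * f z) * inverse (f z * f z))) (at z)"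
    by (intro has_derivative_ln)
  moreover have "(\<lambda>v. (f z * f' v + f' v * f z) * inverse (f z * f z)) = (\<lambda>v. 2 * f' v / f z)"
    using assms(2) by (simp add: fun_eq_iff field_simps)
  ultimately show ?thesis by (simp add: power2_eq_square)
qed

lemma abs_powr_eq_exp: "x \<noteq> 0 \<Longrightarrow> \<bar>x\<bar> powr e = exp (e / 2 * ln (x\<^sup>2))" for x e :: real
proof -
  assume "x \<noteq> 0"
  then have "ln (x\<^sup>2) = 2 * ln \<bar>x\<bar>" using ln_realpow[of "\<bar>x\<bar>" 2] by simp
  then show ?thesis using \<open>x \<noteq> 0\<close> by (simp add: powr_def)
qed

section \<open>The Weyl condition for a Kropina metric\<close>

context berwald_chart
begin

lemma dom_fibre:
  assumes "x \<in> dom"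
  obtains y where "(x, y) \<in> \<Omega>"
  using assms by (auto simp: dom_def)

lemma fundamental_tensor_fibre:
  assumes T: "open T" "(x, y) \<in> T" "T \<subseteq> \<Omega>"
    and E: "\<And>y. (x, y) \<in> T \<Longrightarrow> E (x, y) = (covector b x y)\<^sup>2"
  shows "fundamental_tensor L (x, y) $ i $ j = b i x * b j x"
proof -
  have l: "(covector b x has_derivative covector b x) (at y)" for y
    by (rule linear_imp_has_derivative[OF linear_covector])
  have "pdy j E (x, y) = 2 * b j x * covector b x y" if z: "(x, y) \<in> T" for y
  proof -
    have "pdy j E (x, y) = covector b x y * covector b x (axis j 1) + covector b x (axis j 1) * covector b x y"
      unfolding pdy_dd
      by (rule dd_fibre_eqI[OF T(1) z smooth_on_differentiable[OF smooth_E subsetD[OF T(3) z]] has_derivative_mult[OF l l]])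
        (simp add: E power2_eq_square)
    then show ?thesis by (simp add: covector_axis)
  qed
  then have "pdy i (pdy j E) (x, y) = 2 * b j x * covector b x (axis i 1)"
    unfolding pdy_dd[of i]
    by (rule dd_fibre_eqI[OF T(1,2) smooth_on_differentiable[OF smooth_pdy[OF smooth_E] subsetD[OF T(3,2)]]
        has_derivative_mult_right[OF l]])
  then show ?thesis using subsetD[OF T(3,2)] by (simp add: fundamental_tensor_E covector_axis)
qed

text \<open>The fibre Hessian of the square of a linear form has rank at most one, so the
  fundamental tensor would be singular. This excludes a zero of the 1-form as well as m = -
  1.\<close>

lemma not_square_of_covector:
  assumes dim: "CARD('n) > 2" and T: "open T" "(x, y) \<in> T" "T \<subseteq> \<Omega>"
    and E: "\<And>y. (x, y) \<in> T \<Longrightarrow> E (x, y) = (covector b x y)\<^sup>2"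
  shows False
proof -
  have "dim {\<chi> i. b i x} \<le> card {\<chi> i. b i x}" by (rule dim_le_card') simp
  then have "dim {\<chi> i. b i x} < DIM(real^'n)" using dim by simp
  then obtain v where v: "v \<noteq> 0" "\<And>y. y \<in> span {\<chi> i. b i x} \<Longrightarrow> orthogonal v y"
    using orthogonal_to_subspace_exists by blast
  have "covector b x v = 0"
    using v(2)[OF span_base[OF singletonI]] by (simp add: covector_def orthogonal_def inner_vec_def mult.commute)
  then have "fundamental_tensor L (x, y) *v v = 0"
    by (simp add: matrix_vector_mult_def vec_eq_iff fundamental_tensor_fibre[OF T E] covector_def
        mult.assoc sum_distrib_left[symmetric])
  then show False
    using invertible_kernel[OF nondegenerate] T v(1) by blast
qed

text \<open>The condition \<open>\<nabla>h = \<kappa> \<otimes> h\<close> at the single point x, for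
  the connection with coefficients \<open>G\<close>.\<close>

definition weyl_at :: "('n \<Rightarrow> 'n \<Rightarrow> real^'n \<Rightarrow> real) \<Rightarrow> real^'n \<Rightarrow> ('n \<Rightarrow> real) \<Rightarrow> bool" where
  "weyl_at h x \<kappa> \<longleftrightarrow> (\<forall>k i j. pd k (h i j) x =
     (\<Sum>l\<in>UNIV. G l k i x * h l j x) + (\<Sum>l\<in>UNIV. G l k j x * h i l x) + \<kappa> k * h i j x)"

text \<open>Taking the horizontal derivative of \<open>ln F\<^sup>2\<close> gives
  \<open>(1 + m) (\<nabla>a)(y, y) \<beta>(y) = 2 m a(y, y) (\<nabla>\<beta>)(y)\<close>, a polynomial identity on each fibre.\<close>

lemma kropina_weyl:
  assumes h: "metric_chart dom h" and b: "\<And>i. smooth_on dom (b i)"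
    and dim: "CARD('n) > 2" and m: "m \<noteq> 0"
    and kropina: "\<And>x y. (x, y) \<in> \<Omega> \<Longrightarrow> form h x y y \<noteq> 0 \<Longrightarrow> covector b x y \<noteq> 0 \<Longrightarrow>
      E (x, y) = \<bar>form h x y y\<bar> powr (1 + m) * \<bar>covector b x y\<bar> powr (- 2 * m)"
    and degenerate: "\<And>x y. (x, y) \<in> \<Omega> \<Longrightarrow> (\<And>i. b i x = 0) \<Longrightarrow> E (x, y) = 0"
    and x: "x \<in> dom"
  obtains \<kappa> where "weyl_at h x \<kappa>"
proof -
  interpret h: metric_chart dom h by (rule h)
  define A where "A z = form h (fst z) (snd z) (snd z)" for z
  define \<beta> where "\<beta> z = covector b (fst z) (snd z)" for z
  \<comment> \<open>On this set \<open>F\<^sup>2\<close> is a product of real powers of positive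
    numbers and can be differentiated through its logarithm.\<close>
  define T where "T = {z \<in> \<Omega>. A z \<noteq> 0 \<and> \<beta> z \<noteq> 0}"
  have derA: "(A has_derivative (\<lambda>v. form (\<lambda>i j x. dd (h i j) x (fst v)) x y y + form h x (snd v) y + form h x y (snd v))) (at (x, y))"
    if "x \<in> dom" for x y
    unfolding A_def[abs_def] by (rule has_derivative_form[OF h.smooth that])
  have der\<beta>: "(\<beta> has_derivative (\<lambda>v. covector b x (snd v) + covector (\<lambda>i x. dd (b i) x (fst v)) x y)) (at (x, y))"
    if "x \<in> dom" for x y
    unfolding \<beta>_def[abs_def] by (rule has_derivative_covector[OF b that])
  have "isCont A z" "isCont \<beta> z" if "z \<in> \<Omega>" for z
    using has_derivative_continuous[OF derA[OF in_dom[of "fst z" "snd z"]], of "snd z"]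
      has_derivative_continuous[OF der\<beta>[OF in_dom[of "fst z" "snd z"]], of "snd z"] that by simp_all
  then have "continuous_on \<Omega> A" "continuous_on \<Omega> \<beta>"
    by (auto intro: continuous_at_imp_continuous_on)
  then have opens: "open (\<Omega> \<inter> A -` (- {0}))" "open (\<Omega> \<inter> \<beta> -` (- {0}))"
    by (auto intro!: continuous_open_preimage open_dom)
  moreover have "T = (\<Omega> \<inter> A -` (- {0})) \<inter> (\<Omega> \<inter> \<beta> -` (- {0}))" by (auto simp: T_def)
  ultimately have T: "open T" by (simp only: open_Int)
  have openU: "open {y. (x, y) \<in> S}" if "open S" for S :: "((real^'n) \<times> (real^'n)) set"
    using that by (intro open_vimage[of S "Pair x", unfolded vimage_def] continuous_intros)
  obtain y1 where y1: "(x, y1) \<in> \<Omega>" by (rule dom_fibre[OF x])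
  \<comment> \<open>If the 1-form vanished at x, \<open>E\<close> would vanish on the whole fibre
    and be the square of the zero covector.\<close>
  have "\<exists>i. b i x \<noteq> 0"
  proof (rule ccontr)
    assume "\<not> ?thesis"
    then have "E (x, y) = (covector b x y)\<^sup>2" if "(x, y) \<in> \<Omega>" for y
      using degenerate[OF that] by (simp add: covector_def)
    then show False using not_square_of_covector[OF dim open_dom y1] by blast
  qed
  then obtain i0 where i0: "covector b x (axis i0 1) \<noteq> 0" by (auto simp: covector_axis)
  have "\<exists>y. (x, y) \<in> \<Omega> \<and> covector b x y \<noteq> 0"
  proof (rule ccontr)
    assume "\<not> ?thesis"
    then have z: "covector b x y = 0" if "y \<in> {y. (x, y) \<in> \<Omega>}" for y using that by blast
    have "covector b x (axis i0 1) = 0"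
      by (rule linear_zero_if_zero_on_open[OF linear_covector openU[OF open_dom] _ z]) (use y1 in simp_all)
    with i0 show False by simp
  qed
  then obtain y2 where y2: "(x, y2) \<in> \<Omega>" "covector b x y2 \<noteq> 0" by blast
  from openU[OF opens(2)] have U2: "open {y. (x, y) \<in> \<Omega> \<and> covector b x y \<noteq> 0}" by (simp add: \<beta>_def)
  \<comment> \<open>Otherwise the quadratic form would vanish on an open set of vectors, hence
    identically, against nondegeneracy.\<close>
  have "\<exists>y. (x, y) \<in> \<Omega> \<and> covector b x y \<noteq> 0 \<and> form h x y y \<noteq> 0"
  proof (rule ccontr)
    assume "\<not> ?thesis"
    then have z: "form h x y y = 0" if "y \<in> {y. (x, y) \<in> \<Omega> \<and> covector b x y \<noteq> 0}" for y using that by blast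
    have "form h x (axis i0 1) w = 0" for w
      by (rule bilinear_zero_if_zero_on_open[OF bilinear_form h.form_sym[OF x] U2 _ z]) (use y2 in simp_all)
    from h.form_nondegenerate[OF x this] show False by (simp add: axis_eq_0_iff)
  qed
  then obtain y0 where y0: "(x, y0) \<in> T" by (auto simp: T_def A_def \<beta>_def)
  have T\<Omega>: "T \<subseteq> \<Omega>" by (auto simp: T_def)
  \<comment> \<open>For m = - 1 the power of a(y, y) has exponent 0, and \<open>E\<close> equals the
    square of \<beta> on \<open>T\<close>.\<close>
  have m1: "1 + m \<noteq> 0"
  proof
    assume "1 + m = 0"
    then have m': "m = - 1" by simp
    have "E (x, y) = (covector b x y)\<^sup>2" if "(x, y) \<in> T" for y
      using kropina[of x y] that by (auto simp: T_def A_def \<beta>_def m' powr_numeral)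
    then show False using not_square_of_covector[OF dim T y0 T\<Omega>] by blast
  qed
  \<comment> \<open>\<open>R u\<close> and \<open>\<mu> u\<close> are the covariant derivatives of
    the metric and of the 1-form in the direction u.\<close>
  define R where "R u v w = form (\<lambda>i j x. dd (h i j) x u) x v w - form h x (\<Gamma> x u v) w - form h x v (\<Gamma> x u w)" for u v w
  define \<mu> where "\<mu> u v = covector (\<lambda>i x. dd (b i) x u) x v - covector b x (\<Gamma> x u v)" for u v
  have bilR: "bilinear (R u)" for u
    unfolding bilinear_def R_def
    by (auto intro!: linearI simp: linear_add[OF linear_christoffel_action(2)] linear_cmul[OF linear_christoffel_action(2)]
        bilinear_ladd[OF bilinear_form] bilinear_radd[OF bilinear_form] bilinear_lmul[OF bilinear_form]
        bilinear_rmul[OF bilinear_form] algebra_simps)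
  have lin\<mu>: "linear (\<mu> u)" for u
    unfolding \<mu>_def
    by (auto intro!: linearI simp: linear_add[OF linear_christoffel_action(2)] linear_cmul[OF linear_christoffel_action(2)]
        linear_add[OF linear_covector] linear_cmul[OF linear_covector] algebra_simps)
  have horizontal: "(1 + m) * R u y y * covector b x y = form h x y y * (2 * m * \<mu> u y)" if y: "(x, y) \<in> T" for u y
  proof -
    have ne: "A (x, y) \<noteq> 0" "\<beta> (x, y) \<noteq> 0" and z: "(x, y) \<in> \<Omega>" using y by (auto simp: T_def)
    \<comment> \<open>The logarithm of \<open>F\<^sup>2\<close> on \<open>T\<close>; the squares
      inside \<open>ln\<close> account for the halved exponents.\<close>
    define f where "f z = (1 + m) / 2 * ln ((A z)\<^sup>2) + (- m) * ln ((\<beta> z)\<^sup>2)" for z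
    define A' where "A' v = form (\<lambda>i j x. dd (h i j) x (fst v)) x y y + form h x (snd v) y + form h x y (snd v)" for v
    define \<beta>' where "\<beta>' v = covector b x (snd v) + covector (\<lambda>i x. dd (b i) x (fst v)) x y" for v
    have "(f has_derivative (\<lambda>v. (1 + m) / 2 * (2 * A' v / A (x, y)) + (- m) * (2 * \<beta>' v / \<beta> (x, y)))) (at (x, y))"
      unfolding f_def[abs_def] A'_def \<beta>'_def
      by (intro has_derivative_add has_derivative_mult_right has_derivative_ln_square derA der\<beta> x ne)
    then have "((\<lambda>z. exp (f z)) has_derivative (\<lambda>v. exp (f (x, y)) *
        ((1 + m) / 2 * (2 * A' v / A (x, y)) + (- m) * (2 * \<beta>' v / \<beta> (x, y))))) (at (x, y))"
      by (rule has_derivative_eq_rhs[OF has_derivative_exp]) (simp add: fun_eq_iff)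
    moreover have "exp (f z) = E z" if "z \<in> T" for z
    proof -
      have "E z = \<bar>A z\<bar> powr (1 + m) * \<bar>\<beta> z\<bar> powr (- 2 * m)"
        using kropina[of "fst z" "snd z"] that by (simp add: T_def A_def \<beta>_def)
      then show ?thesis
        using that abs_powr_eq_exp[of "A z" "1 + m"] abs_powr_eq_exp[of "\<beta> z" "- 2 * m"]
        by (simp add: T_def f_def exp_add[symmetric])
    qed
    ultimately have "(E has_derivative (\<lambda>v. exp (f (x, y)) *
        ((1 + m) / 2 * (2 * A' v / A (x, y)) + (- m) * (2 * \<beta>' v / \<beta> (x, y))))) (at (x, y))"
      by (rule has_derivative_transform_within_open[OF _ T y])
    from dd_eqI[OF this] horizontal_E[OF z, of u]
    have "(1 + m) * A' (u, - \<Gamma> x u y) / A (x, y) - 2 * m * \<beta>' (u, - \<Gamma> x u y) / \<beta> (x, y) = 0" by simp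
    then have "(1 + m) * A' (u, - \<Gamma> x u y) * \<beta> (x, y) = A (x, y) * (2 * m * \<beta>' (u, - \<Gamma> x u y))"
      using ne by (simp add: field_simps)
    moreover have "A' (u, - \<Gamma> x u y) = R u y y"
      by (simp add: A'_def R_def bilinear_lneg[OF bilinear_form] bilinear_rneg[OF bilinear_form])
    moreover have "\<beta>' (u, - \<Gamma> x u y) = \<mu> u y"
      by (simp add: \<beta>'_def \<mu>_def linear_neg[OF linear_covector])
    ultimately show ?thesis by (simp add: A_def \<beta>_def)
  qed
  have "\<exists>c. \<forall>y. R u y y = c * form h x y y" for u
  proof -
    have b1: "bilinear (\<lambda>v w. (1 + m) * R u v w)"
      using bilR by (auto simp: bilinear_def linear_iff distrib_left)
    have l1: "linear (\<lambda>v. 2 * m * \<mu> u v)"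
      using lin\<mu> by (auto simp: linear_iff distrib_left)
    have "DIM(real^'n) > 2" using dim by simp
    moreover have "y0 \<in> {y. (x, y) \<in> T}" using y0 by simp
    moreover have "(1 + m) * R u y y * covector b x y = form h x y y * (2 * m * \<mu> u y)" if "y \<in> {y. (x, y) \<in> T}" for y
      using that horizontal by simp
    ultimately obtain c where c: "\<And>y. (1 + m) * R u y y = c * form h x y y"
      using quadratic_divides_quadratic_times_linear[OF bilinear_form h.form_sym[OF x] h.form_nondegenerate[OF x]
          b1 linear_covector l1 _ i0 openU[OF T]] by blast
    have "R u y y = c / (1 + m) * form h x y y" for y
      using c[of y] m1 by (simp add: field_simps)
    then show ?thesis by blast
  qed
  \<comment> \<open>The factor may depend on u; its values at the basis vectors become the
    components of \<kappa>.\<close>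
  then obtain c where c: "\<And>u y. R u y y = c u * form h x y y" by metis
  have symR: "R u v w = R u w v" for u v w
  proof -
    have "dd (h i j) x u = dd (h j i) x u" for i j
      by (rule fun_cong[OF dd_cong[OF h.open_dom x]]) (rule h.sym)
    then have "form (\<lambda>i j x. dd (h i j) x u) x v w = form (\<lambda>i j x. dd (h i j) x u) x w v"
      by (rule form_commute)
    then show ?thesis by (simp add: R_def h.form_sym[OF x, of v] h.form_sym[OF x, of w])
  qed
  have Rc: "R u v w = c u * form h x v w" for u v w
  proof -
    have "bilinear (\<lambda>v w. R u v w - c u * form h x v w)"
      using bilR[of u] bilinear_form[of h x] by (auto simp: bilinear_def linear_iff algebra_simps)
    from bilinear_zero_if_zero_on_diagonal[OF this, of v w]
    show ?thesis using symR[of u] h.form_sym[OF x] c by simp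
  qed
  have "pd k (h i j) x = (\<Sum>l\<in>UNIV. G l k i x * h l j x) + (\<Sum>l\<in>UNIV. G l k j x * h i l x)
      + c (axis k 1) * h i j x" for k i j
  proof -
    have "form (\<lambda>i j x. dd (h i j) x (axis k 1)) x (axis i 1) (axis j 1) = pd k (h i j) x"
      by (simp only: form_axis pd_dd)
    moreover have "form h x (\<Gamma> x (axis k 1) (axis i 1)) (axis j 1) = (\<Sum>l\<in>UNIV. G l k i x * h l j x)"
      by (simp only: form_axis_right christoffel_action_axis_axis mult.commute)
    moreover have "form h x (axis i 1) (\<Gamma> x (axis k 1) (axis j 1)) = (\<Sum>l\<in>UNIV. G l k j x * h i l x)"
      by (simp only: form_axis_left christoffel_action_axis_axis mult.commute)
    moreover have "form h x (axis i 1) (axis j 1) = h i j x" by (rule form_axis)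
    ultimately show ?thesis
      using Rc[of "axis k 1" "axis i 1" "axis j 1"] unfolding R_def by simp
  qed
  then have "weyl_at h x (\<lambda>k. c (axis k 1))"
    unfolding weyl_at_def by blast
  then show ?thesis by (rule that)
qed

end

lemma bilinear_zero_if_zero_on_axes:
  fixes B :: "real^'n \<Rightarrow> real^'n \<Rightarrow> real"
  assumes B: "bilinear B" and z: "\<And>i j. B (axis i 1) (axis j 1) = 0"
  shows "B v w = 0"
proof -
  have "linear (\<lambda>v. B v w)" "linear (B u)" for u w using B by (simp_all add: bilinear_def)
  note l = this
  have "B (axis i 1) w = 0" for i
    by (subst linear_axis_sum[OF l(2)]) (simp add: z)
  then show ?thesis by (subst linear_axis_sum[OF l(1)]) simp
qed

context berwald_chart
begin

text \<open>The derivative of h(y, y) along the horizontal lift of u is (\<nabla>_u h)(y, y). In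
  this form the Weyl condition refers only to a function on the tangent bundle and to horizontal
  vectors, and can be compared between charts.\<close>

lemma weyl_horizontal:
  assumes h: "metric_chart dom h" and weyl: "weyl_at h x \<kappa>" and x: "x \<in> dom"
  shows "dd (\<lambda>z. form h (fst z) (snd z) (snd z)) (x, y) (u, - \<Gamma> x u y) = (\<Sum>k\<in>UNIV. \<kappa> k * u $ k) * form h x y y"
proof -
  interpret h: metric_chart dom h by (rule h)
  have d: "dd (h i j) x u = (\<Sum>l\<in>UNIV. h l j x * \<Gamma> x u (axis i 1) $ l) + (\<Sum>l\<in>UNIV. h i l x * \<Gamma> x u (axis j 1) $ l)
      + (\<Sum>k\<in>UNIV. \<kappa> k * u $ k) * h i j x" for i j
  proof -
    have s: "(\<Sum>k\<in>UNIV. u $ k * (\<Sum>l\<in>UNIV. G l k r x * g l)) = (\<Sum>l\<in>UNIV. g l * \<Gamma> x u (axis r 1) $ l)" for g r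
      unfolding christoffel_action_axis sum_distrib_left by (subst sum.swap) (simp only: mult_ac)
    have "dd (h i j) x u = (\<Sum>k\<in>UNIV. u $ k * pd k (h i j) x)"
      by (rule dd_pd_sum[OF smooth_on_differentiable[OF h.smooth x]])
    also have "\<dots> = (\<Sum>k\<in>UNIV. u $ k * (\<Sum>l\<in>UNIV. G l k i x * h l j x)) + (\<Sum>k\<in>UNIV. u $ k * (\<Sum>l\<in>UNIV. G l k j x * h i l x))
        + (\<Sum>k\<in>UNIV. u $ k * (\<kappa> k * h i j x))"
      using weyl by (simp add: weyl_at_def distrib_left sum.distrib)
    also have "(\<Sum>k\<in>UNIV. u $ k * (\<kappa> k * h i j x)) = (\<Sum>k\<in>UNIV. \<kappa> k * u $ k) * h i j x"
      unfolding sum_distrib_right by (simp only: mult_ac)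
    finally show ?thesis by (simp only: s)
  qed
  have bil: "bilinear (\<lambda>v w. form h x (\<Gamma> x u v) w + form h x v (\<Gamma> x u w) + (\<Sum>k\<in>UNIV. \<kappa> k * u $ k) * form h x v w
      - form (\<lambda>i j x. dd (h i j) x u) x v w)"
    unfolding bilinear_def
    by (auto intro!: linearI simp: linear_add[OF linear_christoffel_action(2)] linear_cmul[OF linear_christoffel_action(2)]
        bilinear_ladd[OF bilinear_form] bilinear_radd[OF bilinear_form] bilinear_lmul[OF bilinear_form]
        bilinear_rmul[OF bilinear_form] algebra_simps)
  have "form (\<lambda>i j x. dd (h i j) x u) x y y = form h x (\<Gamma> x u y) y + form h x y (\<Gamma> x u y) + (\<Sum>k\<in>UNIV. \<kappa> k * u $ k) * form h x y y"
    using bilinear_zero_if_zero_on_axes[OF bil, of y y] by (simp add: form_axis_left form_axis_right sum_axis d)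
  moreover have "dd (\<lambda>z. form h (fst z) (snd z) (snd z)) (x, y) (u, - \<Gamma> x u y) =
      form (\<lambda>i j x. dd (h i j) x u) x y y + form h x (- \<Gamma> x u y) y + form h x y (- \<Gamma> x u y)"
    by (subst dd_eqI[OF has_derivative_form[where h=h, OF h.smooth x]]) simp
  ultimately show ?thesis
    by (simp add: bilinear_lneg[OF bilinear_form] bilinear_rneg[OF bilinear_form])
qed

end

section \<open>Change of chart\<close>

lemma dd_vec_nth: "f differentiable (at x) \<Longrightarrow> dd (\<lambda>x. f x $ k) x v = dd f x v $ k"
  by (subst dd_eqI[OF bounded_linear.has_derivative[OF bounded_linear_vec_nth has_derivative_dd]]) auto

lemma dd_commute_vec:
  fixes f :: "'v::real_normed_vector \<Rightarrow> real^'n"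
  assumes S: "open S" and f: "smooth_on S f" and x: "x \<in> S"
  shows "dd (\<lambda>x. dd f x v) x w = dd (\<lambda>x. dd f x w) x v"
proof -
  have "dd (\<lambda>x. dd f x v) x w $ k = dd (\<lambda>x. dd (\<lambda>x. f x $ k) x v) x w" for v w k
  proof -
    have "dd (\<lambda>x. dd (\<lambda>x. f x $ k) x v) x = dd (\<lambda>x. dd f x v $ k) x"
      by (rule dd_cong[OF S x]) (rule dd_vec_nth[OF smooth_on_differentiable[OF f]])
    then show ?thesis
      by (simp add: dd_vec_nth[OF smooth_on_differentiable[OF smooth_on_dd[OF f] x]])
  qed
  then show ?thesis
    using dd_commute[OF S smooth_on_vec_nth[OF S f] x] by (simp add: vec_eq_iff)
qed

text \<open>A change of chart \<phi> on the overlap \<open>S\<close>, with its differential acting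
  on the fibres. Only the invariance of the Finsler function is assumed; no relation between
  \<open>G1\<close> and \<open>G2\<close> is.\<close>

locale berwald_transition =
  c: berwald_chart \<Omega>1 L1 G1 + d: berwald_chart \<Omega>2 L2 G2
  for \<Omega>1 \<Omega>2 :: "((real^'n) \<times> (real^'n)) set" and L1 L2 :: "'n::finite tfun"
    and G1 G2 :: "'n \<Rightarrow> 'n \<Rightarrow> 'n \<Rightarrow> real^'n \<Rightarrow> real" +
  fixes \<phi> :: "real^'n \<Rightarrow> real^'n" and S :: "(real^'n) set"
  assumes S: "open S" "S \<subseteq> c.dom" and smooth_\<phi>: "smooth_on S \<phi>"
    and surj: "x \<in> S \<Longrightarrow> surj (dd \<phi> x)"
    and trans: "x \<in> S \<Longrightarrow> (x, y) \<in> \<Omega>1 \<Longrightarrow> (\<phi> x, dd \<phi> x y) \<in> \<Omega>2"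
    and L_trans: "x \<in> S \<Longrightarrow> (x, y) \<in> \<Omega>1 \<Longrightarrow> L1 (x, y) = L2 (\<phi> x, dd \<phi> x y)"
begin

definition lift where "lift z = (\<phi> (fst z), dd \<phi> (fst z) (snd z))"

definition D2 where "D2 x u v = dd (\<lambda>x. dd \<phi> x v) x u"

lemma differentiable_\<phi>: "x \<in> S \<Longrightarrow> \<phi> differentiable (at x)"
  by (rule smooth_on_differentiable[OF smooth_\<phi>])

lemma linear_dd_\<phi>: "x \<in> S \<Longrightarrow> linear (dd \<phi> x)"
  by (rule linear_frechet_derivative[OF differentiable_\<phi>])

lemma D2_commute: "x \<in> S \<Longrightarrow> D2 x u v = D2 x v u"
  unfolding D2_def by (rule dd_commute_vec[OF S(1) smooth_\<phi>])

lemma bilinear_D2: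
  assumes "x \<in> S"
  shows "bilinear (D2 x)"
proof -
  have "linear (\<lambda>u. D2 x u v)" for v
    unfolding D2_def by (rule linear_frechet_derivative[OF smooth_on_differentiable[OF smooth_on_dd[OF smooth_\<phi>] assms]])
  moreover from this have "linear (\<lambda>v. D2 x u v)" for u
    by (simp add: D2_commute[OF assms, of u])
  ultimately show ?thesis by (simp add: bilinear_def)
qed

lemma vec_axis_sum: "w = (\<Sum>j\<in>UNIV. w $ j *\<^sub>R axis j 1)" for w :: "real^'n"
  by (simp add: basis_expansion[of w, unfolded scalar_mult_eq_scaleR])

lemma linear_axis_expand:
  fixes f :: "real^'n \<Rightarrow> 'w::real_vector"
  assumes "linear f"
  shows "f w = (\<Sum>j\<in>UNIV. w $ j *\<^sub>R f (axis j 1))"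
  by (subst vec_axis_sum[of w]) (simp add: linear_sum[OF assms] linear_cmul[OF assms])

lemma has_derivative_lift:
  assumes x: "x \<in> S"
  shows "(lift has_derivative (\<lambda>v. (dd \<phi> x (fst v), D2 x (fst v) y + dd \<phi> x (snd v)))) (at (x, y))"
proof -
  have fst: "(fst has_derivative fst) (at (x, y))"
    by (rule bounded_linear_imp_has_derivative[OF bounded_linear_fst])
  have 1: "((\<lambda>z. \<phi> (fst z)) has_derivative (\<lambda>v. dd \<phi> x (fst v))) (at (x, y))"
    using has_derivative_compose[OF fst] has_derivative_dd[OF differentiable_\<phi>[OF x]] by simp
  have "((\<lambda>z. dd \<phi> (fst z) (axis j 1)) has_derivative (\<lambda>v. D2 x (fst v) (axis j 1))) (at (x, y))" for j
    unfolding D2_def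
    by (rule has_derivative_compose[OF fst]) (simp add: smooth_on_has_derivative[OF smooth_on_dd[OF smooth_\<phi>] x])
  moreover have "((\<lambda>z. snd z $ j) has_derivative (\<lambda>v. snd v $ j)) (at (x, y))" for j :: 'n
    by (intro bounded_linear.has_derivative[OF bounded_linear_vec_nth] has_derivative_snd has_derivative_ident)
  \<comment> \<open>The differential is expanded in the components of the fibre vector, so that
    every summand is a product of a function of x and a coordinate of y.\<close>
  ultimately have "((\<lambda>z. \<Sum>j\<in>UNIV. snd z $ j *\<^sub>R dd \<phi> (fst z) (axis j 1)) has_derivative
      (\<lambda>v. \<Sum>j\<in>UNIV. snd (x, y) $ j *\<^sub>R D2 x (fst v) (axis j 1) + snd v $ j *\<^sub>R dd \<phi> (fst (x, y)) (axis j 1))) (at (x, y))"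
    by (intro has_derivative_sum has_derivative_scaleR)
  moreover have "(\<Sum>j\<in>UNIV. snd (x, y) $ j *\<^sub>R D2 x (fst v) (axis j 1) + snd v $ j *\<^sub>R dd \<phi> (fst (x, y)) (axis j 1)) =
      D2 x (fst v) y + dd \<phi> x (snd v)" for v
    using bilinear_D2[OF x] linear_axis_expand[of "D2 x (fst v)" y] linear_axis_expand[OF linear_dd_\<phi>[OF x], of "snd v"]
    by (simp add: sum.distrib bilinear_def)
  ultimately have "((\<lambda>z. \<Sum>j\<in>UNIV. snd z $ j *\<^sub>R dd \<phi> (fst z) (axis j 1)) has_derivative
      (\<lambda>v. D2 x (fst v) y + dd \<phi> x (snd v))) (at (x, y))"
    by simp
  then have "((\<lambda>z. dd \<phi> (fst z) (snd z)) has_derivative (\<lambda>v. D2 x (fst v) y + dd \<phi> x (snd v))) (at (x, y))"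
  proof (rule has_derivative_transform_within_open)
    show "open (S \<times> UNIV)" using S(1) by (simp add: open_Times)
    show "(x, y) \<in> S \<times> UNIV" using x by simp
    show "(\<Sum>j\<in>UNIV. snd z $ j *\<^sub>R dd \<phi> (fst z) (axis j 1)) = dd \<phi> (fst z) (snd z)" if "z \<in> S \<times> UNIV" for z
      using linear_axis_expand[OF linear_dd_\<phi>, of "fst z" "snd z"] that by (simp add: mem_Times_iff)
  qed
  then show ?thesis unfolding lift_def[abs_def] by (rule has_derivative_Pair[OF 1])
qed

lemma dd_lift:
  assumes x: "x \<in> S" and T: "open T" "(x, y) \<in> T" and f2: "f2 differentiable (at (lift (x, y)))"
    and eq: "\<And>z. z \<in> T \<Longrightarrow> f1 z = f2 (lift z)"
  shows "dd f1 (x, y) (u, w) = dd f2 (lift (x, y)) (dd \<phi> x u, D2 x u y + dd \<phi> x w)"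
proof -
  have "dd f1 (x, y) = dd (\<lambda>z. f2 (lift z)) (x, y)" by (rule dd_cong[OF T eq])
  also have "\<dots> = (\<lambda>v. dd f2 (lift (x, y)) (dd \<phi> x (fst v), D2 x (fst v) y + dd \<phi> x (snd v)))"
    by (rule dd_eqI, rule has_derivative_compose[OF has_derivative_lift[OF x] has_derivative_dd[OF f2]])
  finally show ?thesis by simp
qed

lemma lift_in: "x \<in> S \<Longrightarrow> (x, y) \<in> \<Omega>1 \<Longrightarrow> lift (x, y) \<in> \<Omega>2"
  by (simp add: lift_def trans)

text \<open>The defect of the transformation law of the connection coefficients vanishes because the
  horizontal derivatives of \<open>F\<^sup>2\<close> vanish in both charts and \<open>F\<^sup>2\<close> has nondegenerate fibre Hessian.\<close>

definition defect where
  "defect x u y = dd \<phi> x (c.\<Gamma> x u y) - D2 x u y - d.\<Gamma> (\<phi> x) (dd \<phi> x u) (dd \<phi> x y)"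

lemma bilinear_defect: "x \<in> S \<Longrightarrow> bilinear (defect x)"
  unfolding bilinear_def defect_def
  by (auto intro!: linearI simp: linear_add[OF linear_dd_\<phi>] linear_cmul[OF linear_dd_\<phi>]
      bilinear_ladd[OF bilinear_D2] bilinear_radd[OF bilinear_D2] bilinear_lmul[OF bilinear_D2]
      bilinear_rmul[OF bilinear_D2] bilinear_ladd[OF bilinear_christoffel_action] bilinear_radd[OF bilinear_christoffel_action]
      bilinear_lmul[OF bilinear_christoffel_action] bilinear_rmul[OF bilinear_christoffel_action] algebra_simps)

lemma fibre:
  assumes "x \<in> S"
  obtains y where "(x, y) \<in> \<Omega>1"
  using assms S(2) by (auto simp: c.dom_def)

lemma defect_commute:
  assumes x: "x \<in> S"
  shows "defect x u v = defect x v u"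
proof -
  obtain y where y: "(x, y) \<in> \<Omega>1" by (rule fibre[OF x])
  show ?thesis
    unfolding defect_def D2_commute[OF x, of u] c.action_commute[OF y, of u]
      d.action_commute[OF trans[OF x y], of "dd \<phi> x u"] ..
qed

text \<open>The image of a horizontal vector of the first chart and the horizontal vector of the
  second chart over the same base vector differ by a vertical vector, the defect. Both annihilate
  \<open>d.E\<close>.\<close>

lemma defect_annihilates:
  assumes x: "x \<in> S" and y: "(x, y) \<in> \<Omega>1"
  shows "(\<Sum>k\<in>UNIV. defect x u y $ k * pdy k d.E (lift (x, y))) = 0"
proof -
  note z = lift_in[OF x y]
  note dE = smooth_on_differentiable[OF d.smooth_E z]
  note l = linear_frechet_derivative[OF dE]
  have T: "open (\<Omega>1 \<inter> S \<times> UNIV)" using c.open_dom S(1) by (simp add: open_Int open_Times)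
  have "c.E z = d.E (lift z)" if "z \<in> \<Omega>1 \<inter> S \<times> UNIV" for z
    using that L_trans[of "fst z" "snd z"] by (simp add: c.E_def d.E_def lift_def mem_Times_iff)
  from dd_lift[OF x T _ dE this, of u "- c.\<Gamma> x u y"]
  have 1: "dd d.E (lift (x, y)) (dd \<phi> x u, D2 x u y - dd \<phi> x (c.\<Gamma> x u y)) = 0"
    using c.horizontal_E[OF y, of u] x y by (simp add: linear_neg[OF linear_dd_\<phi>[OF x]])
  have 2: "dd d.E (lift (x, y)) (dd \<phi> x u, - d.\<Gamma> (\<phi> x) (dd \<phi> x u) (dd \<phi> x y)) = 0"
    using d.horizontal_E[of "\<phi> x" "dd \<phi> x y" "dd \<phi> x u"] z by (simp add: lift_def)
  have "dd d.E (lift (x, y)) ((dd \<phi> x u, - d.\<Gamma> (\<phi> x) (dd \<phi> x u) (dd \<phi> x y))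
      - (dd \<phi> x u, D2 x u y - dd \<phi> x (c.\<Gamma> x u y))) = 0"
    unfolding linear_diff[OF l] 1 2 by simp
  moreover have "(dd \<phi> x u, - d.\<Gamma> (\<phi> x) (dd \<phi> x u) (dd \<phi> x y)) - (dd \<phi> x u, D2 x u y - dd \<phi> x (c.\<Gamma> x u y)) =
      (0, defect x u y)"
    by (simp add: defect_def)
  ultimately have "dd d.E (lift (x, y)) (0, defect x u y) = 0" by (simp only:)
  then show ?thesis by (simp add: dd_fibre_pdy[OF dE])
qed

text \<open>\<open>defect_annihilates\<close> with u = y held fixed is differentiated along the
  fibre. The product rule gives a Hessian term and a term with \<open>defect x y w\<close>, which
  equals \<open>defect x w y\<close> and is annihilated again. The nondegenerate Hessian then forces
  the diagonal of the defect to vanish.\<close>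

lemma defect_diagonal:
  assumes x: "x \<in> S" and y: "(x, y) \<in> \<Omega>1"
  shows "defect x y y = 0"
proof -
  note z = lift_in[OF x y]
  have ann: "(\<Sum>k\<in>UNIV. defect x y y $ k * dd (pdy k d.E) (lift (x, y)) (0, dd \<phi> x w)) = 0" for w
  proof -
    have "bounded_linear (\<lambda>v. defect x y v $ k)" for k
      using bilinear_nth[OF bilinear_defect[OF x], of k] by (simp add: bilinear_def linear_conv_bounded_linear)
    then have 1: "((\<lambda>v. defect x y v $ k) has_derivative (\<lambda>w. defect x y w $ k)) (at y)" for k
      by (rule bounded_linear_imp_has_derivative)
    have "((\<lambda>v. (\<phi> x, dd \<phi> x v)) has_derivative (\<lambda>w. (0, dd \<phi> x w))) (at y)"
      by (intro has_derivative_Pair has_derivative_const linear_imp_has_derivative linear_dd_\<phi>[OF x])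
    then have 2: "((\<lambda>v. pdy k d.E (lift (x, v))) has_derivative (\<lambda>w. dd (pdy k d.E) (lift (x, y)) (0, dd \<phi> x w))) (at y)" for k
      unfolding lift_def fst_conv snd_conv
      by (rule has_derivative_compose)
        (use smooth_on_has_derivative[OF d.smooth_pdy[OF d.smooth_E] z] in \<open>simp add: lift_def\<close>)
    have "((\<lambda>v. \<Sum>k\<in>UNIV. defect x y v $ k * pdy k d.E (lift (x, v))) has_derivative
        (\<lambda>w. \<Sum>k\<in>UNIV. defect x y y $ k * dd (pdy k d.E) (lift (x, y)) (0, dd \<phi> x w) + defect x y w $ k * pdy k d.E (lift (x, y)))) (at y)"
      by (intro has_derivative_sum has_derivative_mult 1 2)
    then have "((\<lambda>v. 0) has_derivative
        (\<lambda>w. \<Sum>k\<in>UNIV. defect x y y $ k * dd (pdy k d.E) (lift (x, y)) (0, dd \<phi> x w) + defect x y w $ k * pdy k d.E (lift (x, y)))) (at y)"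
      by (rule has_derivative_transform_within_open[OF _ c.open_fibre[of x]]) (use y defect_annihilates[OF x] in simp_all)
    from has_derivative_unique[OF this has_derivative_const]
    have "(\<Sum>k\<in>UNIV. defect x y y $ k * dd (pdy k d.E) (lift (x, y)) (0, dd \<phi> x w) + defect x y w $ k * pdy k d.E (lift (x, y))) = 0"
      by (rule fun_cong)
    then show ?thesis
      unfolding sum.distrib defect_commute[OF x, of y w] by (simp add: defect_annihilates[OF x y])
  qed
  \<comment> \<open>Surjectivity of the differential lets the Hessian be tested in every coordinate
    direction of the second chart.\<close>
  have "\<exists>v. dd \<phi> x v = axis i 1" for i
    using surjD[OF surj[OF x], of "axis i 1"] by metis
  then obtain w where w: "\<And>i. dd \<phi> x (w i) = axis i 1"
    by metis
  have "(\<Sum>k\<in>UNIV. defect x y y $ k * pdy i (pdy k d.E) (lift (x, y))) = 0" for i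
    using ann[of "w i"] unfolding pdy_dd[of i] w .
  then have "fundamental_tensor L2 (lift (x, y)) *v defect x y y = 0"
    by (simp add: vec_eq_iff matrix_vector_mult_def d.fundamental_tensor_E[OF z] mult.commute sum_divide_distrib[symmetric])
  then show ?thesis
    by (rule invertible_kernel[OF d.nondegenerate[OF z]])
qed

lemma defect_zero:
  assumes x: "x \<in> S"
  shows "defect x u v = 0"
proof -
  obtain y where y: "(x, y) \<in> \<Omega>1" by (rule fibre[OF x])
  have "defect x u v $ k = 0" for k
    by (rule bilinear_zero_if_zero_on_open[OF bilinear_nth[OF bilinear_defect[OF x]] _ c.open_fibre[of x]])
      (use y defect_commute[OF x] defect_diagonal[OF x] in auto)
  then show ?thesis by (simp add: vec_eq_iff)
qed

text \<open>As the defect vanishes, the lift maps horizontal vectors to horizontal vectors. Both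
  sides multiplied by h1(y, y) are therefore the same derivative of the same function, and a y with
  h1(y, y) nonzero allows cancelling.\<close>

lemma weyl_transform:
  assumes h1: "metric_chart c.dom h1" and h2: "metric_chart d.dom h2"
    and weyl: "c.weyl_at h1 x \<kappa>1" "d.weyl_at h2 (\<phi> x) \<kappa>2" and x: "x \<in> S"
    and eq: "\<And>x y. x \<in> S \<Longrightarrow> form h1 x y y = form h2 (\<phi> x) (dd \<phi> x y) (dd \<phi> x y)"
  shows "(\<Sum>k\<in>UNIV. \<kappa>1 k * u $ k) = (\<Sum>k\<in>UNIV. \<kappa>2 k * dd \<phi> x u $ k)"
proof -
  interpret h1: metric_chart c.dom h1 by (rule h1)
  interpret h2: metric_chart d.dom h2 by (rule h2)
  have xc: "x \<in> c.dom" using x S(2) by blast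
  obtain y' where y': "(x, y') \<in> \<Omega>1" by (rule fibre[OF x])
  have xd: "\<phi> x \<in> d.dom" by (rule d.in_dom[OF trans[OF x y']])
  have "\<exists>y. form h1 x y y \<noteq> 0"
  proof (rule ccontr)
    assume "\<not> ?thesis"
    then have "form h1 x v w = 0" for v w
      using bilinear_zero_if_zero_on_diagonal[OF bilinear_form h1.form_sym[OF xc]] by blast
    from h1.form_nondegenerate[OF xc this] have "(v :: real^'n) = 0" for v .
    \<comment> \<open>Any nonzero vector would do.\<close>
    from this[of "axis undefined 1"] show False by (simp add: axis_eq_0_iff)
  qed
  then obtain y where y: "form h1 x y y \<noteq> 0" by blast
  define A1 where "A1 z = form h1 (fst z) (snd z) (snd z)" for z
  define A2 where "A2 z = form h2 (fst z) (snd z) (snd z)" for z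
  have dA2: "A2 differentiable (at (lift (x, y)))"
    unfolding A2_def[abs_def] differentiable_def lift_def fst_conv snd_conv
    using has_derivative_form[where h=h2, OF h2.smooth xd] by blast
  have T: "open (S \<times> (UNIV :: (real^'n) set))" using S(1) by (simp add: open_Times)
  have "A1 z = A2 (lift z)" if "z \<in> S \<times> UNIV" for z
    using that eq by (simp add: A1_def A2_def lift_def mem_Times_iff)
  from dd_lift[OF x T _ dA2 this, of u "- c.\<Gamma> x u y"]
  have "dd A1 (x, y) (u, - c.\<Gamma> x u y) = dd A2 (lift (x, y)) (dd \<phi> x u, D2 x u y - dd \<phi> x (c.\<Gamma> x u y))"
    using x by (simp add: linear_neg[OF linear_dd_\<phi>[OF x]])
  also have "D2 x u y - dd \<phi> x (c.\<Gamma> x u y) = - d.\<Gamma> (\<phi> x) (dd \<phi> x u) (dd \<phi> x y)"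
    using defect_zero[OF x, of u y] by (simp add: defect_def algebra_simps)
  finally have "(\<Sum>k\<in>UNIV. \<kappa>1 k * u $ k) * form h1 x y y =
      (\<Sum>k\<in>UNIV. \<kappa>2 k * dd \<phi> x u $ k) * form h2 (\<phi> x) (dd \<phi> x y) (dd \<phi> x y)"
    unfolding A1_def[abs_def] A2_def[abs_def] lift_def fst_conv snd_conv
      c.weyl_horizontal[OF h1 weyl(1) xc] d.weyl_horizontal[OF h2 weyl(2) xd] .
  then show ?thesis using y by (simp add: eq[OF x])
qed

end

section \<open>Kropina metrics on manifolds\<close>

locale smooth_mfd =
  fixes M :: "'a topology" and At :: "('a, 'n::finite) chart set"
  assumes smooth_manifold: "smooth_manifold M At"
begin

lemma is_chart: "c \<in> At \<Longrightarrow> is_chart M c"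
  using smooth_manifold by (simp add: smooth_manifold_def)

lemma cover: "\<Union>(fst ` At) = topspace M"
  using smooth_manifold by (simp add: smooth_manifold_def)

lemma chart_subset: "c \<in> At \<Longrightarrow> fst c \<subseteq> topspace M"
  using cover by blast

lemma open_chart_dom: "c \<in> At \<Longrightarrow> openin M (fst c)"
  using is_chart by (simp add: is_chart_def)

lemma chart_homeomorphic:
  "c \<in> At \<Longrightarrow> homeomorphic_map (subtopology M (fst c)) (top_of_set (snd c ` fst c)) (snd c)"
  using is_chart by (simp add: is_chart_def)

lemma topspace_chart: "c \<in> At \<Longrightarrow> topspace (subtopology M (fst c)) = fst c"
  using chart_subset[of c] by (auto simp: topspace_subtopology)

lemma inj_chart: "c \<in> At \<Longrightarrow> inj_on (snd c) (fst c)"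
  using homeomorphic_imp_injective_map[OF chart_homeomorphic] topspace_chart by metis

lemma inv_chart: "c \<in> At \<Longrightarrow> p \<in> fst c \<Longrightarrow> inv_into (fst c) (snd c) (snd c p) = p"
  by (rule inv_into_f_f[OF inj_chart])

lemma open_chart_image:
  assumes "c \<in> At" "openin M W"
  shows "open (snd c ` (fst c \<inter> W))"
proof -
  have "openin (subtopology M (fst c)) (fst c \<inter> W)"
    using assms(2) by (simp add: openin_subtopology_Int2)
  then have "openin (top_of_set (snd c ` fst c)) (snd c ` (fst c \<inter> W))"
    using homeomorphic_imp_open_map[OF chart_homeomorphic[OF assms(1)]] by (simp add: open_map_def)
  moreover have "open (snd c ` fst c)" using is_chart[OF assms(1)] by (simp add: is_chart_def)
  ultimately show ?thesis using openin_open_trans by blast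
qed

lemma open_chart_range: "c \<in> At \<Longrightarrow> open (snd c ` fst c)"
  using is_chart by (simp add: is_chart_def)

lemma openin_chart_vimage:
  assumes c: "c \<in> At" and B: "open B"
  shows "openin M {q \<in> fst c. snd c q \<in> B}"
proof -
  have "continuous_map (subtopology M (fst c)) (top_of_set (snd c ` fst c)) (snd c)"
    by (rule homeomorphic_imp_continuous_map[OF chart_homeomorphic[OF c]])
  then have "continuous_map (subtopology M (fst c)) euclidean (snd c)"
    by (rule continuous_map_into_fulltopology)
  then have "openin (subtopology M (fst c)) {q \<in> topspace (subtopology M (fst c)). snd c q \<in> B}"
    by (rule openin_continuous_map_preimage) (simp only: open_openin[symmetric] B)
  then show ?thesis
    unfolding topspace_chart[OF c] by (simp add: openin_open_subtopology[OF open_chart_dom[OF c]])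
qed

lemma transition_chart: "c \<in> At \<Longrightarrow> p \<in> fst c \<Longrightarrow> transition c d (snd c p) = snd d p"
  by (simp add: transition_def inv_chart)

lemma smooth_transition:
  "c \<in> At \<Longrightarrow> d \<in> At \<Longrightarrow> smooth_on (snd c ` (fst c \<inter> fst d)) (transition c d)"
  using smooth_manifold by (simp add: smooth_manifold_def)

lemma open_overlap: "c \<in> At \<Longrightarrow> d \<in> At \<Longrightarrow> open (snd c ` (fst c \<inter> fst d))"
  by (rule open_chart_image[OF _ open_chart_dom])

lemma transition_has_derivative:
  "c \<in> At \<Longrightarrow> d \<in> At \<Longrightarrow> p \<in> fst c \<Longrightarrow> p \<in> fst d \<Longrightarrow>
    (transition c d has_derivative dd (transition c d) (snd c p)) (at (snd c p))"
  by (rule smooth_on_has_derivative[OF smooth_transition]) auto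

lemma linear_transition:
  "c \<in> At \<Longrightarrow> d \<in> At \<Longrightarrow> p \<in> fst c \<Longrightarrow> p \<in> fst d \<Longrightarrow> linear (dd (transition c d) (snd c p))"
  using transition_has_derivative has_derivative_linear by blast

lemma transition_cocycle:
  assumes "c \<in> At" "d \<in> At" "e \<in> At" "p \<in> fst c" "p \<in> fst d" "p \<in> fst e"
  shows "dd (transition c e) (snd c p) v = dd (transition d e) (snd d p) (dd (transition c d) (snd c p) v)"
proof -
  let ?T = "snd c ` (fst c \<inter> (fst d \<inter> fst e))"
  have T: "open ?T" "snd c p \<in> ?T"
    using open_chart_image[OF assms(1) openin_Int[OF open_chart_dom open_chart_dom], of d e] assms by simp_all
  have "(transition d e has_derivative dd (transition d e) (snd d p)) (at (transition c d (snd c p)))"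
    using transition_has_derivative[of d e p] assms by (simp add: transition_chart)
  from has_derivative_compose[OF transition_has_derivative this] assms
  have "((\<lambda>x. transition d e (transition c d x)) has_derivative
      (\<lambda>v. dd (transition d e) (snd d p) (dd (transition c d) (snd c p) v))) (at (snd c p))" by blast
  then have "(transition c e has_derivative
      (\<lambda>v. dd (transition d e) (snd d p) (dd (transition c d) (snd c p) v))) (at (snd c p))"
    by (rule has_derivative_transform_within_open[OF _ T]) (use assms in \<open>auto simp: transition_chart\<close>)
  from dd_eqI[OF this] show ?thesis by simp
qed

lemma transition_self:
  assumes "c \<in> At" "p \<in> fst c"
  shows "dd (transition c c) (snd c p) v = v"
proof -
  have "((\<lambda>x. x) has_derivative (\<lambda>x. x)) (at (snd c p))" by (rule has_derivative_ident)
  then have "(transition c c has_derivative (\<lambda>x. x)) (at (snd c p))"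
    by (rule has_derivative_transform_within_open[OF _ open_chart_range[OF assms(1)]])
      (use assms in \<open>auto simp: transition_chart\<close>)
  from dd_eqI[OF this] show ?thesis by simp
qed

text \<open>The tangent vector at p with components y in the chart c: the transformation law fixes
  its components in all other charts. It makes the \<open>inv_into\<close> in
  \<open>tcoord_inv\<close> explicit.\<close>

definition vec_of where
  "vec_of c p y = (\<lambda>d. if d \<in> charts_at At p then dd (transition c d) (snd c p) y else 0)"

lemma vec_of_self: "c \<in> At \<Longrightarrow> p \<in> fst c \<Longrightarrow> vec_of c p y c = y"
  by (simp add: vec_of_def charts_at_def transition_self)

lemma vec_of_tangent:
  assumes "c \<in> At" "p \<in> fst c"
  shows "vec_of c p y \<in> tangent_space At p"
  unfolding tangent_space_def
proof (intro CollectI conjI allI ballI impI)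
  fix d e assume "d \<in> charts_at At p" "e \<in> charts_at At p"
  then show "vec_of c p y e = dd (transition d e) (snd d p) (vec_of c p y d)"
    using transition_cocycle[of c d e p y] assms by (simp add: vec_of_def charts_at_def)
qed (simp add: vec_of_def)

lemma tangent_transform:
  "v \<in> tangent_space At p \<Longrightarrow> c \<in> At \<Longrightarrow> p \<in> fst c \<Longrightarrow> d \<in> At \<Longrightarrow> p \<in> fst d \<Longrightarrow>
    v d = dd (transition c d) (snd c p) (v c)"
  unfolding tangent_space_def charts_at_def by blast

lemma tangent_dummy: "v \<in> tangent_space At p \<Longrightarrow> d \<notin> charts_at At p \<Longrightarrow> v d = 0"
  unfolding tangent_space_def by blast

lemma vec_of_eq:
  assumes "c \<in> At" "p \<in> fst c" "v \<in> tangent_space At p"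
  shows "vec_of c p (v c) = v"
proof
  fix d show "vec_of c p (v c) d = v d"
    using tangent_transform[OF assms(3,1,2), of d] tangent_dummy[OF assms(3), of d]
    by (auto simp: vec_of_def charts_at_def)
qed

lemma vec_of_linear:
  "c \<in> At \<Longrightarrow> p \<in> fst c \<Longrightarrow>
    vec_of c p (r *\<^sub>R y + s *\<^sub>R z) = (\<lambda>d. r *\<^sub>R vec_of c p y d + s *\<^sub>R vec_of c p z d)"
  by (auto simp: vec_of_def charts_at_def fun_eq_iff linear_add[OF linear_transition] linear_cmul[OF linear_transition])

lemma tangent_bundle_iff: "(p, v) \<in> tangent_bundle At \<longleftrightarrow> p \<in> topspace M \<and> v \<in> tangent_space At p"
  by (simp add: tangent_bundle_def cover)

lemma tcoord_inv_tcoord: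
  assumes c: "c \<in> At" and V: "V \<in> over c (tangent_bundle At)"
  shows "tcoord_inv At c (tcoord c V) = V"
  unfolding tcoord_inv_def
proof (rule inv_into_f_f[OF inj_onI V])
  fix V1 V2 assume *: "V1 \<in> over c (tangent_bundle At)" "V2 \<in> over c (tangent_bundle At)" "tcoord c V1 = tcoord c V2"
  obtain p v q w where V: "V1 = (p, v)" "V2 = (q, w)" by (cases V1, cases V2)
  have "p \<in> fst c" "q \<in> fst c" "snd c p = snd c q" "v c = w c"
    "v \<in> tangent_space At p" "w \<in> tangent_space At q"
    using * V by (auto simp: over_def tcoord_def tangent_bundle_iff)
  moreover from this have "p = q" using inj_onD[OF inj_chart[OF c]] by blast
  ultimately have "v = w" using vec_of_eq[OF c] by metis
  with \<open>p = q\<close> show "V1 = V2" using V by simp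
qed

lemma tcoord_inv_eq:
  assumes c: "c \<in> At" "p \<in> fst c"
  shows "tcoord_inv At c (snd c p, y) = (p, vec_of c p y)"
proof -
  have "(p, vec_of c p y) \<in> over c (tangent_bundle At)"
    using c vec_of_tangent[OF c] chart_subset[OF c(1)] by (auto simp: over_def tangent_bundle_iff)
  from tcoord_inv_tcoord[OF c(1) this] show ?thesis by (simp add: tcoord_def vec_of_self[OF c])
qed

lemma coord_vec_eq: "c \<in> At \<Longrightarrow> p \<in> fst c \<Longrightarrow> coord_vec At c i (snd c p) = vec_of c p (axis i 1)"
  by (simp add: coord_vec_def tcoord_inv_eq)

definition one_form_comp where
  "one_form_comp b c i x = b (inv_into (fst c) (snd c) x) (coord_vec At c i x)"

lemma one_form_covector:
  assumes b: "one_form At W b" and c: "c \<in> At" "p \<in> fst c" "p \<in> W" and v: "v \<in> tangent_space At p"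
  shows "b p v = covector (one_form_comp b c) (snd c p) (v c)"
proof -
  have l: "b p (vec_of c p (r *\<^sub>R y + s *\<^sub>R z)) = r * b p (vec_of c p y) + s * b p (vec_of c p z)" for r s y z
    using b c(3) vec_of_tangent[OF c(1,2)] unfolding one_form_def vec_of_linear[OF c(1,2)] by blast
  have "linear (\<lambda>y. b p (vec_of c p y))"
    using l[of 1 _ 1] l[of _ _ 0] by (intro linearI) simp_all
  from linear_axis_sum[OF this, of "v c"]
  show ?thesis
    by (simp add: vec_of_eq[OF c(1,2) v] covector_def one_form_comp_def inv_chart c coord_vec_eq mult.commute)
qed

lemma metric_form:
  assumes h: "pseudo_riemannian_metric At W h" and c: "c \<in> At" "p \<in> fst c" "p \<in> W"
    and v: "v \<in> tangent_space At p" "w \<in> tangent_space At p"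
  shows "h p v w = form (metric_comp At h c) (snd c p) (v c) (w c)"
proof -
  define g where "g y z = h p (vec_of c p y) (vec_of c p z)" for y z
  note T = vec_of_tangent[OF c(1,2)]
  have l: "g (r *\<^sub>R y + s *\<^sub>R z) u = r * g y u + s * g z u" for r s y z u
    using h c(3) T unfolding pseudo_riemannian_metric_def g_def vec_of_linear[OF c(1,2)] by blast
  have s: "g y z = g z y" for y z
    using h c(3) T unfolding pseudo_riemannian_metric_def g_def by blast
  have "linear (\<lambda>y. g y z)" for z
    using l[of 1 _ 1] l[of _ _ 0] by (intro linearI) simp_all
  moreover from this have "linear (\<lambda>z. g y z)" for y by (subst s)
  ultimately have bg: "bilinear g" by (simp add: bilinear_def)
  have "bilinear (\<lambda>y z. g y z - form (metric_comp At h c) (snd c p) y z)"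
    using bg bilinear_form[of "metric_comp At h c" "snd c p"] by (auto simp: bilinear_def linear_iff algebra_simps)
  from bilinear_zero_if_zero_on_axes[OF this, of "v c" "w c"]
  have "g (v c) (w c) = form (metric_comp At h c) (snd c p) (v c) (w c)"
    by (simp add: form_axis_left sum_axis g_def metric_comp_def inv_chart c coord_vec_eq)
  then show ?thesis by (simp add: g_def vec_of_eq[OF c(1,2)] v)
qed

lemma metric_chart:
  assumes h: "pseudo_riemannian_metric At W h" and W: "openin M W" and c: "c \<in> At"
  shows "metric_chart (snd c ` (fst c \<inter> W)) (metric_comp At h c)"
proof
  show "open (snd c ` (fst c \<inter> W))" by (rule open_chart_image[OF c W])
  show "smooth_on (snd c ` (fst c \<inter> W)) (metric_comp At h c i j)" for i j
    using h c by (simp add: pseudo_riemannian_metric_def)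
next
  fix x assume "x \<in> snd c ` (fst c \<inter> W)"
  then obtain p where p: "p \<in> fst c" "p \<in> W" "x = snd c p" by blast
  note T = vec_of_tangent[OF c p(1)]
  show sym: "metric_comp At h c i j x = metric_comp At h c j i x" for i j
    unfolding metric_comp_def p(3) inv_chart[OF c p(1)] coord_vec_eq[OF c p(1)]
    using h p(2) T unfolding pseudo_riemannian_metric_def by blast
  have "v = 0" if v: "(\<chi> i j. metric_comp At h c i j x) *v v = 0" for v
  proof -
    have "form (metric_comp At h c) x w v = 0" for w
    proof -
      have "form (metric_comp At h c) x w v = (\<Sum>i\<in>UNIV. ((\<chi> i j. metric_comp At h c i j x) *v v) $ i * w $ i)"
        by (simp add: form_def matrix_vector_mult_def)
      then show ?thesis unfolding v by simp
    qed
    then have "form (metric_comp At h c) x v w = 0" for w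
      using form_commute[of "metric_comp At h c" x, OF sym] by metis
    then have "h p (vec_of c p v) w = 0" if "w \<in> tangent_space At p" for w
      using metric_form[OF h c p(1,2) T that, of v] by (simp add: p(3) vec_of_self[OF c p(1)])
    then have "vec_of c p v = (\<lambda>_. 0)"
      using h p(2) T unfolding pseudo_riemannian_metric_def by blast
    then show ?thesis using vec_of_self[OF c p(1), of v] by metis
  qed
  then show "invertible (\<chi> i j. metric_comp At h c i j x)"
    unfolding invertible_left_inverse matrix_left_invertible_ker by blast
qed

lemma (in metric_chart) levi_civita_lc:
  "levi_civita At g c k i j x = lc k i j x" if "metric_comp At g c = h"
  unfolding levi_civita_def lc_def hinv_def that ..

end

text \<open>An integral power of a negative number differs from the power of its absolute value by a
  sign at most, which the square removes; for all other exponents \<open>rpow_defined\<close> forces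
  t > 0. The connection depends only on \<open>F\<^sup>2\<close>, so nothing is lost.\<close>

lemma rpow_square:
  assumes "rpow_defined t e" "t \<noteq> 0"
  shows "(rpow t e)\<^sup>2 = \<bar>t\<bar> powr (2 * e)"
proof -
  have "\<bar>rpow t e\<bar> = \<bar>t\<bar> powr e"
  proof (cases "e \<in> \<int>")
    case True
    then obtain n :: int where n: "e = of_int n" by (auto elim: Ints_cases)
    show ?thesis
      using assms(2) by (simp add: rpow_def n power_int_abs[symmetric] powr_real_of_int')
  next
    case False
    then show ?thesis using assms by (auto simp: rpow_def rpow_defined_def)
  qed
  then have "(rpow t e)\<^sup>2 = (\<bar>t\<bar> powr e)\<^sup>2" by (metis power2_abs)
  then show ?thesis by (simp add: power2_eq_square powr_add[symmetric])
qed

lemma rpow_zero: "rpow_defined 0 e \<Longrightarrow> e \<noteq> 0 \<Longrightarrow> rpow 0 e = 0"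
  by (auto simp: rpow_def rpow_defined_def power_int_0_left elim!: Ints_cases)

section \<open>From a Kropina metric on the manifold to its charts\<close>

locale kropina_mfd = smooth_mfd M At for M :: "'a topology" and At :: "('a, 'n::finite) chart set" +
  fixes A :: "('a \<times> ('a, 'n) tvec) set"
    and F :: "'a \<times> ('a, 'n) tvec \<Rightarrow> real"
    and a :: "'a \<Rightarrow> ('a, 'n) tvec \<Rightarrow> ('a, 'n) tvec \<Rightarrow> real"
    and b :: "'a \<Rightarrow> ('a, 'n) tvec \<Rightarrow> real"
    and m :: real
  assumes dim: "CARD('n) > 2" and m: "m \<noteq> 0"
    and kropina: "kropina_metric M At A F m a b"
    and berwald: "berwald At A F"
begin

lemma finsler: "finsler_metric At A F"
  and riemannian: "pseudo_riemannian_metric At (topspace M) a"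
  and one_form: "one_form At (topspace M) b"
  using kropina by (simp_all add: kropina_metric_def)

lemma kropina_eq:
  assumes "(p, v) \<in> A"
  shows "rpow_defined (sqrt \<bar>a p v v\<bar>) (1 + m)" "rpow_defined (b p v) (- m)"
    "F (p, v) = rpow (sqrt \<bar>a p v v\<bar>) (1 + m) * rpow (b p v) (- m)"
  using kropina assms unfolding kropina_metric_def by blast+

lemma conic: "conic_subbundle At A"
  using finsler by (simp add: finsler_metric_def)

lemma A_subset: "A \<subseteq> tangent_bundle At"
  using conic unfolding conic_subbundle_def open_in_tangent_bundle_def by blast

lemma A_scale: "(p, v) \<in> A \<Longrightarrow> 0 < r \<Longrightarrow> (p, \<lambda>c. r *\<^sub>R v c) \<in> A"
  using conic unfolding conic_subbundle_def by blast

lemma F_scale: "(p, v) \<in> A \<Longrightarrow> 0 < r \<Longrightarrow> F (p, \<lambda>c. r *\<^sub>R v c) = r * F (p, v)"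
  using finsler unfolding finsler_metric_def by blast

lemma fst_A: "fst ` A = topspace M"
  using conic unfolding conic_subbundle_def cover by blast

definition \<Omega> where "\<Omega> c = tcoord c ` over c A"

abbreviation L where "L c \<equiv> local_rep At F c"

abbreviation G where "G c \<equiv> affine_connection At A F c"

lemma \<Omega>_iff:
  assumes "c \<in> At" "p \<in> fst c"
  shows "(snd c p, y) \<in> \<Omega> c \<longleftrightarrow> (p, vec_of c p y) \<in> A"
proof
  assume "(snd c p, y) \<in> \<Omega> c"
  then obtain q v where V: "(q, v) \<in> A" "q \<in> fst c" "snd c q = snd c p" "v c = y"
    by (auto simp: \<Omega>_def over_def tcoord_def)
  then have "q = p" using inj_onD[OF inj_chart[OF assms(1)]] assms(2) by blast
  moreover have "v \<in> tangent_space At q" using V(1) A_subset tangent_bundle_iff by blast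
  ultimately have "vec_of c p y = v" using vec_of_eq[OF assms, of v] V(4) by simp
  then show "(p, vec_of c p y) \<in> A" using V(1) \<open>q = p\<close> by simp
next
  assume "(p, vec_of c p y) \<in> A"
  then have "(p, vec_of c p y) \<in> over c A" using assms by (simp add: over_def)
  then have "tcoord c (p, vec_of c p y) \<in> \<Omega> c" unfolding \<Omega>_def by (rule imageI)
  then show "(snd c p, y) \<in> \<Omega> c" by (simp add: tcoord_def vec_of_self[OF assms])
qed

lemma \<Omega>_cases:
  assumes "c \<in> At" "(x, y) \<in> \<Omega> c"
  obtains p where "p \<in> fst c" "x = snd c p" "(p, vec_of c p y) \<in> A"
proof -
  obtain p where "p \<in> fst c" "x = snd c p" using assms(2) by (auto simp: \<Omega>_def over_def tcoord_def)
  then show ?thesis using \<Omega>_iff[OF assms(1)] assms(2) that by blast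
qed

lemma L_eq: "c \<in> At \<Longrightarrow> p \<in> fst c \<Longrightarrow> L c (snd c p, y) = F (p, vec_of c p y)"
  by (simp add: local_rep_def tcoord_inv_eq)

lemma vec_of_scale: "c \<in> At \<Longrightarrow> p \<in> fst c \<Longrightarrow> vec_of c p (r *\<^sub>R y) = (\<lambda>d. r *\<^sub>R vec_of c p y d)"
  using vec_of_linear[of c p r y 0] by simp

lemma berwald_chart:
  assumes c: "c \<in> At"
  shows "berwald_chart (\<Omega> c) (L c) (G c)"
proof
  show "open (\<Omega> c)"
    using conic c unfolding conic_subbundle_def open_in_tangent_bundle_def \<Omega>_def by blast
  show "smooth_on (\<Omega> c) (L c)"
    using finsler c unfolding finsler_metric_def \<Omega>_def by blast
  show "invertible (fundamental_tensor (L c) z)" if "z \<in> \<Omega> c" for z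
    using finsler c that unfolding finsler_metric_def \<Omega>_def by blast
next
  fix x y and r :: real assume z: "(x, y) \<in> \<Omega> c" "0 < r"
  then obtain p where p: "p \<in> fst c" "x = snd c p" "(p, vec_of c p y) \<in> A" using \<Omega>_cases[OF c] by blast
  show "(x, r *\<^sub>R y) \<in> \<Omega> c"
    using A_scale[OF p(3) z(2)] by (simp add: p(2) \<Omega>_iff[OF c p(1)] vec_of_scale[OF c p(1)])
  show "L c (x, r *\<^sub>R y) = r * L c (x, y)"
    using F_scale[OF p(3) z(2)] by (simp add: p(2) L_eq[OF c p(1)] vec_of_scale[OF c p(1)])
next
  fix x y k i assume z: "(x, y) \<in> \<Omega> c"
  have "\<exists>G. berwald_coeffs At A F c G" using berwald c by (simp add: berwald_def)
  then have "berwald_coeffs At A F c (G c)" unfolding affine_connection_def by (rule someI_ex)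
  then show "nonlin_conn (L c) k i (x, y) = (\<Sum>j\<in>UNIV. G c k i j x * y $ j)"
    using z unfolding berwald_coeffs_def \<Omega>_def by blast
qed

text \<open>Every point of the chart carries a vector of the cone because a conic subbundle projects
  onto all of the manifold.\<close>

lemma dom_eq:
  assumes c: "c \<in> At"
  shows "berwald_chart.dom (\<Omega> c) = snd c ` fst c"
proof -
  interpret berwald_chart "\<Omega> c" "L c" "G c" by (rule berwald_chart[OF c])
  have "x \<in> dom" if x: "x \<in> snd c ` fst c" for x
  proof -
    obtain p where p: "p \<in> fst c" "x = snd c p" using x by blast
    then have "p \<in> fst ` A" using chart_subset[OF c] fst_A by blast
    then obtain v where v: "(p, v) \<in> A" by force
    then have "(p, vec_of c p (v c)) \<in> A"
      using vec_of_eq[OF c p(1)] A_subset tangent_bundle_iff by (metis subsetD)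
    then show ?thesis using in_dom \<Omega>_iff[OF c p(1)] p(2) by blast
  qed
  then show ?thesis using \<Omega>_cases[OF c] by (force simp: dom_def)
qed

lemma metric_chart_a: "c \<in> At \<Longrightarrow> metric_chart (snd c ` fst c) (metric_comp At a c)"
  using metric_chart[OF riemannian openin_topspace] chart_subset by (metis Int_absorb2)

lemma weyl_exists:
  assumes c: "c \<in> At" and x: "x \<in> snd c ` fst c"
  shows "\<exists>\<kappa>. berwald_chart.weyl_at (G c) (metric_comp At a c) x \<kappa>"
proof -
  interpret berwald_chart "\<Omega> c" "L c" "G c" by (rule berwald_chart[OF c])
  have repr: "\<exists>p v. (p, v) \<in> A \<and> E (x, y) = (F (p, v))\<^sup>2 \<and> a p v v = form (metric_comp At a c) x y y
      \<and> b p v = covector (one_form_comp b c) x y" if z: "(x, y) \<in> \<Omega> c" for x y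
  proof -
    obtain p where p: "p \<in> fst c" "x = snd c p" "(p, vec_of c p y) \<in> A" by (rule \<Omega>_cases[OF c z])
    have "p \<in> topspace M" using p(1) chart_subset[OF c] by blast
    then show ?thesis
      using p metric_form[OF riemannian c p(1)] one_form_covector[OF one_form c p(1)] vec_of_tangent[OF c p(1)]
      by (intro exI[of _ p] exI[of _ "vec_of c p y"]) (simp add: E_def L_eq[OF c] vec_of_self[OF c])
  qed
  have "\<exists>\<kappa>. weyl_at (metric_comp At a c) x \<kappa>"
  proof (rule kropina_weyl[where h = "metric_comp At a c" and b = "one_form_comp b c" and m = m and x = x])
    show "metric_chart dom (metric_comp At a c)" using metric_chart_a[OF c] by (simp add: dom_eq[OF c])
    show "smooth_on dom (one_form_comp b c i)" for i
    proof -
      have "smooth_on (snd c ` (fst c \<inter> topspace M)) (one_form_comp b c i)"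
        using one_form c unfolding one_form_def one_form_comp_def by blast
      then show ?thesis using chart_subset[OF c] by (simp add: dom_eq[OF c] Int_absorb2)
    qed
    show "CARD('n) > 2" by (rule dim)
    show "m \<noteq> 0" by (rule m)
    show "x \<in> dom" using x by (simp add: dom_eq[OF c])
  next
    fix x y assume z: "(x, y) \<in> \<Omega> c" and ne: "form (metric_comp At a c) x y y \<noteq> 0" "covector (one_form_comp b c) x y \<noteq> 0"
    obtain p v where V: "(p, v) \<in> A" "E (x, y) = (F (p, v))\<^sup>2" "a p v v = form (metric_comp At a c) x y y"
      "b p v = covector (one_form_comp b c) x y" using repr[OF z] by blast
    have "E (x, y) = (rpow (sqrt \<bar>a p v v\<bar>) (1 + m))\<^sup>2 * (rpow (b p v) (- m))\<^sup>2"
      by (simp add: V(2) kropina_eq(3)[OF V(1)] power_mult_distrib)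
    also have "\<dots> = sqrt \<bar>a p v v\<bar> powr (2 * (1 + m)) * \<bar>b p v\<bar> powr (2 * - m)"
      using rpow_square[OF kropina_eq(1)[OF V(1)]] rpow_square[OF kropina_eq(2)[OF V(1)]] ne V(3,4) by simp
    \<comment> \<open>The square root in \<alpha> halves the exponent that squaring \<open>F\<close>
      has doubled; for \<beta> the exponent - 2 m remains.\<close>
    also have "sqrt \<bar>a p v v\<bar> powr (2 * (1 + m)) = \<bar>a p v v\<bar> powr (1 + m)"
      by (simp add: powr_half_sqrt[symmetric] powr_powr add_divide_distrib)
    finally show "E (x, y) = \<bar>form (metric_comp At a c) x y y\<bar> powr (1 + m) * \<bar>covector (one_form_comp b c) x y\<bar> powr (- 2 * m)"
      by (simp add: V(3,4))
  next
    fix x y assume z: "(x, y) \<in> \<Omega> c" and 0: "\<And>i. one_form_comp b c i x = 0"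
    obtain p v where V: "(p, v) \<in> A" "E (x, y) = (F (p, v))\<^sup>2"
      "b p v = covector (one_form_comp b c) x y" using repr[OF z] by blast
    have "b p v = 0" using V(3) 0 by (simp add: covector_def)
    \<comment> \<open>At a zero of \<beta> the power is defined only for - m \<ge> 0; since m is
      nonzero the exponent is positive and \<open>F\<close> vanishes.\<close>
    then have "rpow (b p v) (- m) = 0" using kropina_eq(2)[OF V(1)] rpow_zero[of "- m"] m by simp
    then show "E (x, y) = 0" by (simp add: V(2) kropina_eq(3)[OF V(1)])
  qed blast
  then show ?thesis .
qed

text \<open>The formula of \<open>weyl_trace\<close> solved for \<kappa>. As a definition it is
  smooth by construction; that it agrees with the pointwise Weyl factor is the content of
  \<open>weyl\<close>.\<close>

definition \<kappa> where
  "\<kappa> c k x = (metric_chart.vol (metric_comp At a c) k x - 2 * (\<Sum>l\<in>UNIV. G c l l k x)) / real CARD('n)"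

lemma G_sym: "c \<in> At \<Longrightarrow> x \<in> snd c ` fst c \<Longrightarrow> G c k i j x = G c k j i x"
  using berwald_chart.G_sym[OF berwald_chart] dom_eq by blast

lemma smooth_G: "c \<in> At \<Longrightarrow> smooth_on (snd c ` fst c) (G c k i j)"
  using berwald_chart.smooth_G[OF berwald_chart] dom_eq by metis

lemma weyl:
  assumes c: "c \<in> At" and x: "x \<in> snd c ` fst c"
  shows "berwald_chart.weyl_at (G c) (metric_comp At a c) x (\<lambda>k. \<kappa> c k x)"
proof -
  have G_sym': "G c k i j x = G c k j i x" for k i j by (rule G_sym[OF c x])
  interpret berwald_chart "\<Omega> c" "L c" "G c" by (rule berwald_chart[OF c])
  interpret h: metric_chart "snd c ` fst c" "metric_comp At a c" by (rule metric_chart_a[OF c])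
  obtain \<kappa>' where \<kappa>': "weyl_at (metric_comp At a c) x \<kappa>'" using weyl_exists[OF c x] by blast
  have "\<kappa>' k = \<kappa> c k x" for k
    using h.weyl_trace[OF x, of k "G c" "\<kappa>' k"] \<kappa>' G_sym'[of _ k] unfolding weyl_at_def \<kappa>_def by simp
  then show ?thesis using \<kappa>' by (metis ext)
qed

lemma smooth_\<kappa>:
  assumes c: "c \<in> At"
  shows "smooth_on (snd c ` fst c) (\<kappa> c k)"
proof -
  interpret h: metric_chart "snd c ` fst c" "metric_comp At a c" by (rule metric_chart_a[OF c])
  show ?thesis
    unfolding \<kappa>_def[abs_def] divide_inverse
    by (intro smooth_on_mult smooth_on_diff smooth_on_sum h.open_dom h.smooth_vol smooth_on_const smooth_G c)
qed

lemma affine_ricci_antisym_chart: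
  assumes c: "c \<in> At" and x: "x \<in> V" and V: "open V" "V \<subseteq> snd c ` fst c"
  shows "affine_ricci (G c) l k x - affine_ricci (G c) k l x =
    pd l (\<lambda>x. \<Sum>i\<in>UNIV. G c i i k x) x - pd k (\<lambda>x. \<Sum>i\<in>UNIV. G c i i l x) x"
  by (rule affine_ricci_antisym[OF V(1) x]) (use V(2) smooth_on_subset[OF smooth_G[OF c]] G_sym[OF c] in blast)+

lemma finsler_ricci_eq:
  "c \<in> At \<Longrightarrow> (x, y) \<in> \<Omega> c \<Longrightarrow>
    finsler_ricci_tensor (L c) i j (x, y) = 1/2 * (affine_ricci (G c) i j x + affine_ricci (G c) j i x)"
  by (rule berwald_chart.finsler_ricci_tensor_eq[OF berwald_chart])

lemma \<Omega>_in_range: "c \<in> At \<Longrightarrow> (x, y) \<in> \<Omega> c \<Longrightarrow> x \<in> snd c ` fst c"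
  using \<Omega>_cases by blast

section \<open>Ricci-flatness and local metrizability\<close>

lemma ricci_flat_if_affinely_ricci_flat:
  assumes "affinely_ricci_flat At A F"
  shows "ricci_flat At A F"
  unfolding ricci_flat_def \<Omega>_def[symmetric]
proof (intro ballI allI)
  fix c z i j assume c: "c \<in> At" and z: "z \<in> \<Omega> c"
  obtain x y where xy: "z = (x, y)" by (cases z)
  have "affine_ricci (G c) i j x = 0" for i j
    using assms c \<Omega>_in_range[OF c] z xy unfolding affinely_ricci_flat_def by blast
  then show "finsler_ricci_tensor (L c) i j z = 0"
    using finsler_ricci_eq[OF c, of x y i j] z xy by simp
qed

lemma affinely_ricci_flat_if_metrizable:
  assumes met: "locally_metrizable M At A F" and flat: "ricci_flat At A F"
  shows "affinely_ricci_flat At A F"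
  unfolding affinely_ricci_flat_def
proof (intro ballI allI)
  fix c x i j assume c: "c \<in> At" and x: "x \<in> snd c ` fst c"
  obtain p where p: "p \<in> fst c" "x = snd c p" using x by blast
  then have "p \<in> topspace M" using chart_subset[OF c] by blast
  from bspec[OF met[unfolded locally_metrizable_def] this] obtain W h where W: "openin M W" "p \<in> W" and h: "pseudo_riemannian_metric At W h"
    and lc': "\<forall>c\<in>At. \<forall>x\<in>snd c ` (fst c \<inter> W). \<forall>k i j. levi_civita At h c k i j x = G c k i j x"
    by (elim exE conjE) (rule that)
  define V where "V = snd c ` (fst c \<inter> W)"
  interpret h: metric_chart V "metric_comp At h c" unfolding V_def by (rule metric_chart[OF h W(1) c])
  have lc: "levi_civita At h c k i j x = G c k i j x" if "x \<in> V" for k i j x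
    using lc' c that unfolding V_def by blast
  have xV: "x \<in> V" unfolding V_def using p W(2) by blast
  have "(\<Sum>i\<in>UNIV. G c i i k x) = 1/2 * h.vol k x" if "x \<in> V" for k x
    using h.lc_trace[OF that, of k] by (simp add: lc[OF that] h.levi_civita_lc[OF refl, symmetric])
  then have "pd l (\<lambda>x. \<Sum>i\<in>UNIV. G c i i k x) x = pd l (\<lambda>x. 1/2 * h.vol k x) x" for k l
    by (rule pd_cong[OF h.open_dom xV])
  also have "pd l (\<lambda>x. 1/2 * h.vol k x) x = 1/2 * pd l (h.vol k) x" for k l
    unfolding pd_dd by (rule dd_cmult[OF smooth_on_differentiable[OF h.smooth_vol xV]])
  finally have tr: "pd l (\<lambda>x. \<Sum>i\<in>UNIV. G c i i k x) x = 1/2 * pd l (h.vol k) x" for k l .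
  have "V \<subseteq> snd c ` fst c" by (auto simp: V_def)
  from affine_ricci_antisym_chart[OF c xV h.open_dom this]
  have "affine_ricci (G c) l k x - affine_ricci (G c) k l x = 0" for l k
    unfolding tr by (simp add: h.vol_closed[OF xV, of l k])
  from this[of i j] have sym: "affine_ricci (G c) i j x = affine_ricci (G c) j i x" by simp
  \<comment> \<open>Ricci-flatness speaks of points of the cone only, so a fibre vector over x is
    required to use it.\<close>
  have "x \<in> berwald_chart.dom (\<Omega> c)" using x by (simp add: dom_eq[OF c])
  then obtain y where z: "(x, y) \<in> \<Omega> c" using berwald_chart.dom_fibre[OF berwald_chart[OF c]] by blast
  have "finsler_ricci_tensor (L c) i j (x, y) = 0"
    using flat c z unfolding ricci_flat_def \<Omega>_def by blast
  then show "affine_ricci (G c) i j x = 0" using finsler_ricci_eq[OF c z, of i j] sym by simp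
qed

lemma \<kappa>_closed:
  assumes flat: "affinely_ricci_flat At A F" and c: "c \<in> At" and x: "x \<in> snd c ` fst c"
  shows "pd j (\<kappa> c k) x = pd k (\<kappa> c j) x"
proof -
  interpret h: metric_chart "snd c ` fst c" "metric_comp At a c" by (rule metric_chart_a[OF c])
  define t where "t k x = (\<Sum>l\<in>UNIV. G c l l k x)" for k x
  have t: "smooth_on (snd c ` fst c) (t k)" for k
    unfolding t_def[abs_def] by (intro smooth_on_sum h.open_dom smooth_G c)
  have "affine_ricci (G c) i j x = 0" for i j
    using flat c x unfolding affinely_ricci_flat_def by blast
  then have "pd j (t k) x = pd k (t j) x" for j k
    using affine_ricci_antisym_chart[OF c x h.open_dom subset_refl, of j k] by (simp add: t_def[abs_def])
  moreover have "pd j (\<kappa> c k) x = inverse (real CARD('n)) * (pd j (h.vol k) x - 2 * pd j (t k) x)" for j k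
  proof -
    have "\<kappa> c k = (\<lambda>x. inverse (real CARD('n)) * (h.vol k x - 2 * t k x))"
      by (simp add: fun_eq_iff \<kappa>_def t_def divide_inverse mult.commute)
    then show ?thesis
      unfolding pd_dd using smooth_on_differentiable[OF t x] smooth_on_differentiable[OF h.smooth_vol x]
      by (simp add: dd_cmult dd_diff differentiable_diff differentiable_mult)
  qed
  ultimately show ?thesis by (simp add: h.vol_closed[OF x, of j k])
qed

text \<open>The local expressions of \<kappa> form a 1-form. A potential found in one chart
  therefore has differential \<kappa> in all charts.\<close>

lemma \<kappa>_transform:
  assumes c: "c \<in> At" "d \<in> At" and p: "p \<in> fst c" "p \<in> fst d"
  shows "(\<Sum>k\<in>UNIV. \<kappa> c k (snd c p) * u $ k) = (\<Sum>k\<in>UNIV. \<kappa> d k (snd d p) * dd (transition c d) (snd c p) u $ k)"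
proof -
  let ?S = "snd c ` (fst c \<inter> fst d)" and ?\<phi> = "transition c d"
  interpret c: berwald_chart "\<Omega> c" "L c" "G c" by (rule berwald_chart[OF c(1)])
  interpret d: berwald_chart "\<Omega> d" "L d" "G d" by (rule berwald_chart[OF c(2)])
  have chg: "vec_of d q (dd ?\<phi> (snd c q) y) = vec_of c q y" if "q \<in> fst c" "q \<in> fst d" for q y
    using vec_of_eq[OF c(2) that(2) vec_of_tangent[OF c(1) that(1)], of y] that c
    by (simp add: vec_of_def charts_at_def)
  interpret berwald_transition "\<Omega> c" "\<Omega> d" "L c" "L d" "G c" "G d" ?\<phi> ?S
  proof
    show "open ?S" by (rule open_overlap[OF c])
    show "?S \<subseteq> c.dom" by (auto simp: dom_eq[OF c(1)])
    show "smooth_on ?S ?\<phi>" by (rule smooth_transition[OF c])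
  next
    fix x assume "x \<in> ?S"
    then obtain q where q: "q \<in> fst c" "q \<in> fst d" "x = snd c q" by blast
    \<comment> \<open>The differential of the reverse transition is a right inverse, by the chain
      rule.\<close>
    have "v = dd ?\<phi> x (dd (transition d c) (snd d q) v)" for v
      using transition_cocycle[OF c(2) c(1) c(2) q(2,1,2)] transition_self[OF c(2) q(2)] q(3) by simp
    then show "surj (dd ?\<phi> x)" by (rule surjI[OF sym])
    fix y assume "(x, y) \<in> \<Omega> c"
    then have "(q, vec_of c q y) \<in> A" using q(3) \<Omega>_iff[OF c(1) q(1)] by simp
    then show "(?\<phi> x, dd ?\<phi> x y) \<in> \<Omega> d"
      using q transition_chart[OF c(1) q(1)] \<Omega>_iff[OF c(2) q(2)] chg[OF q(1,2)] by simp
    show "L c (x, y) = L d (?\<phi> x, dd ?\<phi> x y)"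
      using q transition_chart[OF c(1) q(1)] L_eq[OF c(1) q(1)] L_eq[OF c(2) q(2)] chg[OF q(1,2)] by simp
  qed
  have "form (metric_comp At a c) x y y = form (metric_comp At a d) (?\<phi> x) (dd ?\<phi> x y) (dd ?\<phi> x y)" if x: "x \<in> ?S" for x y
  proof -
    obtain q where q: "q \<in> fst c" "q \<in> fst d" "x = snd c q" using x by blast
    have "q \<in> topspace M" using q chart_subset[OF c(1)] by blast
    moreover have "vec_of c q y d = dd ?\<phi> (snd c q) y" by (simp add: vec_of_def charts_at_def c q(2))
    ultimately show ?thesis
      using metric_form[OF riemannian c(1) q(1) _ vec_of_tangent[OF c(1) q(1)] vec_of_tangent[OF c(1) q(1)], of y y]
        metric_form[OF riemannian c(2) q(2) _ vec_of_tangent[OF c(2) q(2)] vec_of_tangent[OF c(2) q(2)], of "dd ?\<phi> x y" "dd ?\<phi> x y"]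
      by (simp add: q(3) vec_of_self[OF c(1) q(1)] vec_of_self[OF c(2) q(2)] chg[OF q(1,2)] transition_chart[OF c(1) q(1)])
  qed
  from weyl_transform[of "metric_comp At a c" "metric_comp At a d" "snd c p", OF _ _ _ _ _ this]
  show ?thesis
    using metric_chart_a[OF c(1)] metric_chart_a[OF c(2)] weyl[OF c(1)] weyl[OF c(2)] p
    by (simp add: dom_eq[OF c(1)] dom_eq[OF c(2)] transition_chart[OF c(1)])
qed

lemma metrizable_if_affinely_ricci_flat:
  assumes flat: "affinely_ricci_flat At A F"
  shows "locally_metrizable M At A F"
  unfolding locally_metrizable_def
proof
  fix p assume "p \<in> topspace M"
  then obtain d where d: "d \<in> At" "p \<in> fst d" using cover by blast
  \<comment> \<open>A ball in the image of the chart, in order to have a convex domain for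
    \<open>poincare\<close>.\<close>
  obtain e where e: "0 < e" "ball (snd d p) e \<subseteq> snd d ` fst d"
    using open_chart_range[OF d(1)] d(2) open_contains_ball by (metis imageI)
  define B where "B = ball (snd d p) e"
  obtain \<psi> where \<psi>: "\<And>x. x \<in> B \<Longrightarrow> (\<psi> has_derivative (\<lambda>u. \<Sum>k\<in>UNIV. \<kappa> d k x * u $ k)) (at x)"
  proof (rule poincare[of B "\<kappa> d"])
    show "open B" "convex B" by (simp_all add: B_def)
    show "smooth_on B (\<kappa> d k)" for k
      using smooth_on_subset[OF smooth_\<kappa>[OF d(1)]] e(2) by (simp add: B_def)
    show "pd j (\<kappa> d k) x = pd k (\<kappa> d j) x" if "x \<in> B" for x j k
      using \<kappa>_closed[OF flat d(1)] e(2) that by (auto simp: B_def)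
  qed blast
  define W where "W = {q \<in> fst d. snd d q \<in> B}"
  \<comment> \<open>The conformal factor is dictated by \<open>\<nabla>(exp (- \<psi>) a) = exp (-
    \<psi>) (\<kappa> - d\<psi>) \<otimes> a\<close>, which vanishes for
    \<open>d\<psi> = \<kappa>\<close>.\<close>
  define h where "h q v w = exp (- \<psi> (snd d q)) * a q v w" for q v w
  have W: "openin M W" "p \<in> W"
    unfolding W_def using openin_chart_vimage[OF d(1), of B] d(2) e(1) by (simp_all add: B_def)
  have WM: "W \<subseteq> topspace M" using chart_subset[OF d(1)] by (auto simp: W_def)
  have comp: "metric_comp At h c i j x = exp (- 1 * \<psi> (transition c d x)) * metric_comp At a c i j x"
    if "c \<in> At" "x \<in> snd c ` (fst c \<inter> W)" for c i j x
    using that by (auto simp: metric_comp_def h_def inv_chart transition_chart)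
  \<comment> \<open>Read in an arbitrary chart c, the potential built in d has differential
    \<open>\<kappa> c\<close>; this is where the transformation law is used.\<close>
  have der: "((\<lambda>x. \<psi> (transition c d x)) has_derivative (\<lambda>u. \<Sum>k\<in>UNIV. \<kappa> c k x * u $ k)) (at x)"
    if c: "c \<in> At" and x: "x \<in> snd c ` (fst c \<inter> W)" for c x
  proof -
    obtain q where q: "q \<in> fst c" "q \<in> W" "x = snd c q" using x by blast
    then have q': "q \<in> fst d" "snd d q \<in> B" by (auto simp: W_def)
    have "(\<psi> has_derivative (\<lambda>u. \<Sum>k\<in>UNIV. \<kappa> d k (snd d q) * u $ k)) (at (transition c d x))"
      using \<psi>[OF q'(2)] by (simp add: q(3) transition_chart[OF c q(1)])
    from has_derivative_compose[OF transition_has_derivative[OF c d(1) q(1) q'(1)] this[unfolded q(3)]]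
    show ?thesis unfolding q(3) \<kappa>_transform[OF c d(1) q(1) q'(1)] .
  qed
  have sm: "smooth_on (snd c ` (fst c \<inter> W)) (\<lambda>x. \<psi> (transition c d x))" if c: "c \<in> At" for c
  proof (rule smooth_on_if_derivative[OF open_chart_image[OF c W(1)] der[OF c]])
    have "smooth_on (snd c ` (fst c \<inter> W)) (\<kappa> c k)" for k
      by (rule smooth_on_subset[OF smooth_\<kappa>[OF c]]) auto
    then show "smooth_on (snd c ` (fst c \<inter> W)) (\<lambda>x. \<Sum>k\<in>UNIV. \<kappa> c k x * v $ k)" for v
      by (intro smooth_on_sum smooth_on_mult smooth_on_const open_chart_image[OF c W(1)])
  qed
  have riem: "pseudo_riemannian_metric At W h"
    unfolding pseudo_riemannian_metric_def
  proof (intro conjI ballI allI impI)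
    fix q u v w r s assume q: "q \<in> W" and v: "u \<in> tangent_space At q" "v \<in> tangent_space At q" "w \<in> tangent_space At q"
    have "a q (\<lambda>c. r *\<^sub>R u c + s *\<^sub>R v c) w = r * a q u w + s * a q v w"
      using riemannian q WM v unfolding pseudo_riemannian_metric_def by blast
    then show "h q (\<lambda>c. r *\<^sub>R u c + s *\<^sub>R v c) w = r * h q u w + s * h q v w"
      by (simp add: h_def algebra_simps)
  next
    fix q v w assume q: "q \<in> W" and v: "v \<in> tangent_space At q" "w \<in> tangent_space At q"
    have "a q v w = a q w v"
      using riemannian q WM v unfolding pseudo_riemannian_metric_def by blast
    then show "h q v w = h q w v" by (simp add: h_def)
  next
    fix q v assume q: "q \<in> W" and v: "v \<in> tangent_space At q" and "\<forall>w\<in>tangent_space At q. h q v w = 0"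
    then have "\<forall>w\<in>tangent_space At q. a q v w = 0" by (simp add: h_def)
    then show "v = (\<lambda>_. 0)"
      using riemannian q WM v unfolding pseudo_riemannian_metric_def by blast
  next
    fix c i j assume c: "c \<in> At"
    note O = open_chart_image[OF c W(1)]
    have "smooth_on (snd c ` fst c) (metric_comp At a c i j)"
      by (rule metric_chart.smooth[OF metric_chart_a[OF c]])
    then have "smooth_on (snd c ` (fst c \<inter> W)) (metric_comp At a c i j)"
      by (rule smooth_on_subset) auto
    then have "smooth_on (snd c ` (fst c \<inter> W)) (\<lambda>x. exp (- 1 * \<psi> (transition c d x)) * metric_comp At a c i j x)"
      by (intro smooth_on_mult[OF O] smooth_on_exp[OF O] smooth_on_const sm[OF c])
    then show "smooth_on (snd c ` (fst c \<inter> W)) (metric_comp At h c i j)"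
      by (rule smooth_on_cong[OF O, rotated]) (simp only: comp[OF c])
  qed
  have "levi_civita At h c k i j x = G c k i j x" if c: "c \<in> At" and x: "x \<in> snd c ` (fst c \<inter> W)" for c k i j x
  proof -
    interpret h: metric_chart "snd c ` (fst c \<inter> W)" "metric_comp At h c" by (rule metric_chart[OF riem W(1) c])
    interpret berwald_chart "\<Omega> c" "L c" "G c" by (rule berwald_chart[OF c])
    have xc: "x \<in> snd c ` fst c" using x by blast
    define f where "f x = exp (- 1 * \<psi> (transition c d x))" for x
    have df: "(f has_derivative (\<lambda>u. f x * (- 1 * (\<Sum>k\<in>UNIV. \<kappa> c k x * u $ k)))) (at x)"
      unfolding f_def[abs_def]
      by (rule has_derivative_eq_rhs[OF has_derivative_exp[OF has_derivative_mult_right[OF der[OF c x]]]]) (simp add: fun_eq_iff)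
    \<comment> \<open>The metric is parallel: the derivative of the conformal factor cancels the
      Weyl term. As the connection is symmetric, \<open>lc_unique\<close> identifies it with the
      Levi-Civita connection.\<close>
    have "pd k (metric_comp At h c i j) x =
        (\<Sum>l\<in>UNIV. G c l k i x * metric_comp At h c l j x) + (\<Sum>l\<in>UNIV. G c l k j x * metric_comp At h c i l x)" for i j k
    proof -
      have "pd k (metric_comp At h c i j) x = pd k (\<lambda>x. f x * metric_comp At a c i j x) x"
        by (rule pd_cong[OF h.open_dom x]) (simp only: comp[OF c] f_def)
      also have "\<dots> = f x * pd k (metric_comp At a c i j) x + pd k f x * metric_comp At a c i j x"
        unfolding pd_dd using df
        by (intro dd_mult smooth_on_differentiable[OF metric_chart.smooth[OF metric_chart_a[OF c]] xc])
          (auto simp: differentiable_def)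
      also have "pd k f x = - f x * \<kappa> c k x"
        unfolding pd_dd dd_eqI[OF df] by (simp add: sum_axis)
      also have "f x * pd k (metric_comp At a c i j) x + - f x * \<kappa> c k x * metric_comp At a c i j x =
          f x * (\<Sum>l\<in>UNIV. G c l k i x * metric_comp At a c l j x) + f x * (\<Sum>l\<in>UNIV. G c l k j x * metric_comp At a c i l x)"
        using weyl[OF c xc] by (simp add: weyl_at_def algebra_simps)
      finally show ?thesis
        by (simp add: comp[OF c x] f_def sum_distrib_left mult.left_commute)
    qed
    then have "h.lc k i j x = G c k i j x"
      by (intro h.lc_unique[OF x G_sym]) (simp_all add: dom_eq[OF c] xc)
    then show ?thesis by (simp add: h.levi_civita_lc[OF refl])
  qed
  then have "\<forall>c\<in>At. \<forall>x\<in>snd c ` (fst c \<inter> W). \<forall>k i j. levi_civita At h c k i j x = G c k i j x"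
    by (intro ballI allI)
  with W riem show "\<exists>W h. openin M W \<and> p \<in> W \<and> pseudo_riemannian_metric At W h \<and>
      (\<forall>c\<in>At. \<forall>x\<in>snd c ` (fst c \<inter> W). \<forall>k i j. levi_civita At h c k i j x = G c k i j x)"
    by (intro exI[of _ W] exI[of _ h] conjI)
qed

end

theorem proposition22:
  fixes M :: "'a topology"
    and At :: "('a, 'n::finite) chart set"
    and A :: "('a \<times> ('a, 'n) tvec) set"
    and F :: "'a \<times> ('a, 'n) tvec \<Rightarrow> real"
    and a :: "'a \<Rightarrow> ('a, 'n) tvec \<Rightarrow> ('a, 'n) tvec \<Rightarrow> real"
    and b :: "'a \<Rightarrow> ('a, 'n) tvec \<Rightarrow> real"
    and m :: real
  assumes "smooth_manifold M At"
    and "CARD('n) > 2"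
    and "m \<noteq> 0"
    and "kropina_metric M At A F m a b"
    and "berwald At A F"
  shows "affinely_ricci_flat At A F \<longleftrightarrow> locally_metrizable M At A F \<and> ricci_flat At A F"
proof -
  interpret kropina_mfd M At A F a b m
    by unfold_locales (rule assms)+
  show ?thesis
  proof (intro iffI conjI)
    assume flat: "affinely_ricci_flat At A F"
    show "locally_metrizable M At A F" by (rule metrizable_if_affinely_ricci_flat[OF flat])
    show "ricci_flat At A F" by (rule ricci_flat_if_affinely_ricci_flat[OF flat])
  next
    assume "locally_metrizable M At A F \<and> ricci_flat At A F"
    then show "affinely_ricci_flat At A F" by (elim conjE) (rule affinely_ricci_flat_if_metrizable)
  qed
qed

end
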